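(* Let $0<q<m$ be coprime integers. Assume that $\frac1m(1,q)$ admits an involution $\tau$ such that $\frac1m(1,q)/\langle\tau\rangle$ is either a cyclic quotient singularity $\frac{1}{m_0}(1,q_0)$ or a nonsingular point. Then the quotient is one of: (a) a nonsingular point, which can happen only when $q=m-1$; (b) $m_0=2m$ and $q_0\in\{q,\,m+q\}$; (c) $m_0=m$ and $q_0=2q$; (d) $m_0=m/2$ and $q_0=q$; (e) $m_0=\frac{m}{\gcd(q+1,m)}$ and $q_0=\frac{q+1}{\gcd(q+1,m)}$, which happens only when $q^2\equiv1\pmod m$ and $q\ne m-1$.
   Context: For coprime $0<q<m$, $\frac1m(1,q)$ denotes the cyclic quotient singularity, the germ at the origin of $\mathbb{C}^2/\mu_m$ where $\zeta$ acts by $(x,y)\mapsto(\zeta x,\zeta^q y)$.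
   Formalization: In (b) and (c), 1/m0(1,q0) means C^2/mu_{m0} with q0 taken mod m0 and not necessarily coprime to m0; with coprimality the list misses 1/5(1,2) modulo (x,y)->(-x,y), which is 1/5(1,1), i.e. the non-reduced 1/10(1,2). *)

theory Defs
  imports "HOL-Analysis.Analysis" "HOL-Number_Theory.Number_Theory"
begin

text \<open>Complex analytic germs are encoded by their local rings of holomorphic
functions (anti-equivalence between germs of complex spaces and analytic algebras).
A bivariate power series sum a i j x^i y^j is a function nat => nat => complex.\<close>

type_synonym ps2 = "nat \<Rightarrow> nat \<Rightarrow> complex"

definition convergent_ps2 :: "ps2 \<Rightarrow> bool" where
  "convergent_ps2 a \<longleftrightarrow>
     (\<exists>r::real. r > 0 \<and> (\<lambda>(i,j). norm (a i j) * r ^ (i + j)) summable_on UNIV)"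

definition ps2_add :: "ps2 \<Rightarrow> ps2 \<Rightarrow> ps2" where
  "ps2_add a b = (\<lambda>i j. a i j + b i j)"

definition ps2_smult :: "complex \<Rightarrow> ps2 \<Rightarrow> ps2" where
  "ps2_smult c a = (\<lambda>i j. c * a i j)"

definition ps2_mult :: "ps2 \<Rightarrow> ps2 \<Rightarrow> ps2" where
  "ps2_mult a b = (\<lambda>i j. \<Sum>k\<le>i. \<Sum>l\<le>j. a k l * b (i - k) (j - l))"

definition ps2_one :: ps2 where
  "ps2_one = (\<lambda>i j. if i = 0 \<and> j = 0 then 1 else 0)"

text \<open>The analytic local ring of the cyclic quotient singularity 1/m(1,q):
the mu_m-invariant convergent power series, where zeta acts by
(x,y) |-> (zeta x, zeta^q y); x^i y^j is invariant iff m divides i + q j.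
For m = 1 (or m dividing q) this is C{x,y}, the ring of a nonsingular point.\<close>

definition cqs_ring :: "nat \<Rightarrow> nat \<Rightarrow> ps2 set" where
  "cqs_ring m q = {a. convergent_ps2 a \<and> (\<forall>i j. a i j \<noteq> 0 \<longrightarrow> m dvd (i + q * j))}"

definition smooth_ring :: "ps2 set" where
  "smooth_ring = {a. convergent_ps2 a}"

text \<open>C-algebra homomorphisms between subalgebras of convergent power series
(morphisms of the corresponding germs, in the opposite direction).\<close>

definition alg_hom :: "ps2 set \<Rightarrow> ps2 set \<Rightarrow> (ps2 \<Rightarrow> ps2) \<Rightarrow> bool" where
  "alg_hom A B f \<longleftrightarrow>
     (\<forall>a\<in>A. f a \<in> B) \<and>
     (\<forall>a\<in>A. \<forall>b\<in>A. f (ps2_add a b) = ps2_add (f a) (f b)) \<and>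
     (\<forall>c. \<forall>a\<in>A. f (ps2_smult c a) = ps2_smult c (f a)) \<and>
     (\<forall>a\<in>A. \<forall>b\<in>A. f (ps2_mult a b) = ps2_mult (f a) (f b)) \<and>
     f ps2_one = ps2_one"

definition alg_iso :: "ps2 set \<Rightarrow> ps2 set \<Rightarrow> bool" where
  "alg_iso A B \<longleftrightarrow> (\<exists>f. alg_hom A B f \<and> bij_betw f A B)"

text \<open>An involution tau of the germ 1/m(1,q) (a non-identity automorphism of
order 2 of its analytic algebra) and the ring of the quotient germ by tau.\<close>

definition is_involution :: "ps2 set \<Rightarrow> (ps2 \<Rightarrow> ps2) \<Rightarrow> bool" where
  "is_involution A t \<longleftrightarrow> alg_hom A A t \<and> (\<forall>a\<in>A. t (t a) = a) \<and> (\<exists>a\<in>A. t a \<noteq> a)"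

definition fixed_ring :: "ps2 set \<Rightarrow> (ps2 \<Rightarrow> ps2) \<Rightarrow> ps2 set" where
  "fixed_ring A t = {a\<in>A. t a = a}"

end

theory Submission
  imports Defs "HOL-Complex_Analysis.Complex_Analysis"
begin

text \<open>
  Let \<open>A\<close> be the invariant ring of \<open>1/m(1,q)\<close>. A homomorphism from \<open>A\<close> to \<open>C{x,y}\<close> with finite fibre over
  the origin is a substitution: the images of \<open>x\<^sup>m\<close> and \<open>y\<^sup>m\<close> have no common zero off the origin, and
  a power of one times the other is an \<open>m\<close>-th power, so that both are \<open>m\<close>-th powers. Hence the involution
  lifts to an automorphism of \<open>C{x,y}\<close>, which becomes linear after averaging the coordinates.
  If it is diagonal, the fixed monomials form one of the lattices of cases (b)--(d). If it exchanges the
  axes, then \<open>q\<^sup>2 = 1\<close> modulo \<open>m\<close>. When one of the lifts is a reflection, it may be taken to be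
  \<open>x \<leftrightarrow> y\<close>, and the symmetric invariants are the power series in \<open>x\<^sup>d + y\<^sup>d\<close> and \<open>x y\<close> with
  \<open>d = gcd (q + 1) m\<close>, which gives (a) and (e). Otherwise the extended group is non-abelian and free of
  reflections; lifting the inverse of an isomorphism with a cyclic quotient then yields two semi-invariants
  whose Jacobian vanishes exactly at the origin, which is impossible in dimension two.
\<close>

section \<open>Holomorphic functions of two variables\<close>

definition polydisc :: "real \<Rightarrow> (complex \<times> complex) set" where
  "polydisc r = ball 0 r \<times> ball 0 r"

lemma open_polydisc [simp]: "open (polydisc r)"
  by (simp add: polydisc_def open_Times)

lemma mem_polydisc [simp]: "(x, y) \<in> polydisc r \<longleftrightarrow> norm x < r \<and> norm y < r"
  by (simp add: polydisc_def)

lemma polydisc_mono: "r \<le> s \<Longrightarrow> polydisc r \<subseteq> polydisc s"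
  by (auto simp: polydisc_def)

abbreviation near0 :: "(complex \<times> complex \<Rightarrow> bool) \<Rightarrow> bool" (binder \<open>\<forall>\<^sub>0\<close> 10) where
  "near0 P \<equiv> eventually P (nhds (0, 0))"

lemma open_contains_polydisc:
  assumes "open U" "(0, 0) \<in> U"
  shows "\<exists>r>0. polydisc r \<subseteq> U"
proof -
  obtain A B where AB: "open A" "open B" "(0, 0) \<in> A \<times> B" "A \<times> B \<subseteq> U"
    using open_prod_elim[OF assms] by metis
  then obtain a b where "a > 0" "ball 0 a \<subseteq> A" "b > 0" "ball 0 b \<subseteq> B"
    by (metis mem_Sigma_iff open_contains_ball)
  then show ?thesis
    using AB(4) by (intro exI[of _ "min a b"]) (force simp: polydisc_def)
qed

lemma near0_iff_polydisc: "near0 P \<longleftrightarrow> (\<exists>r>0. \<forall>z\<in>polydisc r. P z)"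
proof
  assume "near0 P"
  then obtain U where "open U" "(0, 0) \<in> U" "\<forall>z\<in>U. P z" by (auto simp: eventually_nhds)
  then show "\<exists>r>0. \<forall>z\<in>polydisc r. P z" by (metis open_contains_polydisc subsetD)
next
  assume "\<exists>r>0. \<forall>z\<in>polydisc r. P z"
  then show "near0 P"
    unfolding eventually_nhds using open_polydisc by (metis mem_polydisc norm_zero)
qed

text \<open>Properties that hold on all small polydiscs are combined in the filter \<open>at_right 0\<close> of
  radii, which replaces taking minima of radii by hand.\<close>

lemma eventually_at_right_0I:
  fixes r :: real
  assumes "0 < r" "\<And>s. 0 < s \<Longrightarrow> s \<le> r \<Longrightarrow> P s"
  shows "\<forall>\<^sub>F s in at_right 0. P s"
  using assms eventually_at_right_field[of P 0] by (metis less_imp_le)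

lemma eventually_at_right_0E:
  assumes "\<forall>\<^sub>F s :: real in at_right 0. P s"
  obtains s where "0 < s" "P s"
  using eventually_happens'[OF trivial_limit_at_right_real
      eventually_conj[OF eventually_at_right_less assms]] by blast

lemma near0_imp_eventually_polydisc:
  "near0 P \<Longrightarrow> \<forall>\<^sub>F r in at_right 0. \<forall>z\<in>polydisc r. P z"
  unfolding near0_iff_polydisc using polydisc_mono by (blast intro: eventually_at_right_0I)

text \<open>Separate holomorphy together with continuity suffices for a convergent double power series
  expansion.\<close>

definition holomorphic2_on :: "(complex \<times> complex \<Rightarrow> complex) \<Rightarrow> (complex \<times> complex) set \<Rightarrow> bool"
    (infixl \<open>holomorphic2'_on\<close> 50) where
  "F holomorphic2_on U \<longleftrightarrow> continuous_on U F \<and>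
     (\<forall>y. (\<lambda>x. F (x, y)) holomorphic_on {x. (x, y) \<in> U}) \<and>
     (\<forall>x. (\<lambda>y. F (x, y)) holomorphic_on {y. (x, y) \<in> U})"

lemma holomorphic2_on_imp_continuous_on: "F holomorphic2_on U \<Longrightarrow> continuous_on U F"
  by (simp add: holomorphic2_on_def)

lemma holomorphic2_on_imp_isCont:
  "F holomorphic2_on U \<Longrightarrow> open U \<Longrightarrow> z \<in> U \<Longrightarrow> isCont F z"
  by (simp add: holomorphic2_on_def continuous_on_eq_continuous_at)

lemma holomorphic2_on_imp_holomorphic_on:
  assumes "F holomorphic2_on U"
  shows "(\<And>x. x \<in> S \<Longrightarrow> (x, y) \<in> U) \<Longrightarrow> (\<lambda>x. F (x, y)) holomorphic_on S"
    and "(\<And>y. y \<in> S \<Longrightarrow> (x, y) \<in> U) \<Longrightarrow> (\<lambda>y. F (x, y)) holomorphic_on S"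
proof -
  have slices: "(\<lambda>x. F (x, y)) holomorphic_on {x. (x, y) \<in> U}"
    "(\<lambda>y. F (x, y)) holomorphic_on {y. (x, y) \<in> U}" for x y
    using assms by (simp_all add: holomorphic2_on_def)
  show "(\<lambda>x. F (x, y)) holomorphic_on S" if "\<And>x. x \<in> S \<Longrightarrow> (x, y) \<in> U"
    by (rule holomorphic_on_subset[OF slices(1)]) (use that in auto)
  show "(\<lambda>y. F (x, y)) holomorphic_on S" if "\<And>y. y \<in> S \<Longrightarrow> (x, y) \<in> U"
    by (rule holomorphic_on_subset[OF slices(2)]) (use that in auto)
qed

lemma holomorphic2_on_subset:
  assumes "F holomorphic2_on U" "V \<subseteq> U"
  shows "F holomorphic2_on V"
proof -
  have "continuous_on V F"
    using assms continuous_on_subset by (auto simp: holomorphic2_on_def)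
  then show ?thesis
    using assms(2) unfolding holomorphic2_on_def[of F V]
    by (auto intro!: holomorphic2_on_imp_holomorphic_on[OF assms(1)])
qed

lemma holomorphic2_on_const [simp]: "(\<lambda>z. c) holomorphic2_on U"
  and holomorphic2_on_fst [simp]: "fst holomorphic2_on U"
  and holomorphic2_on_snd [simp]: "snd holomorphic2_on U"
  by (auto simp: holomorphic2_on_def intro!: continuous_intros)

lemma holomorphic2_on_add:
    "F holomorphic2_on U \<Longrightarrow> G holomorphic2_on U \<Longrightarrow> (\<lambda>z. F z + G z) holomorphic2_on U"
  and holomorphic2_on_diff:
    "F holomorphic2_on U \<Longrightarrow> G holomorphic2_on U \<Longrightarrow> (\<lambda>z. F z - G z) holomorphic2_on U"
  and holomorphic2_on_mult:
    "F holomorphic2_on U \<Longrightarrow> G holomorphic2_on U \<Longrightarrow> (\<lambda>z. F z * G z) holomorphic2_on U"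
  and holomorphic2_on_power: "F holomorphic2_on U \<Longrightarrow> (\<lambda>z. F z ^ n) holomorphic2_on U"
  by (auto simp: holomorphic2_on_def intro!: continuous_intros holomorphic_intros)

lemma holomorphic2_on_divide:
  "F holomorphic2_on U \<Longrightarrow> G holomorphic2_on U \<Longrightarrow> (\<And>z. z \<in> U \<Longrightarrow> G z \<noteq> 0) \<Longrightarrow>
   (\<lambda>z. F z / G z) holomorphic2_on U"
  by (auto simp: holomorphic2_on_def intro!: continuous_intros holomorphic_intros)

lemmas holomorphic2_intros =
  holomorphic2_on_const holomorphic2_on_fst holomorphic2_on_snd holomorphic2_on_add
  holomorphic2_on_diff holomorphic2_on_mult holomorphic2_on_power holomorphic2_on_divide

lemma continuous_on_infsum:
  fixes f :: "'i \<Rightarrow> 'a :: topological_space \<Rightarrow> 'b :: banach"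
  assumes "\<And>i. i \<in> I \<Longrightarrow> continuous_on S (f i)"
    and "\<And>i z. i \<in> I \<Longrightarrow> z \<in> S \<Longrightarrow> norm (f i z) \<le> M i" "M summable_on I"
  shows "continuous_on S (\<lambda>z. \<Sum>\<^sub>\<infinity>i\<in>I. f i z)"
proof (rule uniform_limit_theorem[OF _ Weierstrass_m_test_general[OF assms(2,3)]])
  show "\<forall>\<^sub>F X in finite_subsets_at_top I. continuous_on S (\<lambda>z. \<Sum>i\<in>X. f i z)"
    unfolding eventually_finite_subsets_at_top
    by (rule exI[of _ "{}"]) (auto intro!: continuous_intros assms(1))
qed simp_all

lemma holomorphic_on_infsum:
  assumes f: "\<And>i. i \<in> I \<Longrightarrow> f i holomorphic_on S" and "open S"
    and M: "\<And>i z. i \<in> I \<Longrightarrow> z \<in> S \<Longrightarrow> norm (f i z) \<le> M i" "M summable_on I"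
  shows "(\<lambda>z. \<Sum>\<^sub>\<infinity>i\<in>I. f i z) holomorphic_on S"
  unfolding holomorphic_on_open[OF \<open>open S\<close>]
proof
  fix z assume "z \<in> S"
  then obtain r where r: "r > 0" "cball z r \<subseteq> S" using \<open>open S\<close> open_contains_cball by blast
  have "continuous_on (cball z r) (\<lambda>z. \<Sum>i\<in>X. f i z) \<and> (\<lambda>z. \<Sum>i\<in>X. f i z) holomorphic_on ball z r"
    if "X \<subseteq> I" for X
  proof -
    have "(\<lambda>z. \<Sum>i\<in>X. f i z) holomorphic_on cball z r"
      using r(2) that by (intro holomorphic_intros holomorphic_on_subset[OF f]) auto
    then show ?thesis
      using holomorphic_on_imp_continuous_on holomorphic_on_subset ball_subset_cball by blast
  qed
  then have partial_sums: "\<forall>\<^sub>F X in finite_subsets_at_top I.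
      continuous_on (cball z r) (\<lambda>z. \<Sum>i\<in>X. f i z) \<and> (\<lambda>z. \<Sum>i\<in>X. f i z) holomorphic_on ball z r"
    using eventually_finite_subsets_at_top by auto
  have "uniform_limit (cball z r) (\<lambda>X z. \<Sum>i\<in>X. f i z) (\<lambda>z. \<Sum>\<^sub>\<infinity>i\<in>I. f i z) (finite_subsets_at_top I)"
    using r(2) by (intro Weierstrass_m_test_general[OF M]) auto
  from holomorphic_uniform_limit[OF partial_sums this]
  have "(\<lambda>z. \<Sum>\<^sub>\<infinity>i\<in>I. f i z) holomorphic_on ball z r" by simp
  then show "\<exists>f'. ((\<lambda>z. \<Sum>\<^sub>\<infinity>i\<in>I. f i z) has_field_derivative f') (at z)"
    using r(1) by (simp add: holomorphic_on_open)
qed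

lemma holomorphic2_on_infsum:
  assumes F: "\<And>i. i \<in> I \<Longrightarrow> F i holomorphic2_on U" and U: "open U"
    and M: "\<And>i z. i \<in> I \<Longrightarrow> z \<in> U \<Longrightarrow> norm (F i z) \<le> M i" "M summable_on I"
  shows "(\<lambda>z. \<Sum>\<^sub>\<infinity>i\<in>I. F i z) holomorphic2_on U"
  unfolding holomorphic2_on_def
proof (intro conjI allI)
  show "continuous_on U (\<lambda>z. \<Sum>\<^sub>\<infinity>i\<in>I. F i z)"
    using F M by (intro continuous_on_infsum[where M = M]) (auto simp: holomorphic2_on_def)
  fix w
  have "open ((\<lambda>x. (x, w)) -` U)" "open ((\<lambda>y. (w, y)) -` U)"
    using U by (auto intro!: open_vimage continuous_intros)
  then have "open {x. (x, w) \<in> U}" "open {y. (w, y) \<in> U}" by (simp_all add: vimage_def)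
  then show "(\<lambda>x. \<Sum>\<^sub>\<infinity>i\<in>I. F i (x, w)) holomorphic_on {x. (x, w) \<in> U}"
    and "(\<lambda>y. \<Sum>\<^sub>\<infinity>i\<in>I. F i (w, y)) holomorphic_on {y. (w, y) \<in> U}"
    using F M by (auto intro!: holomorphic_on_infsum[where M = M] simp: holomorphic2_on_def)
qed

section \<open>Convergent double power series\<close>

no_notation Infinite_Set_Sum.abs_summable_on (infix \<open>abs'_summable'_on\<close> 50)
notation Infinite_Sum.abs_summable_on (infixr \<open>abs'_summable'_on\<close> 46)

definition ps2_eval :: "ps2 \<Rightarrow> complex \<times> complex \<Rightarrow> complex" where
  "ps2_eval a z = (\<Sum>\<^sub>\<infinity>(i, j). a i j * fst z ^ i * snd z ^ j)"

abbreviation ps2_abs_conv :: "ps2 \<Rightarrow> real \<Rightarrow> bool" where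
  "ps2_abs_conv a r \<equiv> (\<lambda>(i, j). norm (a i j) * r ^ (i + j)) summable_on UNIV"

lemma norm_ps2_term_le:
  fixes a :: ps2 and x y :: complex
  assumes "norm x \<le> r" "norm y \<le> r"
  shows "norm (a i j * x ^ i * y ^ j) \<le> norm (a i j) * r ^ (i + j)"
proof -
  have "0 \<le> r" using assms(1) norm_ge_zero order_trans by blast
  then have "norm x ^ i * norm y ^ j \<le> r ^ i * r ^ j"
    using assms by (intro mult_mono power_mono) auto
  then show ?thesis
    by (simp add: norm_mult norm_power power_add mult_left_mono mult.assoc)
qed

lemma ps2_terms_abs_summable:
  assumes "ps2_abs_conv a r" "norm x \<le> r" "norm y \<le> r"
  shows "(\<lambda>(i, j). a i j * x ^ i * y ^ j) abs_summable_on UNIV"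
  by (rule summable_on_comparison_test[OF assms(1)])
     (use norm_ps2_term_le[OF assms(2,3)] in \<open>auto simp: case_prod_unfold\<close>)

lemma ps2_eval_has_sum:
  assumes "ps2_abs_conv a r" "norm x \<le> r" "norm y \<le> r"
  shows "((\<lambda>(i, j). a i j * x ^ i * y ^ j) has_sum ps2_eval a (x, y)) UNIV"
  using abs_summable_summable[OF ps2_terms_abs_summable[OF assms]] by (simp add: ps2_eval_def)

lemma ps2_eval_rows:
  assumes a: "ps2_abs_conv a r" and x: "norm x \<le> r" and r: "r > 0"
  shows "summable (\<lambda>i. a i j * x ^ i)"
    and "norm y \<le> r \<Longrightarrow> (\<lambda>j. (\<Sum>i. a i j * x ^ i) * y ^ j) sums ps2_eval a (x, y)"
proof -
  have swapped: "((\<lambda>(j, i). a i j * x ^ i * y ^ j) has_sum ps2_eval a (x, y)) (UNIV \<times> UNIV)"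
    if "norm y \<le> r" for y
    using has_sum_swap[where f = "\<lambda>(i, j). a i j * x ^ i * y ^ j" and A = UNIV and B = UNIV]
      ps2_eval_has_sum[OF a x that] by (simp add: case_prod_unfold)
  have row: "(\<lambda>i. a i j * x ^ i) summable_on UNIV" for j
  proof -
    have "(\<lambda>(j, i). a i j * x ^ i * of_real r ^ j) summable_on (UNIV \<times> UNIV)"
      using swapped[of "of_real r"] r by (auto dest: has_sum_imp_summable)
    then have "(\<lambda>i. a i j * x ^ i * of_real r ^ j) summable_on UNIV"
      using summable_on_SigmaD1 by fastforce
    then show ?thesis using r by (simp add: summable_on_cmult_left')
  qed
  then show "summable (\<lambda>i. a i j * x ^ i)" for j by (rule summable_on_imp_summable)
  assume y: "norm y \<le> r"
  have row_has_sum: "((\<lambda>i. a i j * x ^ i) has_sum (\<Sum>i. a i j * x ^ i)) UNIV" for j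
    using has_sum_infsum[OF row] has_sum_imp_sums[OF has_sum_infsum[OF row]] sums_unique by metis
  have "((\<lambda>j. (\<Sum>i. a i j * x ^ i) * y ^ j) has_sum ps2_eval a (x, y)) UNIV"
    by (rule has_sum_SigmaD[OF swapped[OF y]]) (simp add: has_sum_cmult_left row_has_sum)
  then show "(\<lambda>j. (\<Sum>i. a i j * x ^ i) * y ^ j) sums ps2_eval a (x, y)"
    by (rule has_sum_imp_sums)
qed

lemma ps2_abs_conv_mono:
  assumes "ps2_abs_conv a r" "0 \<le> s" "s \<le> r"
  shows "ps2_abs_conv a s"
  by (rule summable_on_comparison_test[OF assms(1)])
     (use assms(2,3) in \<open>auto intro!: mult_left_mono power_mono\<close>)

lemma has_sum_times:
  fixes f :: "'a \<Rightarrow> 'c :: {real_normed_field, banach}" and g :: "'b \<Rightarrow> 'c"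
  assumes "f abs_summable_on A" "g abs_summable_on B"
  shows "(\<lambda>(p, q). f p * g q) abs_summable_on A \<times> B"
    and "((\<lambda>(p, q). f p * g q) has_sum infsum f A * infsum g B) (A \<times> B)"
proof -
  show abs: "(\<lambda>(p, q). f p * g q) abs_summable_on A \<times> B"
    using assms unfolding Infinite_Sum.abs_summable_on_Sigma_iff
    by (auto simp: norm_mult infsum_cmult_right' infsum_nonneg
        intro!: summable_on_cmult_right summable_on_cmult_left)
  have fg: "f summable_on A" "g summable_on B" using assms by (simp_all add: abs_summable_summable)
  show "((\<lambda>(p, q). f p * g q) has_sum infsum f A * infsum g B) (A \<times> B)"
  proof (rule has_sum_SigmaI)
    show "((\<lambda>q. case (p, q) of (p, q) \<Rightarrow> f p * g q) has_sum f p * infsum g B) B" for p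
      using has_sum_cmult_right[OF has_sum_infsum[OF fg(2)]] by simp
    show "((\<lambda>p. f p * infsum g B) has_sum infsum f A * infsum g B) A"
      by (rule has_sum_cmult_left[OF has_sum_infsum[OF fg(1)]])
  qed (rule abs_summable_summable[OF abs])
qed

lemma ps2_abs_conv_of_bounded:
  assumes "\<And>i j. norm (a i j) * r ^ (i + j) \<le> M" and "0 \<le> s" "s < r"
  shows "ps2_abs_conv a s"
proof -
  have "(\<lambda>n. (s / r) ^ n) abs_summable_on UNIV"
    using assms(2,3)
    by (intro norm_summable_imp_summable_on) (auto simp: norm_power intro!: summable_geometric)
  then have "(\<lambda>(i, j). (s / r) ^ i * (s / r) ^ j) abs_summable_on (UNIV \<times> UNIV)"
    by (intro has_sum_times(1))
  then have "(\<lambda>p. M * (case p of (i, j) \<Rightarrow> (s / r) ^ i * (s / r) ^ j)) summable_on UNIV"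
    by (intro summable_on_cmult_right) (simp add: abs_summable_summable)
  then show ?thesis
  proof (rule summable_on_comparison_test)
    fix p :: "nat \<times> nat"
    obtain i j where p: "p = (i, j)" by force
    have "norm (a i j) * s ^ (i + j) = norm (a i j) * r ^ (i + j) * ((s / r) ^ i * (s / r) ^ j)"
      using assms(2,3) by (simp add: power_divide power_add)
    also have "\<dots> \<le> M * ((s / r) ^ i * (s / r) ^ j)"
      using assms by (intro mult_right_mono) auto
    finally show "(case p of (i, j) \<Rightarrow> norm (a i j) * s ^ (i + j)) \<le>
        M * (case p of (i, j) \<Rightarrow> (s / r) ^ i * (s / r) ^ j)" by (simp add: p)
  qed (use assms in auto)
qed

lemma ps2_abs_conv_imp_bounded:
  assumes "ps2_abs_conv a r" "0 \<le> r"
  shows "norm (a i j) * r ^ (i + j) \<le> (\<Sum>\<^sub>\<infinity>(i, j). norm (a i j) * r ^ (i + j))"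
  using finite_sum_le_infsum[OF assms(1), of "{(i, j)}"] assms(2) by auto

lemma convergent_ps2_iff_bounded:
  "convergent_ps2 a \<longleftrightarrow> (\<exists>r>0. \<exists>M. \<forall>i j. norm (a i j) * r ^ (i + j) \<le> M)"
proof
  assume "convergent_ps2 a"
  then show "\<exists>r>0. \<exists>M. \<forall>i j. norm (a i j) * r ^ (i + j) \<le> M"
    unfolding convergent_ps2_def using ps2_abs_conv_imp_bounded by (meson less_imp_le)
next
  assume "\<exists>r>0. \<exists>M. \<forall>i j. norm (a i j) * r ^ (i + j) \<le> M"
  then obtain r M where r: "r > 0" "\<And>i j. norm (a i j) * r ^ (i + j) \<le> M" by blast
  have "ps2_abs_conv a (r / 2)" by (rule ps2_abs_conv_of_bounded[OF r(2)]) (use r in auto)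
  then show "convergent_ps2 a"
    unfolding convergent_ps2_def using r(1) by (intro exI[of _ "r / 2"]) auto
qed

lemma convergent_ps2_mono:
  assumes "convergent_ps2 a" "\<And>i j. norm (b i j) \<le> norm (a i j)"
  shows "convergent_ps2 b"
proof -
  obtain r M where r: "r > 0" "\<And>i j. norm (a i j) * r ^ (i + j) \<le> M"
    using assms(1) convergent_ps2_iff_bounded by blast
  have "norm (b i j) * r ^ (i + j) \<le> M" for i j
    by (rule order_trans[OF mult_right_mono[OF assms(2)] r(2)]) (use r in auto)
  then show ?thesis using r(1) convergent_ps2_iff_bounded by blast
qed

lemma convergent_ps2_eventually_abs_conv:
  assumes "convergent_ps2 a"
  shows "\<forall>\<^sub>F r in at_right 0. ps2_abs_conv a r"
proof -
  obtain r where r: "r > 0" "ps2_abs_conv a r" using assms by (auto simp: convergent_ps2_def)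
  show ?thesis
    by (rule eventually_at_right_0I[OF r(1)]) (rule ps2_abs_conv_mono[OF r(2)], auto)
qed

lemma convergent_ps2_reindex:
  assumes "convergent_ps2 a" "\<And>i j. f i j + g i j \<le> N * (i + j + 1)"
  shows "convergent_ps2 (\<lambda>i j. a (f i j) (g i j))"
proof -
  obtain r M where r: "r > 0" "\<And>i j. norm (a i j) * r ^ (i + j) \<le> M"
    using assms(1) convergent_ps2_iff_bounded by blast
  define s where "s = min r 1"
  have s: "0 < s" "s \<le> r" "s \<le> 1" using r(1) by (auto simp: s_def)
  have "norm (a (f i j) (g i j)) * (s ^ N) ^ (i + j) \<le> M / s ^ N" for i j
  proof -
    have "(s ^ N) ^ (i + j) * s ^ N = s ^ (N * (i + j + 1))"
      by (simp flip: power_mult power_add add: algebra_simps)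
    also have "\<dots> \<le> s ^ (f i j + g i j)" using s assms(2) by (intro power_decreasing) auto
    also have "\<dots> \<le> r ^ (f i j + g i j)" using s by (intro power_mono) auto
    finally have "norm (a (f i j) (g i j)) * ((s ^ N) ^ (i + j) * s ^ N)
        \<le> norm (a (f i j) (g i j)) * r ^ (f i j + g i j)"
      by (rule mult_left_mono) simp
    then show ?thesis using r(2)[of "f i j" "g i j"] s(1) by (simp add: pos_le_divide_eq mult.assoc)
  qed
  then show ?thesis using s(1) convergent_ps2_iff_bounded by (meson zero_less_power)
qed

lemma sums_zero_imp_coeffs_zero:
  fixes a :: "nat \<Rightarrow> complex"
  assumes "r > 0" "\<And>x. norm x < r \<Longrightarrow> (\<lambda>n. a n * x ^ n) sums 0"
  shows "a n = 0"
proof (rule ccontr)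
  assume n: "a n \<noteq> 0"
  have "a 0 = 0" using assms(2)[of 0] assms(1) powser_sums_zero[of a] sums_unique2 by fastforce
  then have "n > 0" using n by (cases n) auto
  then obtain s where "s > 0" "\<And>z. z \<in> cball 0 s - {0} \<Longrightarrow> (\<lambda>_::complex. 0 :: complex) z \<noteq> 0"
    using powser_0_nonzero[of r 0 a "\<lambda>_. 0" n] assms n by auto
  moreover from \<open>s > 0\<close> have "of_real s \<in> cball (0 :: complex) s - {0}" by auto
  ultimately show False by blast
qed

lemma ps2_eval_eq_zero_imp_zero:
  assumes "convergent_ps2 a" "\<forall>\<^sub>0z. ps2_eval a z = 0"
  shows "a i j = 0"
proof -
  have "\<forall>\<^sub>F r in at_right 0. ps2_abs_conv a r \<and> (\<forall>z\<in>polydisc r. ps2_eval a z = 0)"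
    using convergent_ps2_eventually_abs_conv[OF assms(1)] near0_imp_eventually_polydisc[OF assms(2)]
    by eventually_elim simp
  then obtain r where r: "r > 0" "ps2_abs_conv a r" "\<And>z. z \<in> polydisc r \<Longrightarrow> ps2_eval a z = 0"
    by (rule eventually_at_right_0E) auto
  have "(\<Sum>i. a i j * x ^ i) = 0" if "norm x < r" for x j
  proof (rule sums_zero_imp_coeffs_zero[OF r(1)])
    fix y :: complex assume "norm y < r"
    then show "(\<lambda>j. (\<Sum>i. a i j * x ^ i) * y ^ j) sums 0"
      using ps2_eval_rows(2)[OF r(2) _ r(1), of x y] r(3)[of "(x, y)"] that by simp
  qed
  then have "(\<lambda>i. a i j * x ^ i) sums 0" if "norm x < r" for x
    using summable_sums[OF ps2_eval_rows(1)[OF r(2) _ r(1), of x j]] that by simp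
  then show ?thesis by (rule sums_zero_imp_coeffs_zero[OF r(1)])
qed

lemma holomorphic2_on_ps2_eval_compose:
  assumes a: "ps2_abs_conv a r" and FG: "F holomorphic2_on U" "G holomorphic2_on U" "open U"
    and bound: "\<And>z. z \<in> U \<Longrightarrow> norm (F z) \<le> r \<and> norm (G z) \<le> r"
  shows "(\<lambda>z. ps2_eval a (F z, G z)) holomorphic2_on U"
proof -
  have "(\<lambda>z. \<Sum>\<^sub>\<infinity>p. a (fst p) (snd p) * F z ^ fst p * G z ^ snd p) holomorphic2_on U"
    by (rule holomorphic2_on_infsum[where M = "\<lambda>(i, j). norm (a i j) * r ^ (i + j)"])
       (use a FG bound norm_ps2_term_le[of _ r _ a] in
         \<open>auto simp: case_prod_unfold intro!: holomorphic2_on_mult holomorphic2_on_power\<close>)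
  then show ?thesis by (simp add: ps2_eval_def case_prod_unfold)
qed

lemma ps2_eval_holomorphic2_on:
  assumes "ps2_abs_conv a r"
  shows "ps2_eval a holomorphic2_on polydisc r"
  using holomorphic2_on_ps2_eval_compose[OF assms, of fst "polydisc r" snd]
  by (auto simp: less_imp_le)

lemma ps2_lincomb:
  assumes "ps2_abs_conv a r" "ps2_abs_conv b r" "0 \<le> r"
  shows "ps2_abs_conv (\<lambda>i j. c * a i j + d * b i j) r"
    and "norm x \<le> r \<Longrightarrow> norm y \<le> r \<Longrightarrow>
      ps2_eval (\<lambda>i j. c * a i j + d * b i j) (x, y) = c * ps2_eval a (x, y) + d * ps2_eval b (x, y)"
proof -
  show conv: "ps2_abs_conv (\<lambda>i j. c * a i j + d * b i j) r"
  proof (rule summable_on_comparison_test)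
    show "(\<lambda>p. norm c * (case p of (i, j) \<Rightarrow> norm (a i j) * r ^ (i + j)) +
        norm d * (case p of (i, j) \<Rightarrow> norm (b i j) * r ^ (i + j))) summable_on UNIV"
      by (intro summable_on_add summable_on_cmult_right assms(1,2))
    have "norm (c * a i j + d * b i j) * r ^ (i + j)
        \<le> (norm c * norm (a i j) + norm d * norm (b i j)) * r ^ (i + j)" for i j
      using assms(3) norm_triangle_ineq[of "c * a i j" "d * b i j"]
      by (intro mult_right_mono) (auto simp: norm_mult)
    then show "(case p of (i, j) \<Rightarrow> norm (c * a i j + d * b i j) * r ^ (i + j)) \<le>
        norm c * (case p of (i, j) \<Rightarrow> norm (a i j) * r ^ (i + j)) +
        norm d * (case p of (i, j) \<Rightarrow> norm (b i j) * r ^ (i + j))" for p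
      by (simp add: case_prod_unfold algebra_simps)
  qed (use assms(3) in auto)
  assume xy: "norm x \<le> r" "norm y \<le> r"
  have "((\<lambda>p. c * (case p of (i, j) \<Rightarrow> a i j * x ^ i * y ^ j) +
      d * (case p of (i, j) \<Rightarrow> b i j * x ^ i * y ^ j))
     has_sum c * ps2_eval a (x, y) + d * ps2_eval b (x, y)) UNIV"
    by (intro has_sum_add has_sum_cmult_right ps2_eval_has_sum[OF _ xy] assms)
  then have "((\<lambda>(i, j). (c * a i j + d * b i j) * x ^ i * y ^ j)
     has_sum c * ps2_eval a (x, y) + d * ps2_eval b (x, y)) UNIV"
    by (simp add: case_prod_unfold algebra_simps)
  then show "ps2_eval (\<lambda>i j. c * a i j + d * b i j) (x, y) =
      c * ps2_eval a (x, y) + d * ps2_eval b (x, y)"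
    using ps2_eval_has_sum[OF conv xy] has_sum_unique by blast
qed

lemma ps2_lincomb_near0:
  assumes "convergent_ps2 a" "convergent_ps2 b"
  shows "convergent_ps2 (\<lambda>i j. c * a i j + d * b i j)"
    and "\<forall>\<^sub>0z. ps2_eval (\<lambda>i j. c * a i j + d * b i j) z = c * ps2_eval a z + d * ps2_eval b z"
proof -
  have "\<forall>\<^sub>F r in at_right 0. ps2_abs_conv a r \<and> ps2_abs_conv b r"
    using assms by (intro eventually_conj convergent_ps2_eventually_abs_conv)
  then obtain r where r: "0 < r" "ps2_abs_conv a r" "ps2_abs_conv b r"
    by (rule eventually_at_right_0E) auto
  show "convergent_ps2 (\<lambda>i j. c * a i j + d * b i j)"
    unfolding convergent_ps2_def using r ps2_lincomb(1) less_imp_le by blast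
  show "\<forall>\<^sub>0z. ps2_eval (\<lambda>i j. c * a i j + d * b i j) z = c * ps2_eval a z + d * ps2_eval b z"
    unfolding near0_iff_polydisc using r ps2_lincomb(2)[OF r(2,3)]
    by (intro exI[of _ r]) (auto simp: less_imp_le)
qed

lemma has_sum_cauchy_product2:
  fixes f g :: "nat \<times> nat \<Rightarrow> 'a :: {topological_semigroup_mult, semiring_0,
      topological_comm_monoid_add, t3_space}"
  assumes "((\<lambda>(p, q). f p * g q) has_sum S) (UNIV \<times> UNIV)"
  shows "((\<lambda>(i, j). \<Sum>k\<le>i. \<Sum>l\<le>j. f (k, l) * g (i - k, j - l)) has_sum S) UNIV"
proof -
  let ?B = "\<lambda>p :: nat \<times> nat. {..fst p} \<times> {..snd p}"
  let ?h = "\<lambda>(p, q). f q * g (fst p - fst q, snd p - snd q)"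
  have "(?h has_sum S) (Sigma UNIV ?B) \<longleftrightarrow> ((\<lambda>(p, q). f p * g q) has_sum S) (UNIV \<times> UNIV)"
    by (rule has_sum_reindex_bij_witness[where
          i = "\<lambda>(q, q'). ((fst q + fst q', snd q + snd q'), q)" and
          j = "\<lambda>(p, q). (q, (fst p - fst q, snd p - snd q))"]) auto
  then have "(?h has_sum S) (Sigma UNIV ?B)" using assms by simp
  then show ?thesis
  proof (rule has_sum_SigmaD)
    fix p :: "nat \<times> nat"
    have "((\<lambda>q. ?h (p, q)) has_sum (\<Sum>q\<in>?B p. ?h (p, q))) (?B p)" by (rule has_sum_finite) simp
    also have "(\<Sum>q\<in>?B p. ?h (p, q)) = (case p of (i, j) \<Rightarrow> \<Sum>k\<le>i. \<Sum>l\<le>j. f (k, l) * g (i - k, j - l))"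
      by (simp add: case_prod_unfold sum.cartesian_product)
    finally show "((\<lambda>q. ?h (p, q)) has_sum
        (case p of (i, j) \<Rightarrow> \<Sum>k\<le>i. \<Sum>l\<le>j. f (k, l) * g (i - k, j - l))) (?B p)" .
  qed
qed

lemma convolution_times_powers:
  fixes a b :: "nat \<Rightarrow> nat \<Rightarrow> 'a :: comm_semiring_1"
  shows "(\<Sum>k\<le>i. \<Sum>l\<le>j. (a k l * x ^ k * y ^ l) * (b (i - k) (j - l) * x ^ (i - k) * y ^ (j - l)))
    = (\<Sum>k\<le>i. \<Sum>l\<le>j. a k l * b (i - k) (j - l)) * x ^ i * y ^ j"
  unfolding sum_distrib_right
proof (intro sum.cong refl)
  fix k l assume "k \<in> {..i}" "l \<in> {..j}"
  then have "x ^ i = x ^ k * x ^ (i - k)" "y ^ j = y ^ l * y ^ (j - l)"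
    by (simp_all flip: power_add)
  then show "(a k l * x ^ k * y ^ l) * (b (i - k) (j - l) * x ^ (i - k) * y ^ (j - l))
      = a k l * b (i - k) (j - l) * x ^ i * y ^ j" by (simp add: mult_ac)
qed

lemma ps2_mult_abs_conv:
  assumes "ps2_abs_conv a r" "ps2_abs_conv b r" "0 \<le> r"
  shows "ps2_abs_conv (ps2_mult a b) r"
proof -
  let ?na = "\<lambda>i j. norm (a i j)" and ?nb = "\<lambda>i j. norm (b i j)"
  let ?f = "\<lambda>(i, j). ?na i j * r ^ i * r ^ j" and ?g = "\<lambda>(i, j). ?nb i j * r ^ i * r ^ j"
  have "?f abs_summable_on UNIV" "?g abs_summable_on UNIV"
    using assms by (simp_all add: case_prod_unfold abs_mult power_add mult.assoc)
  from has_sum_cauchy_product2[OF has_sum_times(2)[OF this]]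
  have "(\<lambda>(i, j). \<Sum>k\<le>i. \<Sum>l\<le>j. ?f (k, l) * ?g (i - k, j - l)) summable_on UNIV"
    using has_sum_imp_summable by blast
  then have "(\<lambda>(i, j). (\<Sum>k\<le>i. \<Sum>l\<le>j. ?na k l * ?nb (i - k) (j - l)) * r ^ i * r ^ j) summable_on UNIV"
    using convolution_times_powers[where a = ?na and b = ?nb] by simp
  then show ?thesis
  proof (rule summable_on_comparison_test)
    have "norm (ps2_mult a b i j) \<le> (\<Sum>k\<le>i. \<Sum>l\<le>j. ?na k l * ?nb (i - k) (j - l))" for i j
      unfolding ps2_mult_def
      by (intro order_trans[OF norm_sum] sum_mono order_trans[OF norm_sum]) (simp add: norm_mult)
    then show "(case p of (i, j) \<Rightarrow> norm (ps2_mult a b i j) * r ^ (i + j)) \<le>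
        (case p of (i, j) \<Rightarrow> (\<Sum>k\<le>i. \<Sum>l\<le>j. ?na k l * ?nb (i - k) (j - l)) * r ^ i * r ^ j)" for p
      using assms(3) by (simp add: case_prod_unfold power_add mult.assoc mult_right_mono)
  qed (use assms(3) in auto)
qed

lemma ps2_eval_mult:
  assumes a: "ps2_abs_conv a r" and b: "ps2_abs_conv b r" and xy: "norm x \<le> r" "norm y \<le> r"
  shows "ps2_eval (ps2_mult a b) (x, y) = ps2_eval a (x, y) * ps2_eval b (x, y)"
proof -
  let ?f = "\<lambda>(i, j). a i j * x ^ i * y ^ j" and ?g = "\<lambda>(i, j). b i j * x ^ i * y ^ j"
  have r: "0 \<le> r" using xy(1) norm_ge_zero order_trans by blast
  have "((\<lambda>(p, q). ?f p * ?g q) has_sum ps2_eval a (x, y) * ps2_eval b (x, y)) (UNIV \<times> UNIV)"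
    using has_sum_times(2)[OF ps2_terms_abs_summable[OF a xy] ps2_terms_abs_summable[OF b xy]]
    by (simp add: ps2_eval_def)
  from has_sum_cauchy_product2[OF this]
  have "((\<lambda>(i, j). ps2_mult a b i j * x ^ i * y ^ j) has_sum
      ps2_eval a (x, y) * ps2_eval b (x, y)) UNIV"
    by (simp add: convolution_times_powers ps2_mult_def)
  then show ?thesis
    using ps2_eval_has_sum[OF ps2_mult_abs_conv[OF a b r] xy] has_sum_unique by blast
qed

lemma ps2_mult_near0:
  assumes "convergent_ps2 a" "convergent_ps2 b"
  shows "convergent_ps2 (ps2_mult a b)"
    and "\<forall>\<^sub>0z. ps2_eval (ps2_mult a b) z = ps2_eval a z * ps2_eval b z"
proof -
  have "\<forall>\<^sub>F r in at_right 0. ps2_abs_conv a r \<and> ps2_abs_conv b r"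
    using assms by (intro eventually_conj convergent_ps2_eventually_abs_conv)
  then obtain r where r: "0 < r" "ps2_abs_conv a r" "ps2_abs_conv b r"
    by (rule eventually_at_right_0E) auto
  show "convergent_ps2 (ps2_mult a b)"
    unfolding convergent_ps2_def using r ps2_mult_abs_conv less_imp_le by blast
  show "\<forall>\<^sub>0z. ps2_eval (ps2_mult a b) z = ps2_eval a z * ps2_eval b z"
    unfolding near0_iff_polydisc using r(1) ps2_eval_mult[OF r(2,3)]
    by (intro exI[of _ r]) (auto simp: less_imp_le)
qed

section \<open>Cauchy integrals over a torus\<close>

definition circle_coeff :: "real \<Rightarrow> (complex \<Rightarrow> complex) \<Rightarrow> nat \<Rightarrow> complex" where
  "circle_coeff r f n =
      contour_integral (circlepath 0 r) (\<lambda>w. f w / w ^ Suc n) / (2 * of_real pi * \<i>)"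

lemma circle_coeff_cong:
  assumes "0 \<le> r" "\<And>w. w \<in> sphere 0 r \<Longrightarrow> f w = g w"
  shows "circle_coeff r f = circle_coeff r g"
  unfolding circle_coeff_def fun_eq_iff
  using assms by (auto intro!: contour_integral_cong arg_cong2[where f = "(/)"])

lemma contour_integrable_circle_coeff:
  assumes "0 < r" "continuous_on (sphere 0 r) f"
  shows "(\<lambda>w. f w / w ^ Suc n) contour_integrable_on circlepath 0 r"
  using assms by (auto intro!: contour_integrable_continuous_circlepath continuous_intros)

lemma circle_coeff_cmult:
  assumes "0 < r" "continuous_on (sphere 0 r) f"
  shows "circle_coeff r (\<lambda>w. f w * c) n = circle_coeff r f n * c"
  using contour_integral_rmul[OF contour_integrable_circle_coeff[OF assms], of n c]
  by (simp add: circle_coeff_def)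

lemma circle_coeff_sums:
  assumes "0 < r" "continuous_on (cball 0 r) f" "f holomorphic_on ball 0 r" "norm y < r"
  shows "(\<lambda>n. circle_coeff r f n * y ^ n) sums f y"
proof -
  have "circle_coeff r f n = (deriv ^^ n) f 0 / fact n" for n
    using Cauchy_has_contour_integral_higher_derivative_circlepath[OF assms(2,3), of 0 n] assms(1)
    by (simp add: circle_coeff_def contour_integral_unique)
  then show ?thesis using holomorphic_power_series[OF assms(3), of y] assms(4) by simp
qed

lemma norm_circle_coeff_le:
  assumes r: "0 < r" and f: "continuous_on (sphere 0 r) f"
    and M: "\<And>w. w \<in> sphere 0 r \<Longrightarrow> norm (f w) \<le> M"
  shows "norm (circle_coeff r f n) \<le> M / r ^ n"
proof -
  have "norm (contour_integral (circlepath 0 r) (\<lambda>w. f w / w ^ Suc n)) \<le> M / r ^ Suc n * (2 * pi * r)"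
  proof (rule has_contour_integral_bound_circlepath[OF has_contour_integral_integral])
    show "0 \<le> M / r ^ Suc n"
      using order_trans[OF norm_ge_zero M[of "of_real r"]] r by simp
    show "norm (f w / w ^ Suc n) \<le> M / r ^ Suc n" if "norm (w - 0) = r" for w
      using M[of w] that r by (simp add: norm_divide norm_mult norm_power divide_right_mono)
  qed (use r f contour_integrable_circle_coeff in auto)
  then show ?thesis using r by (simp add: circle_coeff_def norm_divide norm_mult field_simps)
qed

lemma continuous_on_circle_coeff:
  assumes k: "continuous_on (U \<times> sphere 0 r) k" and "0 < r"
  shows "continuous_on U (\<lambda>x. circle_coeff r (\<lambda>w. k (x, w)) n)"
proof -
  let ?w = "\<lambda>t. circlepath 0 r t"
  have "continuous_on (U \<times> cbox 0 1) (\<lambda>z. k (fst z, ?w (snd z)))"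
    by (rule continuous_on_compose2[OF k]) (use assms(2) in
      \<open>auto intro!: continuous_intros simp: circlepath norm_mult\<close>)
  then have "continuous_on (U \<times> cbox 0 1) (\<lambda>(x, t). k (x, ?w t) / ?w t ^ Suc n *
      (2 * of_real pi * \<i> * r * exp (2 * of_real pi * \<i> * t)))"
    using assms(2) by (auto simp: case_prod_unfold circlepath intro!: continuous_intros)
  from integral_continuous_on_param[OF this]
  have "continuous_on U (\<lambda>x. contour_integral (circlepath 0 r) (\<lambda>w. k (x, w) / w ^ Suc n))"
    by (simp add: contour_integral_integral vector_derivative_circlepath)
  then show ?thesis unfolding circle_coeff_def by (intro continuous_intros) auto
qed

lemma circle_coeff_sums_uniform:
  assumes r: "0 < r" and g: "\<And>i. continuous_on (sphere 0 r) (g i)"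
    and sums: "\<And>w. w \<in> sphere 0 r \<Longrightarrow> (\<lambda>i. g i w) sums h w"
    and M: "\<And>i w. w \<in> sphere 0 r \<Longrightarrow> norm (g i w) \<le> M i" "summable M"
  shows "(\<lambda>i. circle_coeff r (g i) n) sums circle_coeff r h n"
proof -
  have "uniform_limit (sphere 0 r) (\<lambda>N w. \<Sum>i<N. g i w / w ^ Suc n) (\<lambda>w. \<Sum>i. g i w / w ^ Suc n) sequentially"
  proof (rule Weierstrass_m_test)
    show "norm (g i w / w ^ Suc n) \<le> M i / r ^ Suc n" if "w \<in> sphere 0 r" for i w
      using M(1)[OF that] that r by (simp add: norm_divide norm_mult norm_power divide_right_mono)
    show "summable (\<lambda>i. M i / r ^ Suc n)" by (rule summable_divide[OF M(2)])
  qed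
  moreover have "(\<Sum>i. g i w / w ^ Suc n) = h w / w ^ Suc n" if "w \<in> sphere 0 r" for w
    by (rule sums_unique[OF sums_divide[OF sums[OF that]], symmetric])
  ultimately have lim:
      "uniform_limit (sphere 0 r) (\<lambda>N w. \<Sum>i<N. g i w / w ^ Suc n) (\<lambda>w. h w / w ^ Suc n) sequentially"
    by (rule uniform_limit_cong'[THEN iffD1, OF refl, rotated])
  have int: "(\<lambda>w. g i w / w ^ Suc n) contour_integrable_on circlepath 0 r" for i
    by (rule contour_integrable_circle_coeff[OF r g])
  have "(\<lambda>N. contour_integral (circlepath 0 r) (\<lambda>w. \<Sum>i<N. g i w / w ^ Suc n))
      \<longlonglongrightarrow> contour_integral (circlepath 0 r) (\<lambda>w. h w / w ^ Suc n)"
    by (rule contour_integral_uniform_limit_circlepath(2)[OF _ lim _ r])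
       (intro always_eventually allI contour_integrable_sum int, simp_all)
  then have "(\<lambda>i. contour_integral (circlepath 0 r) (\<lambda>w. g i w / w ^ Suc n)) sums
      contour_integral (circlepath 0 r) (\<lambda>w. h w / w ^ Suc n)"
    unfolding sums_def by (simp add: contour_integral_sum int del: power_Suc)
  then show ?thesis unfolding circle_coeff_def by (rule sums_divide)
qed

definition torus_coeff :: "real \<Rightarrow> real \<Rightarrow> (complex \<times> complex \<Rightarrow> complex) \<Rightarrow> ps2" where
  "torus_coeff r s k i j = circle_coeff s (\<lambda>w. circle_coeff r (\<lambda>x. k (x, w)) i) j"

context
  fixes r s :: real and k :: "complex \<times> complex \<Rightarrow> complex"
  assumes r: "0 < r" and s: "0 < s" and k: "continuous_on (cball 0 r \<times> sphere 0 s) k"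
begin

lemma continuous_on_kernel_slices:
  shows "w \<in> sphere 0 s \<Longrightarrow> continuous_on (cball 0 r) (\<lambda>x. k (x, w))"
    and "x \<in> cball 0 r \<Longrightarrow> continuous_on (sphere 0 s) (\<lambda>w. k (x, w))"
  by (auto intro!: continuous_on_compose2[OF k] continuous_intros)

lemma kernel_bounded: "\<exists>M. \<forall>x\<in>cball 0 r. \<forall>w\<in>sphere 0 s. norm (k (x, w)) \<le> M"
proof -
  have "compact (k ` (cball 0 r \<times> sphere 0 s))"
    by (intro compact_continuous_image k compact_Times) auto
  then show ?thesis by (meson SigmaI bounded_iff compact_imp_bounded imageI)
qed

lemma inner_circle_coeff:
  shows "continuous_on (sphere 0 s) (\<lambda>w. circle_coeff r (\<lambda>x. k (x, w)) i)"
    and "(\<And>x w. x \<in> cball 0 r \<Longrightarrow> w \<in> sphere 0 s \<Longrightarrow> norm (k (x, w)) \<le> M) \<Longrightarrow>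
      w \<in> sphere 0 s \<Longrightarrow> norm (circle_coeff r (\<lambda>x. k (x, w)) i) \<le> M / r ^ i"
proof -
  have "continuous_on (sphere 0 s \<times> sphere 0 r) (\<lambda>z. k (snd z, fst z))"
    by (rule continuous_on_compose2[OF k]) (auto intro!: continuous_intros)
  from continuous_on_circle_coeff[OF this r]
  show "continuous_on (sphere 0 s) (\<lambda>w. circle_coeff r (\<lambda>x. k (x, w)) i)" by simp
  show "norm (circle_coeff r (\<lambda>x. k (x, w)) i) \<le> M / r ^ i"
    if "\<And>x w. x \<in> cball 0 r \<Longrightarrow> w \<in> sphere 0 s \<Longrightarrow> norm (k (x, w)) \<le> M" "w \<in> sphere 0 s"
    by (rule norm_circle_coeff_le[OF r])
       (use that in \<open>auto intro: continuous_on_subset[OF continuous_on_kernel_slices(1)]\<close>)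
qed

lemma torus_coeff_abs_conv:
  assumes "0 \<le> t" "t < min r s"
  shows "ps2_abs_conv (torus_coeff r s k) t"
proof -
  obtain M where M: "\<And>x w. x \<in> cball 0 r \<Longrightarrow> w \<in> sphere 0 s \<Longrightarrow> norm (k (x, w)) \<le> M"
    using kernel_bounded by blast
  have "norm (torus_coeff r s k i j) * min r s ^ (i + j) \<le> M" for i j
  proof -
    have "norm (torus_coeff r s k i j) \<le> M / r ^ i / s ^ j"
      unfolding torus_coeff_def
      by (rule norm_circle_coeff_le[OF s inner_circle_coeff(1)]) (rule inner_circle_coeff(2)[OF M])
    then have "norm (torus_coeff r s k i j) * (r ^ i * s ^ j) \<le> M"
      using r s by (simp add: field_simps)
    moreover have "min r s ^ (i + j) \<le> r ^ i * s ^ j"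
      unfolding power_add using r s by (intro mult_mono power_mono) auto
    ultimately show ?thesis by (meson mult_left_mono norm_ge_zero order_trans)
  qed
  then show ?thesis by (rule ps2_abs_conv_of_bounded[OF _ assms])
qed

lemma convergent_torus_coeff: "convergent_ps2 (torus_coeff r s k)"
  unfolding convergent_ps2_def using r s
  by (intro exI[of _ "min r s / 2"] conjI torus_coeff_abs_conv) auto

lemma torus_coeff_row_sums:
  assumes hol: "\<And>w. w \<in> sphere 0 s \<Longrightarrow> (\<lambda>x. k (x, w)) holomorphic_on ball 0 r" and x: "norm x < r"
  shows "(\<lambda>i. torus_coeff r s k i j * x ^ i) sums circle_coeff s (\<lambda>w. k (x, w)) j"
proof -
  obtain M where M: "\<And>x w. x \<in> cball 0 r \<Longrightarrow> w \<in> sphere 0 s \<Longrightarrow> norm (k (x, w)) \<le> M"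
    using kernel_bounded by blast
  have "(\<lambda>i. circle_coeff s (\<lambda>w. circle_coeff r (\<lambda>x. k (x, w)) i * x ^ i) j) sums
      circle_coeff s (\<lambda>w. k (x, w)) j"
  proof (rule circle_coeff_sums_uniform[OF s])
    show "continuous_on (sphere 0 s) (\<lambda>w. circle_coeff r (\<lambda>x. k (x, w)) i * x ^ i)" for i
      by (intro continuous_intros inner_circle_coeff(1))
    show "(\<lambda>i. circle_coeff r (\<lambda>x. k (x, w)) i * x ^ i) sums k (x, w)" if "w \<in> sphere 0 s" for w
      by (rule circle_coeff_sums[OF r continuous_on_kernel_slices(1)[OF that] hol[OF that] x])
    show "norm (circle_coeff r (\<lambda>x. k (x, w)) i * x ^ i) \<le> M * (norm x / r) ^ i" if "w \<in> sphere 0 s"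
      for i w
      using mult_right_mono[OF inner_circle_coeff(2)[OF M that, of i], of "norm x ^ i"]
      by (simp add: norm_mult norm_power power_divide)
    show "summable (\<lambda>i. M * (norm x / r) ^ i)"
      using x r by (intro summable_mult summable_geometric) (simp add: divide_less_eq)
  qed
  then show ?thesis by (simp add: torus_coeff_def circle_coeff_cmult[OF s inner_circle_coeff(1)])
qed

lemma torus_coeff_eval:
  assumes hol: "\<And>w. w \<in> sphere 0 s \<Longrightarrow> (\<lambda>x. k (x, w)) holomorphic_on ball 0 r"
    and xy: "norm x < min r s" "norm y < min r s"
    and f: "continuous_on (cball 0 s) f" "f holomorphic_on ball 0 s"
    and boundary: "\<And>w. w \<in> sphere 0 s \<Longrightarrow> f w = k (x, w)"
  shows "ps2_eval (torus_coeff r s k) (x, y) = f y"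
proof -
  obtain t where t: "max (norm x) (norm y) < t" "t < min r s"
    using dense[of "max (norm x) (norm y)" "min r s"] xy by auto
  have t0: "0 < t" using t(1) norm_ge_zero[of x] by linarith
  have "(\<Sum>i. torus_coeff r s k i j * x ^ i) = circle_coeff s f j" for j
    using sums_unique[OF torus_coeff_row_sums[OF hol, of x j]] xy
      circle_coeff_cong[of s f "\<lambda>w. k (x, w)"]
      boundary s by simp
  then have "(\<lambda>j. circle_coeff s f j * y ^ j) sums ps2_eval (torus_coeff r s k) (x, y)"
    using ps2_eval_rows(2)[OF torus_coeff_abs_conv[OF _ t(2)], of x y] t t0 by simp
  moreover have "(\<lambda>j. circle_coeff s f j * y ^ j) sums f y"
    using xy by (intro circle_coeff_sums[OF s f]) auto
  ultimately show ?thesis by (rule sums_unique2)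
qed

end

theorem holomorphic2_on_imp_ps2_eval:
  assumes F: "F holomorphic2_on U" "open U" "(0, 0) \<in> U"
  obtains a where "convergent_ps2 a" "\<forall>\<^sub>0z. F z = ps2_eval a z"
proof -
  obtain R where R: "R > 0" "polydisc R \<subseteq> U" using open_contains_polydisc[OF F(2,3)] by blast
  define r where "r = R / 2"
  have r: "r > 0" "r < R" using R by (auto simp: r_def)
  have FR: "F holomorphic2_on polydisc R" using F(1) R(2) by (rule holomorphic2_on_subset)
  then have k: "continuous_on (cball 0 r \<times> sphere 0 r) F"
    using r by (auto intro!: continuous_on_subset[OF holomorphic2_on_imp_continuous_on])
  have slices: "(\<lambda>x. F (x, w)) holomorphic_on ball 0 R" "(\<lambda>y. F (w, y)) holomorphic_on ball 0 R"
    if "norm w < R" for w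
    using that by (auto intro!: holomorphic2_on_imp_holomorphic_on[OF FR])
  have "ps2_eval (torus_coeff r r F) (x, y) = F (x, y)" if "norm x < r" "norm y < r" for x y
  proof (rule torus_coeff_eval[OF r(1) r(1) k])
    show "(\<lambda>x. F (x, w)) holomorphic_on ball 0 r" if "w \<in> sphere 0 r" for w
      using that r by (auto intro!: holomorphic_on_subset[OF slices(1)])
    have "(\<lambda>y. F (x, y)) holomorphic_on cball 0 r"
      using that r by (auto intro!: holomorphic_on_subset[OF slices(2)])
    then show "continuous_on (cball 0 r) (\<lambda>y. F (x, y))" "(\<lambda>y. F (x, y)) holomorphic_on ball 0 r"
      by (auto intro: holomorphic_on_imp_continuous_on holomorphic_on_subset)
  qed (use that in auto)
  then have "\<forall>\<^sub>0z. F z = ps2_eval (torus_coeff r r F) z"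
    unfolding near0_iff_polydisc using r(1) by (intro exI[of _ r]) auto
  then show ?thesis using convergent_torus_coeff[OF r(1) r(1) k] that by blast
qed

section \<open>The ring of convergent power series\<close>

declare One_nat_def [simp del]

lemma convergent_ps2_monomial: "convergent_ps2 (\<lambda>k l. if k = i \<and> l = j then c else 0)"
  unfolding convergent_ps2_iff_bounded by (intro exI[of _ 1] exI[of _ "norm c"]) auto

typedef cps = "{a. convergent_ps2 a}" morphisms coef Cps
  using convergent_ps2_monomial by blast

lemma convergent_coef [simp]: "convergent_ps2 (coef s)"
  using coef by simp

lemma coef_Cps [simp]: "convergent_ps2 a \<Longrightarrow> coef (Cps a) = a"
  by (simp add: Cps_inverse)

lemma cps_eqI: "(\<And>i j. coef s i j = coef t i j) \<Longrightarrow> s = t"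
  by (metis coef_inject ext)

definition ev :: "cps \<Rightarrow> complex \<times> complex \<Rightarrow> complex" where
  "ev s = ps2_eval (coef s)"

definition monom2 :: "complex \<Rightarrow> nat \<Rightarrow> nat \<Rightarrow> cps" where
  "monom2 c i j = Cps (\<lambda>k l. if k = i \<and> l = j then c else 0)"

abbreviation cst :: "complex \<Rightarrow> cps" where "cst c \<equiv> monom2 c 0 0"
abbreviation xvar :: cps where "xvar \<equiv> monom2 1 1 0"
abbreviation yvar :: cps where "yvar \<equiv> monom2 1 0 1"

instantiation cps :: "{zero, one, plus, minus, uminus, times}"
begin
definition "0 = cst 0"
definition "1 = cst 1"
definition "s + t = Cps (ps2_add (coef s) (coef t))"
definition "s - t = Cps (\<lambda>i j. coef s i j - coef t i j)"
definition "- s = Cps (\<lambda>i j. - coef s i j)"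
definition "s * t = Cps (ps2_mult (coef s) (coef t))"
instance ..
end

lemma coef_monom2: "coef (monom2 c i j) k l = (if k = i \<and> l = j then c else 0)"
  by (simp add: monom2_def convergent_ps2_monomial)

lemma cst_0 [simp]: "cst 0 = 0"
  and cst_1 [simp]: "cst 1 = 1"
  by (simp_all add: zero_cps_def one_cps_def)

lemma coef_0 [simp]: "coef 0 i j = 0"
  by (simp add: coef_monom2 flip: cst_0)

lemma coef_1: "coef 1 i j = (if i = 0 \<and> j = 0 then 1 else 0)"
  by (simp add: coef_monom2 flip: cst_1)

lemma coef_1_0_0 [simp]: "coef 1 0 0 = 1"
  by (simp add: coef_1)

lemma coef_monom2_0_0 [simp]: "coef (monom2 c i j) 0 0 = (if i = 0 \<and> j = 0 then c else 0)"
  by (simp add: coef_monom2)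

lemma coef_add [simp]: "coef (s + t) i j = coef s i j + coef t i j"
  using ps2_lincomb_near0(1)[of "coef s" "coef t" 1 1] by (simp add: plus_cps_def ps2_add_def)

lemma coef_diff [simp]: "coef (s - t) i j = coef s i j - coef t i j"
  using ps2_lincomb_near0(1)[of "coef s" "coef t" 1 "-1"] by (simp add: minus_cps_def)

lemma coef_uminus [simp]: "coef (- s) i j = - coef s i j"
  using ps2_lincomb_near0(1)[of "coef s" "coef s" "-1" 0] by (simp add: uminus_cps_def)

lemma coef_times: "coef (s * t) = ps2_mult (coef s) (coef t)"
  by (simp add: times_cps_def ps2_mult_near0)

lemma ev_monom2: "ev (monom2 c i j) z = c * fst z ^ i * snd z ^ j"
proof -
  have "ps2_eval (coef (monom2 c i j)) z =
      (\<Sum>\<^sub>\<infinity>p\<in>{(i, j)}. coef (monom2 c i j) (fst p) (snd p) * fst z ^ fst p * snd z ^ snd p)"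
    unfolding ps2_eval_def case_prod_unfold
    by (rule infsum_cong_neutral) (auto simp: coef_monom2)
  then show ?thesis by (simp add: ev_def coef_monom2)
qed

lemma ev_0 [simp]: "ev 0 z = 0" and ev_1 [simp]: "ev 1 z = 1"
  by (simp_all add: ev_monom2 flip: cst_0 cst_1)

lemma ev_add: "\<forall>\<^sub>0z. ev (s + t) z = ev s z + ev t z"
  using ps2_lincomb_near0(2)[of "coef s" "coef t" 1 1] by (simp add: ev_def coef_add[abs_def])

lemma ev_diff: "\<forall>\<^sub>0z. ev (s - t) z = ev s z - ev t z"
  using ps2_lincomb_near0(2)[of "coef s" "coef t" 1 "-1"] by (simp add: ev_def coef_diff[abs_def])

lemma ev_mult: "\<forall>\<^sub>0z. ev (s * t) z = ev s z * ev t z"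
  using ps2_mult_near0(2)[of "coef s" "coef t"] by (simp add: ev_def coef_times)

lemma ev_eqI:
  assumes "\<forall>\<^sub>0z. ev s z = ev t z"
  shows "s = t"
proof -
  have "\<forall>\<^sub>0z. ps2_eval (coef (s - t)) z = 0"
    using assms ev_diff[of s t] by eventually_elim (simp add: ev_def)
  then have "coef (s - t) i j = 0" for i j by (rule ps2_eval_eq_zero_imp_zero[OF convergent_coef])
  then show ?thesis by (intro cps_eqI) simp
qed

lemma sum_atMost_delta2:
  "(\<Sum>k\<le>m. \<Sum>l\<le>n. if k = i \<and> l = j then c else 0) =
   (if i \<le> m \<and> j \<le> n then c else (0 :: 'a :: comm_monoid_add))" for i j m n :: nat
proof -
  have "(\<Sum>k\<le>m. \<Sum>l\<le>n. if k = i \<and> l = j then c else 0) =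
      (\<Sum>p\<in>{..m} \<times> {..n}. if p = (i, j) then c else 0)"
    unfolding sum.cartesian_product by (intro sum.cong) (auto split: if_splits)
  then show ?thesis by (simp add: sum.delta)
qed

lemma coef_monom2_mult:
  "coef (monom2 c i j * s) k l = (if i \<le> k \<and> j \<le> l then c * coef s (k - i) (l - j) else 0)"
proof -
  have "coef (monom2 c i j * s) k l
      = (\<Sum>k'\<le>k. \<Sum>l'\<le>l. if k' = i \<and> l' = j then c * coef s (k - i) (l - j) else 0)"
    unfolding coef_times ps2_mult_def by (intro sum.cong) (auto simp: coef_monom2)
  then show ?thesis by (simp add: sum_atMost_delta2)
qed

instance cps :: comm_ring_1
proof
  fix a b c :: cps
  show "a * b * c = a * (b * c)"
    by (rule ev_eqI, use ev_mult[of "a * b" c] ev_mult[of a b] ev_mult[of a "b * c"] ev_mult[of b c]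
        in eventually_elim) simp
  show "a * b = b * a"
    by (rule ev_eqI, use ev_mult[of a b] ev_mult[of b a] in eventually_elim) simp
  show "1 * a = a"
    by (rule cps_eqI) (simp add: coef_monom2_mult flip: cst_1)
  show "(a + b) * c = a * c + b * c"
    by (rule ev_eqI, use ev_mult[of "a + b" c] ev_add[of a b] ev_add[of "a * c" "b * c"]
      ev_mult[of a c] ev_mult[of b c]
        in eventually_elim) (simp add: algebra_simps)
  show "(0 :: cps) \<noteq> 1" by (metis coef_0 coef_1_0_0 zero_neq_one)
qed (auto intro: cps_eqI)

lemma ev_power: "\<forall>\<^sub>0z. ev (s ^ n) z = ev s z ^ n"
proof (induction n)
  case (Suc n)
  then show ?case using ev_mult[of s "s ^ n"] by eventually_elim simp
qed simp

lemma monom2_mult: "monom2 c i j * monom2 d k l = monom2 (c * d) (i + k) (j + l)"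
  by (rule ev_eqI, use ev_mult[of "monom2 c i j" "monom2 d k l"] in eventually_elim)
     (simp add: ev_monom2 power_add)

lemma monom2_power: "monom2 c i j ^ n = monom2 (c ^ n) (i * n) (j * n)"
  by (induction n) (auto simp: monom2_mult)

lemma cst_power: "cst c ^ n = cst (c ^ n)"
  by (simp add: monom2_power)

lemma cst_mult_cst: "cst a * (cst b * s) = cst (a * b) * s"
  by (simp add: monom2_mult flip: mult.assoc)

lemma coef_cst_mult [simp]: "coef (cst c * s) i j = c * coef s i j"
  by (simp add: coef_monom2_mult)

lemma coef_sum: "coef (\<Sum>x\<in>I. f x) i j = (\<Sum>x\<in>I. coef (f x) i j)"
  by (induction I rule: infinite_finite_induct) auto

lemma coef_mult_0_0 [simp]: "coef (s * t) 0 0 = coef s 0 0 * coef t 0 0"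
  by (simp add: coef_times ps2_mult_def)

lemma coef_power_0_0 [simp]: "coef (s ^ n) 0 0 = coef s 0 0 ^ n"
  by (induction n) auto

lemma ev_0_0: "ev s (0, 0) = coef s 0 0"
proof -
  have "ev s (0, 0) = (\<Sum>\<^sub>\<infinity>p\<in>{(0, 0)}. coef s (fst p) (snd p) * 0 ^ fst p * 0 ^ snd p)"
    unfolding ev_def ps2_eval_def case_prod_unfold by (rule infsum_cong_neutral) auto
  then show ?thesis by simp
qed

subsection \<open>Order of vanishing\<close>

lemma coef_mult_low_order:
  assumes "\<And>i j. i + j < M \<Longrightarrow> coef s i j = 0" "\<And>i j. i + j < N \<Longrightarrow> coef t i j = 0" "i + j < M + N"
  shows "coef (s * t) i j = 0"
  unfolding coef_times ps2_mult_def
proof (intro sum.neutral ballI)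
  fix k l assume "k \<in> {..i}" "l \<in> {..j}"
  then have "k + l < M \<or> (i - k) + (j - l) < N" using assms(3) by auto
  then show "coef s k l * coef t (i - k) (j - l) = 0" using assms(1,2) by auto
qed

lemma coef_power_low_order:
  assumes "coef s 0 0 = 0" "i + j < n"
  shows "coef (s ^ n) i j = 0"
  using assms(2)
proof (induction n arbitrary: i j)
  case (Suc n)
  have "coef (s * s ^ n) i j = 0"
    by (rule coef_mult_low_order[where M = 1 and N = n]) (use Suc assms in auto)
  then show ?case by simp
qed simp

lemma coef_power_mult_low_order:
  "coef s 0 0 = 0 \<Longrightarrow> i + j < n \<Longrightarrow> coef (s ^ n * t) i j = 0"
  by (rule coef_mult_low_order[where M = n and N = 0]) (auto intro: coef_power_low_order)

lemma cps_divide_monom2: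
  assumes "\<And>i j. coef s i j \<noteq> 0 \<Longrightarrow> k \<le> i \<and> l \<le> j"
  obtains t where "s = monom2 1 k l * t" "\<And>i j. coef t i j = coef s (i + k) (j + l)"
proof -
  have conv: "convergent_ps2 (\<lambda>i j. coef s (i + k) (j + l))"
    by (rule convergent_ps2_reindex[where N = "k + l + 1"]) (auto simp: algebra_simps)
  define t where "t = Cps (\<lambda>i j. coef s (i + k) (j + l))"
  have t: "coef t i j = coef s (i + k) (j + l)" for i j using conv by (simp add: t_def)
  have "s = monom2 1 k l * t"
    by (rule cps_eqI) (use assms in \<open>auto simp: coef_monom2_mult t\<close>)
  then show ?thesis using t by (rule that)
qed

definition x_regular :: "cps \<Rightarrow> bool" where
  "x_regular s \<longleftrightarrow> (\<exists>j. coef s 0 j \<noteq> 0)"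

lemma x_regular_iff_fps_nonzero: "x_regular s \<longleftrightarrow> Abs_fps (coef s 0) \<noteq> 0"
  by (simp add: x_regular_def fps_eq_iff)

lemma fps_of_coef_0_mult: "Abs_fps (coef (s * t) 0) = Abs_fps (coef s 0) * Abs_fps (coef t 0)"
  by (simp add: fps_eq_iff fps_mult_nth coef_times ps2_mult_def atMost_atLeast0)

lemma x_regular_mult: "x_regular s \<Longrightarrow> x_regular t \<Longrightarrow> x_regular (s * t)"
  by (simp add: x_regular_iff_fps_nonzero fps_of_coef_0_mult)

lemma x_regular_power: "x_regular s \<Longrightarrow> x_regular (s ^ n)"
  by (induction n) (auto simp: x_regular_mult, auto simp: x_regular_def coef_1)

lemma x_regular_factor:
  assumes "s \<noteq> 0"
  obtains k t where "s = monom2 1 k 0 * t" "x_regular t"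
proof -
  have "\<exists>i j. coef s i j \<noteq> 0" using assms cps_eqI[of s 0] by fastforce
  then obtain k where k: "\<exists>j. coef s k j \<noteq> 0" "\<forall>i<k. \<not> (\<exists>j. coef s i j \<noteq> 0)"
    using exists_least_iff[of "\<lambda>i. \<exists>j. coef s i j \<noteq> 0"] by blast
  have "k \<le> i" if "coef s i j \<noteq> 0" for i j using k(2) that not_less by blast
  then obtain t where "s = monom2 1 k 0 * t" "\<And>i j. coef t i j = coef s (i + k) (j + 0)"
    using cps_divide_monom2[of s k 0] by auto
  then show ?thesis using that k(1) unfolding x_regular_def by simp
qed

lemma monom2_times_x_regular_nonzero: "x_regular s \<Longrightarrow> monom2 1 k 0 * s \<noteq> 0"
  using coef_monom2_mult[of 1 k 0 s k] by (auto simp: x_regular_def)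

instance cps :: idom
proof
  fix s t :: cps assume "s \<noteq> 0" "t \<noteq> 0"
  then obtain k s' l t' where s: "s = monom2 1 k 0 * s'" "x_regular s'"
    and t: "t = monom2 1 l 0 * t'" "x_regular t'"
    by (meson x_regular_factor)
  have "s * t = (monom2 1 k 0 * monom2 1 l 0) * (s' * t')" unfolding s(1) t(1) by (simp only: mult_ac)
  also have "\<dots> \<noteq> 0"
    using monom2_times_x_regular_nonzero[OF x_regular_mult[OF s(2) t(2)]] by (simp add: monom2_mult)
  finally show "s * t \<noteq> 0" .
qed

lemma x_order_unique:
  assumes "monom2 1 k 0 * s = monom2 1 l 0 * t" "x_regular s" "x_regular t"
  shows "k = l" "s = t"
proof -
  obtain i j where ij: "coef s 0 i \<noteq> 0" "coef t 0 j \<noteq> 0" using assms(2,3)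
    by (auto simp: x_regular_def)
  show "k = l"
    using arg_cong[OF assms(1), of "\<lambda>u. coef u k i"] arg_cong[OF assms(1), of "\<lambda>u. coef u l j"] ij
    by (auto simp: coef_monom2_mult split: if_splits)
  moreover have "monom2 1 l 0 \<noteq> (0 :: cps)"
    using coef_monom2[of 1 l 0 l 0] by auto
  ultimately show "s = t" using assms(1) by simp
qed

lemma cps_power_eq_imp:
  fixes s t :: cps
  assumes "s ^ n = t ^ n" "0 < n"
  obtains \<theta> where "\<theta> ^ n = 1" "s = cst \<theta> * t"
proof (cases "t = 0")
  case True
  then show ?thesis using that[of 1] assms by (simp add: zero_power)
next
  case t: False
  let ?roots = "(\<lambda>c. cst c * t) ` {c. c ^ n = 1}"
  let ?p = "Polynomial.monom 1 n - [:t ^ n:]"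
  have p: "poly ?p x = x ^ n - t ^ n" for x by (simp add: poly_monom)
  have "Polynomial.coeff ?p n = 1" using assms(2) by (cases n) auto
  then have p0: "?p \<noteq> 0" by (metis Polynomial.coeff_0 zero_neq_one)
  have deg: "Polynomial.degree ?p \<le> n"
    by (rule order_trans[OF degree_diff_le_max]) (auto simp: degree_monom_le)
  have "inj_on (\<lambda>c. cst c * t) {c. c ^ n = 1}"
  proof (rule inj_onI)
    fix c d assume "cst c * t = cst d * t"
    then have "cst c = cst d" using t by simp
    from arg_cong[OF this, of "\<lambda>s. coef s 0 0"] show "c = d" by simp
  qed
  then have card_roots: "card ?roots = n"
    using assms(2) by (simp add: card_image card_roots_unity_eq)
  have roots: "?roots \<subseteq> {x. poly ?p x = 0}"
    unfolding p by (auto simp: power_mult_distrib cst_power)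
  have "card {x. poly ?p x = 0} \<le> card ?roots"
    using card_poly_roots_bound[OF p0] deg card_roots by linarith
  then have "?roots = {x. poly ?p x = 0}"
    by (intro card_seteq[OF poly_roots_finite[OF p0] roots])
  moreover have "s \<in> {x. poly ?p x = 0}" using assms(1) unfolding p by simp
  ultimately show ?thesis using that by blast
qed

subsection \<open>Power series as holomorphic germs\<close>

lemma ev_holomorphic2_on: "\<forall>\<^sub>F r in at_right 0. ev s holomorphic2_on polydisc r"
  using convergent_ps2_eventually_abs_conv[OF convergent_coef[of s]]
  by eventually_elim (simp add: ev_def ps2_eval_holomorphic2_on)

lemma isCont_ev: "isCont (ev s) (0, 0)"
proof -
  obtain r where "r > 0" "ev s holomorphic2_on polydisc r"
    using ev_holomorphic2_on by (rule eventually_at_right_0E)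
  then show ?thesis by (intro holomorphic2_on_imp_isCont) auto
qed

lemma holomorphic2_on_imp_ev:
  assumes "F holomorphic2_on U" "open U" "(0, 0) \<in> U"
  obtains s where "\<forall>\<^sub>0z. ev s z = F z"
proof -
  obtain a where a: "convergent_ps2 a" "\<forall>\<^sub>0z. F z = ps2_eval a z"
    using holomorphic2_on_imp_ps2_eval[OF assms] .
  have "\<forall>\<^sub>0z. ev (Cps a) z = F z" using a(2) by eventually_elim (simp add: ev_def a(1))
  then show ?thesis by (rule that)
qed

lemma cps_unit:
  assumes "coef s 0 0 \<noteq> 0"
  obtains t where "s * t = 1"
proof -
  obtain r where r: "r > 0" "ev s holomorphic2_on polydisc r"
    using ev_holomorphic2_on by (rule eventually_at_right_0E)
  define U where "U = polydisc r \<inter> ev s -` (- {0})"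
  have U: "open U" "(0, 0) \<in> U"
    using continuous_open_preimage[OF holomorphic2_on_imp_continuous_on[OF r(2)]] r(1) assms
    by (auto simp: U_def ev_0_0)
  have "(\<lambda>z. 1 / ev s z) holomorphic2_on U"
    by (intro holomorphic2_intros holomorphic2_on_subset[OF r(2)]) (auto simp: U_def)
  then obtain t where t: "\<forall>\<^sub>0z. ev t z = 1 / ev s z" using holomorphic2_on_imp_ev[OF _ U] by blast
  have "s * t = 1"
    by (rule ev_eqI, use ev_mult[of s t] t eventually_nhds_in_open[OF U] in eventually_elim)
      (auto simp: U_def)
  then show ?thesis by (rule that)
qed

section \<open>Substitution\<close>

text \<open>Only meaningful if \<open>X\<close> and \<open>Y\<close> have no constant term.\<close>

definition subst :: "cps \<Rightarrow> cps \<Rightarrow> cps \<Rightarrow> cps" where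
  "subst s X Y = (SOME t. \<forall>\<^sub>0z. ev t z = ev s (ev X z, ev Y z))"

context
  fixes X Y :: cps
  assumes XY: "coef X 0 0 = 0" "coef Y 0 0 = 0"
begin

lemma ev_subst: "\<forall>\<^sub>0z. ev (subst s X Y) z = ev s (ev X z, ev Y z)"
proof -
  obtain r where r: "r > 0" "ps2_abs_conv (coef s) r"
    using convergent_coef[of s] unfolding convergent_ps2_def by blast
  have "\<forall>\<^sub>F \<rho> in at_right 0. ev X holomorphic2_on polydisc \<rho> \<and> ev Y holomorphic2_on polydisc \<rho>"
    by (intro eventually_conj ev_holomorphic2_on)
  then obtain \<rho> where \<rho>: "\<rho> > 0" "ev X holomorphic2_on polydisc \<rho>" "ev Y holomorphic2_on polydisc \<rho>"
    by (rule eventually_at_right_0E) auto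
  define U where "U = (polydisc \<rho> \<inter> ev X -` ball 0 r) \<inter> (polydisc \<rho> \<inter> ev Y -` ball 0 r)"
  have U: "open U" "(0, 0) \<in> U"
    using r \<rho> XY
    by (auto simp: U_def ev_0_0 intro!: continuous_open_preimage holomorphic2_on_imp_continuous_on)
  have "(\<lambda>z. ps2_eval (coef s) (ev X z, ev Y z)) holomorphic2_on U"
    by (rule holomorphic2_on_ps2_eval_compose[OF r(2)])
       (use U in \<open>auto simp: U_def less_imp_le intro: holomorphic2_on_subset[OF \<rho>(2)]
           holomorphic2_on_subset[OF \<rho>(3)]\<close>)
  then have "\<exists>t. \<forall>\<^sub>0z. ev t z = ev s (ev X z, ev Y z)"
    using holomorphic2_on_imp_ev[OF _ U] unfolding ev_def by metis
  then show ?thesis unfolding subst_def by (rule someI_ex)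
qed

lemma near0_compose:
  assumes "near0 P"
  shows "\<forall>\<^sub>0z. P (ev X z, ev Y z)"
proof -
  have "((\<lambda>z. (ev X z, ev Y z)) \<longlongrightarrow> (ev X (0, 0), ev Y (0, 0))) (nhds (0, 0))"
    using isCont_ev[of X] isCont_ev[of Y] unfolding isCont_def tendsto_at_iff_tendsto_nhds
    by (rule tendsto_Pair)
  then show ?thesis using assms XY by (simp add: ev_0_0 filterlim_iff)
qed

lemma subst_add: "subst (s + t) X Y = subst s X Y + subst t X Y"
  by (rule ev_eqI, use ev_subst[of "s + t"] ev_subst[of s] ev_subst[of t]
      near0_compose[OF ev_add, of s t] ev_add[of "subst s X Y" "subst t X Y"] in eventually_elim) simp

lemma subst_mult: "subst (s * t) X Y = subst s X Y * subst t X Y"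
  by (rule ev_eqI, use ev_subst[of "s * t"] ev_subst[of s] ev_subst[of t]
      near0_compose[OF ev_mult, of s t] ev_mult[of "subst s X Y" "subst t X Y"] in eventually_elim)
    simp

lemma subst_monom2: "subst (monom2 c i j) X Y = cst c * X ^ i * Y ^ j"
  by (rule ev_eqI, use ev_subst[of "monom2 c i j"] ev_mult[of "cst c * X ^ i" "Y ^ j"]
    ev_mult[of "cst c" "X ^ i"]
      ev_power[of X i] ev_power[of Y j] in eventually_elim) (simp add: ev_monom2)

lemma subst_cst: "subst (cst c) X Y = cst c"
  and subst_xvar: "subst xvar X Y = X"
  and subst_yvar: "subst yvar X Y = Y"
  by (simp_all add: subst_monom2)

lemma subst_1: "subst 1 X Y = 1"
  using subst_cst[of 1] by simp

lemma subst_power: "subst (s ^ n) X Y = subst s X Y ^ n"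
  by (induction n) (simp_all add: subst_1 subst_mult)

lemma subst_diff: "subst (s - t) X Y = subst s X Y - subst t X Y"
  using subst_add[of "s - t" t] by (simp add: algebra_simps)

lemma coef_subst_0_0: "coef (subst s X Y) 0 0 = coef s 0 0"
  using eventually_nhds_x_imp_x[OF ev_subst[of s]] by (simp add: ev_0_0 XY)

end

lemma subst_subst:
  assumes "coef X 0 0 = 0" "coef Y 0 0 = 0" "coef X' 0 0 = 0" "coef Y' 0 0 = 0"
  shows "subst (subst s X Y) X' Y' = subst s (subst X X' Y') (subst Y X' Y')"
proof (rule ev_eqI)
  note a = ev_subst[OF assms(3,4)]
  have "\<forall>\<^sub>0z. ev (subst s (subst X X' Y') (subst Y X' Y')) z =
      ev s (ev (subst X X' Y') z, ev (subst Y X' Y') z)"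
    by (rule ev_subst) (simp_all add: coef_subst_0_0 assms)
  with a[of "subst s X Y"] a[of X] a[of Y] near0_compose[OF assms(3,4) ev_subst[OF assms(1,2), of s]]
  show "\<forall>\<^sub>0z. ev (subst (subst s X Y) X' Y') z = ev (subst s (subst X X' Y') (subst Y X' Y')) z"
    by eventually_elim simp
qed

lemma coef_vars_0_0: "coef xvar 0 0 = 0" "coef yvar 0 0 = 0"
  by simp_all

lemma subst_xvar_yvar: "subst s xvar yvar = s"
  by (rule ev_eqI, use ev_subst[OF coef_vars_0_0, of s] in eventually_elim) (simp add: ev_monom2)

section \<open>Algebras of power series\<close>

locale cps_subalgebra =
  fixes A :: "cps set"
  assumes one_closed: "1 \<in> A"
    and add_closed: "a \<in> A \<Longrightarrow> b \<in> A \<Longrightarrow> a + b \<in> A"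
    and mult_closed: "a \<in> A \<Longrightarrow> b \<in> A \<Longrightarrow> a * b \<in> A"
    and scalar_closed: "a \<in> A \<Longrightarrow> cst c * a \<in> A"
begin

lemma cst_closed: "cst c \<in> A"
  using scalar_closed[OF one_closed, of c] by simp

lemma zero_closed: "0 \<in> A"
  using cst_closed[of 0] by simp

lemma power_closed: "a \<in> A \<Longrightarrow> a ^ n \<in> A"
  by (induction n) (auto intro: one_closed mult_closed)

lemma sum_closed: "(\<And>x. x \<in> I \<Longrightarrow> f x \<in> A) \<Longrightarrow> sum f I \<in> A"
  by (induction I rule: infinite_finite_induct) (auto intro: zero_closed add_closed)

end

locale cps_hom = cps_subalgebra A for A +
  fixes \<psi> :: "cps \<Rightarrow> cps"
  assumes map_add: "a \<in> A \<Longrightarrow> b \<in> A \<Longrightarrow> \<psi> (a + b) = \<psi> a + \<psi> b"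
    and map_mult: "a \<in> A \<Longrightarrow> b \<in> A \<Longrightarrow> \<psi> (a * b) = \<psi> a * \<psi> b"
    and map_scalar: "a \<in> A \<Longrightarrow> \<psi> (cst c * a) = cst c * \<psi> a"
    and map_one: "\<psi> 1 = 1"
begin

lemma map_cst: "\<psi> (cst c) = cst c"
  using map_scalar[OF one_closed, of c] by (simp add: map_one)

lemma map_zero: "\<psi> 0 = 0"
  using map_cst[of 0] by simp

lemma map_power: "a \<in> A \<Longrightarrow> \<psi> (a ^ n) = \<psi> a ^ n"
  by (induction n) (simp_all add: map_one map_mult power_closed)

lemma map_sum: "(\<And>x. x \<in> I \<Longrightarrow> f x \<in> A) \<Longrightarrow> \<psi> (sum f I) = (\<Sum>x\<in>I. \<psi> (f x))"
  by (induction I rule: infinite_finite_induct) (auto simp: map_zero map_add sum_closed)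

lemma cps_subalgebra_image: "cps_subalgebra (\<psi> ` A)"
proof
  show "1 \<in> \<psi> ` A" using map_one one_closed by force
qed (auto simp: map_add[symmetric] map_mult[symmetric] map_scalar[symmetric]
    intro: add_closed mult_closed scalar_closed)

lemma cps_hom_inv_into:
  assumes "inj_on \<psi> A"
  shows "cps_hom (\<psi> ` A) (inv_into A \<psi>)"
proof -
  interpret image: cps_subalgebra "\<psi> ` A" by (rule cps_subalgebra_image)
  have inv: "inv_into A \<psi> (\<psi> a) = a" if "a \<in> A" for a using assms that by simp
  show ?thesis
  proof
    show "inv_into A \<psi> 1 = 1" using inv[OF one_closed] by (simp add: map_one)
  qed (auto simp: inv map_add[symmetric] map_mult[symmetric] map_scalar[symmetric]
      add_closed mult_closed scalar_closed)
qed

end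

lemma cps_subalgebra_equalizer:
  assumes "cps_hom A \<phi>" "cps_hom A \<psi>"
  shows "cps_subalgebra {a \<in> A. \<phi> a = \<psi> a}"
proof -
  interpret \<phi>: cps_hom A \<phi> by (rule assms(1))
  interpret \<psi>: cps_hom A \<psi> by (rule assms(2))
  show ?thesis
    by unfold_locales (auto simp: \<phi>.map_add \<phi>.map_mult \<phi>.map_scalar \<phi>.map_one
        \<psi>.map_add \<psi>.map_mult \<psi>.map_scalar \<psi>.map_one
        intro: \<phi>.one_closed \<phi>.add_closed \<phi>.mult_closed \<phi>.scalar_closed)
qed

lemma cps_hom_compose:
  assumes "cps_hom A \<phi>" "cps_hom B \<psi>" "\<phi> ` A \<subseteq> B"
  shows "cps_hom A (\<lambda>a. \<psi> (\<phi> a))"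
proof -
  interpret \<phi>: cps_hom A \<phi> by (rule assms(1))
  interpret \<psi>: cps_hom B \<psi> by (rule assms(2))
  have "\<phi> a \<in> B" if "a \<in> A" for a using assms(3) that by blast
  then show ?thesis
    by unfold_locales (simp_all add: \<phi>.map_add \<phi>.map_mult \<phi>.map_scalar \<phi>.map_one
        \<psi>.map_add \<psi>.map_mult \<psi>.map_scalar \<psi>.map_one)
qed

definition cps_iso :: "cps set \<Rightarrow> cps set \<Rightarrow> bool" where
  "cps_iso A B \<longleftrightarrow> (\<exists>\<psi>. cps_hom A \<psi> \<and> bij_betw \<psi> A B)"

lemma cps_iso_sym:
  assumes "cps_iso A B"
  shows "cps_iso B A"
proof -
  obtain \<psi> where \<psi>: "cps_hom A \<psi>" "inj_on \<psi> A" "B = \<psi> ` A"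
    using assms by (auto simp: cps_iso_def bij_betw_def)
  then show ?thesis
    using cps_hom.cps_hom_inv_into[OF \<psi>(1,2)] inj_on_imp_bij_betw[OF \<psi>(2)] bij_betw_inv_into
    unfolding cps_iso_def by blast
qed

lemma cps_iso_trans:
  assumes "cps_iso A B" "cps_iso B C"
  shows "cps_iso A C"
proof -
  obtain \<phi> \<psi> where "cps_hom A \<phi>" "bij_betw \<phi> A B" "cps_hom B \<psi>" "bij_betw \<psi> B C"
    using assms by (auto simp: cps_iso_def)
  then show ?thesis
    using cps_hom_compose[of A \<phi> B \<psi>] bij_betw_trans[of \<phi> A B \<psi> C]
    unfolding cps_iso_def comp_def by (auto dest: bij_betw_imp_surj_on)
qed

lemma cps_hom_subst:
  assumes "coef X 0 0 = 0" "coef Y 0 0 = 0" "cps_subalgebra A"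
  shows "cps_hom A (\<lambda>s. subst s X Y)"
proof -
  interpret cps_subalgebra A by (rule assms(3))
  show ?thesis
    by unfold_locales (simp_all add: subst_add subst_mult subst_1 subst_cst assms(1,2))
qed

section \<open>Invariant rings\<close>

definition inv_ring :: "nat \<Rightarrow> nat \<Rightarrow> cps set" where
  "inv_ring m q = {s. \<forall>i j. coef s i j \<noteq> 0 \<longrightarrow> m dvd i + q * j}"

lemma inv_ring_1 [simp]: "inv_ring 1 q = UNIV"
  by (simp add: inv_ring_def)

lemma monom2_in_inv_ring: "m dvd i + q * j \<Longrightarrow> monom2 c i j \<in> inv_ring m q"
  by (auto simp: inv_ring_def coef_monom2)

lemma mult_in_inv_ring:
  assumes "a \<in> inv_ring m q" "b \<in> inv_ring m q"
  shows "a * b \<in> inv_ring m q"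
  unfolding inv_ring_def
proof (intro CollectI allI impI)
  fix i j assume "coef (a * b) i j \<noteq> 0"
  then obtain k l where kl: "k \<le> i" "l \<le> j" "coef a k l * coef b (i - k) (j - l) \<noteq> 0"
    unfolding coef_times ps2_mult_def
    by (metis (no_types, lifting) atMost_iff sum.not_neutral_contains_not_neutral)
  then have "coef a k l \<noteq> 0" "coef b (i - k) (j - l) \<noteq> 0" by auto
  then have "m dvd k + q * l" "m dvd (i - k) + q * (j - l)" using assms unfolding inv_ring_def
    by blast+
  then have "m dvd (k + q * l) + ((i - k) + q * (j - l))" by (rule dvd_add)
  also have "(k + q * l) + ((i - k) + q * (j - l)) = i + q * j"
    using kl by (auto simp: le_iff_add algebra_simps)
  finally show "m dvd i + q * j" .
qed

interpretation inv_ring: cps_subalgebra "inv_ring m q" for m q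
proof
  show "1 \<in> inv_ring m q" by (auto simp: inv_ring_def coef_1)
  show "cst c * a \<in> inv_ring m q" if "a \<in> inv_ring m q" for a c
    using that by (auto simp: inv_ring_def)
  show "a + b \<in> inv_ring m q" if "a \<in> inv_ring m q" "b \<in> inv_ring m q" for a b
    unfolding inv_ring_def
  proof (intro CollectI allI impI)
    fix i j assume "coef (a + b) i j \<noteq> 0"
    then have "coef a i j \<noteq> 0 \<or> coef b i j \<noteq> 0" by auto
    then show "m dvd i + q * j" using that by (auto simp: inv_ring_def)
  qed
qed (rule mult_in_inv_ring)

subsection \<open>Truncation\<close>

definition truncate :: "nat \<Rightarrow> cps \<Rightarrow> cps" where
  "truncate K s = (\<Sum>(i, j)\<in>{..<K} \<times> {..<K}. monom2 (coef s i j) i j)"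

lemma coef_truncate: "coef (truncate K s) k l = (if k < K \<and> l < K then coef s k l else 0)"
proof -
  have "coef (truncate K s) k l = (\<Sum>p\<in>{..<K} \<times> {..<K}. if p = (k, l) then coef s k l else 0)"
    unfolding truncate_def coef_sum case_prod_unfold by (intro sum.cong) (auto simp: coef_monom2)
  then show ?thesis by (auto simp: sum.delta)
qed

lemma truncate_in_inv_ring: "s \<in> inv_ring m q \<Longrightarrow> truncate K s \<in> inv_ring m q"
  by (auto simp: inv_ring_def coef_truncate)

lemma inv_ring_truncate:
  assumes b: "b \<in> inv_ring m q" and K: "m dvd K"
  obtains b1 b2 where "b1 \<in> inv_ring m q" "b2 \<in> inv_ring m q"
    "b = truncate K b + monom2 1 K 0 * b1 + monom2 1 0 K * b2"
proof -
  define r1 where "r1 = Cps (\<lambda>i j. if K \<le> i then coef b i j else 0)"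
  define r2 where "r2 = Cps (\<lambda>i j. if i < K \<and> K \<le> j then coef b i j else 0)"
  have r1: "coef r1 i j = (if K \<le> i then coef b i j else 0)"
    and r2: "coef r2 i j = (if i < K \<and> K \<le> j then coef b i j else 0)" for i j
    unfolding r1_def r2_def
    by (subst coef_Cps; auto intro: convergent_ps2_mono[OF convergent_coef[of b]])+
  obtain b1 where b1: "r1 = monom2 1 K 0 * b1" "\<And>i j. coef b1 i j = coef r1 (i + K) (j + 0)"
    using cps_divide_monom2[of r1 K 0] r1 by (metis le0)
  obtain b2 where b2: "r2 = monom2 1 0 K * b2" "\<And>i j. coef b2 i j = coef r2 (i + 0) (j + K)"
    using cps_divide_monom2[of r2 0 K] r2 by (metis le0)
  have shift: "m dvd i + K + q * j \<longleftrightarrow> m dvd i + q * j" "m dvd i + q * (j + K) \<longleftrightarrow> m dvd i + q * j"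
    for i j
    using dvd_add_left_iff[OF K, of "i + q * j"]
      dvd_add_left_iff[OF dvd_mult[OF K, of q], of "i + q * j"]
    by (simp_all add: algebra_simps)
  have support: "m dvd i + q * j" if "coef b i j \<noteq> 0" for i j
    using b that by (simp add: inv_ring_def)
  have "m dvd i + q * j" if "coef b1 i j \<noteq> 0" for i j
    using support[of "i + K" j] that by (simp add: b1(2) r1 shift)
  moreover have "m dvd i + q * j" if "coef b2 i j \<noteq> 0" for i j
    using support[of i "j + K"] that by (simp add: b2(2) r2 shift split: if_splits)
  ultimately have "b1 \<in> inv_ring m q" "b2 \<in> inv_ring m q"
    by (simp_all add: inv_ring_def)
  moreover have "b = truncate K b + r1 + r2"
    by (rule cps_eqI) (auto simp: coef_truncate r1 r2)
  ultimately show ?thesis using that b1(1) b2(1) by simp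
qed

text \<open>A homomorphism that sends the invariant monomials to those in \<open>X\<close>, \<open>Y\<close> is determined
  up to any order by the truncations of its argument.\<close>

lemma coef_hom_monomial:
  assumes "cps_hom (inv_ring m q) \<psi>" and XY: "coef X 0 0 = 0" "coef Y 0 0 = 0"
    and monomials: "\<And>i j. m dvd i + q * j \<Longrightarrow> \<psi> (monom2 1 i j) = X ^ i * Y ^ j"
    and b: "b \<in> inv_ring m q" and K: "m dvd K" "i + j < K"
  shows "coef (\<psi> b) i j = (\<Sum>(k, l)\<in>{..<K} \<times> {..<K}. coef b k l * coef (X ^ k * Y ^ l) i j)"
proof -
  interpret \<psi>: cps_hom "inv_ring m q" \<psi> by fact
  have term_in: "monom2 (coef b k l) k l \<in> inv_ring m q" for k l
    using b by (auto simp: inv_ring_def coef_monom2)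
  have map_term: "\<psi> (monom2 (coef b k l) k l) = cst (coef b k l) * (X ^ k * Y ^ l)" for k l
  proof (cases "coef b k l = 0")
    case True
    then have "monom2 (coef b k l) k l = 0" by (intro cps_eqI) (simp add: coef_monom2)
    then show ?thesis using True by (simp add: \<psi>.map_zero)
  next
    case False
    then have dvd: "m dvd k + q * l" using b by (auto simp: inv_ring_def)
    show ?thesis
      using \<psi>.map_scalar[OF monom2_in_inv_ring[OF dvd], of "coef b k l" 1] monomials[OF dvd]
      by (simp add: monom2_mult)
  qed
  obtain b1 b2 where b12: "b1 \<in> inv_ring m q" "b2 \<in> inv_ring m q"
    and decomp: "b = truncate K b + monom2 1 K 0 * b1 + monom2 1 0 K * b2"
    by (rule inv_ring_truncate[OF b K(1)])
  have powers: "monom2 1 K 0 \<in> inv_ring m q" "monom2 1 0 K \<in> inv_ring m q"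
    using K(1) by (auto intro: monom2_in_inv_ring)
  have "\<psi> b = \<psi> (truncate K b) + X ^ K * \<psi> b1 + Y ^ K * \<psi> b2"
    by (subst decomp) (simp add: \<psi>.map_add \<psi>.map_mult powers b12 truncate_in_inv_ring[OF b]
        inv_ring.add_closed inv_ring.mult_closed monomials K(1))
  then have "coef (\<psi> b) i j = coef (\<psi> (truncate K b)) i j"
    using coef_power_mult_low_order XY K(2) by simp
  also have "\<psi> (truncate K b) = (\<Sum>(k, l)\<in>{..<K} \<times> {..<K}. cst (coef b k l) * (X ^ k * Y ^ l))"
    unfolding truncate_def
    by (subst \<psi>.map_sum) (auto simp: term_in map_term intro!: sum.cong)
  finally show ?thesis by (simp add: coef_sum case_prod_unfold)
qed

lemma coef_subst:
  assumes "coef X 0 0 = 0" "coef Y 0 0 = 0" "i + j < K"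
  shows "coef (subst s X Y) i j = (\<Sum>(k, l)\<in>{..<K} \<times> {..<K}. coef s k l * coef (X ^ k * Y ^ l) i j)"
  using coef_hom_monomial[OF cps_hom_subst[OF assms(1,2) inv_ring.cps_subalgebra_axioms] assms(1,2),
    of 1 0 s K i j] assms
  by (simp add: subst_monom2)

lemma hom_eq_subst:
  assumes "0 < m" and hom: "cps_hom (inv_ring m q) \<psi>" and XY: "coef X 0 0 = 0" "coef Y 0 0 = 0"
    and monomials: "\<And>i j. m dvd i + q * j \<Longrightarrow> \<psi> (monom2 1 i j) = X ^ i * Y ^ j"
    and b: "b \<in> inv_ring m q"
  shows "\<psi> b = subst b X Y"
proof (rule cps_eqI)
  fix i j
  have K: "i + j < m * Suc (i + j)" using assms(1) by (cases m) auto
  show "coef (\<psi> b) i j = coef (subst b X Y) i j"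
    by (rule trans[OF coef_hom_monomial[OF hom XY monomials b dvd_triv_left K]
      coef_subst[OF XY K, symmetric]])
qed

subsection \<open>Monomial substitutions\<close>

context
  fixes a b c d :: nat
  assumes nonconst: "0 < a + b" "0 < c + d"
begin

lemma coef_subst_monom2:
  "coef (subst s (monom2 \<alpha> a b) (monom2 \<beta> c d)) i j =
    (\<Sum>(k, l)\<in>{..i + j} \<times> {..i + j}. if a * k + c * l = i \<and> b * k + d * l = j
      then \<alpha> ^ k * \<beta> ^ l * coef s k l else 0)"
proof -
  have "coef (monom2 \<alpha> a b) 0 0 = 0" "coef (monom2 \<beta> c d) 0 0 = 0" using nonconst by auto
  from coef_subst[OF this, of i j "Suc (i + j)"] show ?thesis
    by (auto simp: monom2_power monom2_mult coef_monom2 lessThan_Suc_atMost intro!: sum.cong)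
qed

lemma coef_subst_monom2_unique:
  assumes "\<And>k l. a * k + c * l = i \<and> b * k + d * l = j \<longleftrightarrow> k = k0 \<and> l = l0"
  shows "coef (subst s (monom2 \<alpha> a b) (monom2 \<beta> c d)) i j = \<alpha> ^ k0 * \<beta> ^ l0 * coef s k0 l0"
proof -
  have "i + j = (a + b) * k0 + (c + d) * l0" using assms[of k0 l0] by (auto simp: algebra_simps)
  moreover have "1 * k0 \<le> (a + b) * k0" "1 * l0 \<le> (c + d) * l0"
    using nonconst by (intro mult_le_mono1; linarith)+
  ultimately have bounds: "k0 \<le> i + j" "l0 \<le> i + j" by linarith+
  have "coef (subst s (monom2 \<alpha> a b) (monom2 \<beta> c d)) i j =
      (\<Sum>p\<in>{..i + j} \<times> {..i + j}. if p = (k0, l0) then \<alpha> ^ k0 * \<beta> ^ l0 * coef s k0 l0 else 0)"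
    unfolding coef_subst_monom2 by (rule sum.cong) (auto simp: assms split: if_splits)
  then show ?thesis using bounds by (simp add: sum.delta)
qed

lemma coef_subst_monom2_eq_0:
  "(\<And>k l. \<not> (a * k + c * l = i \<and> b * k + d * l = j)) \<Longrightarrow>
    coef (subst s (monom2 \<alpha> a b) (monom2 \<beta> c d)) i j = 0"
  unfolding coef_subst_monom2 by (rule sum.neutral) auto

end

definition scale :: "complex \<Rightarrow> complex \<Rightarrow> cps \<Rightarrow> cps" where
  "scale \<alpha> \<beta> s = subst s (monom2 \<alpha> 1 0) (monom2 \<beta> 0 1)"

lemma coef_scale: "coef (scale \<alpha> \<beta> s) i j = \<alpha> ^ i * \<beta> ^ j * coef s i j"
  unfolding scale_def by (rule coef_subst_monom2_unique) auto

lemma coef_subst_swap: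
  "coef (subst s (monom2 \<alpha> 0 1) (monom2 \<beta> 1 0)) i j = \<alpha> ^ j * \<beta> ^ i * coef s j i"
  by (rule coef_subst_monom2_unique) auto

lemma coef_subst_powers:
  assumes "0 < a" "0 < b"
  shows "coef (subst s (monom2 1 a 0) (monom2 1 0 b)) i j =
    (if a dvd i \<and> b dvd j then coef s (i div a) (j div b) else 0)"
proof (cases "a dvd i \<and> b dvd j")
  case True
  have "coef (subst s (monom2 1 a 0) (monom2 1 0 b)) i j =
      1 ^ (i div a) * 1 ^ (j div b) * coef s (i div a) (j div b)"
    by (rule coef_subst_monom2_unique) (use assms True in auto)
  then show ?thesis using True by simp
next
  case False
  then show ?thesis by (subst coef_subst_monom2_eq_0) (use assms in auto)
qed

lemma scale_eq_iff: "scale \<alpha> \<beta> s = s \<longleftrightarrow> (\<forall>i j. coef s i j \<noteq> 0 \<longrightarrow> \<alpha> ^ i * \<beta> ^ j = 1)"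
proof -
  have "scale \<alpha> \<beta> s = s \<longleftrightarrow> (\<forall>i j. \<alpha> ^ i * \<beta> ^ j * coef s i j = coef s i j)"
    using coef_scale[of \<alpha> \<beta> s] cps_eqI[of "scale \<alpha> \<beta> s" s] by metis
  then show ?thesis by auto
qed

lemma subst_scale:
  assumes "coef X 0 0 = 0" "coef Y 0 0 = 0"
  shows "subst (scale \<alpha> \<beta> s) X Y = subst s (cst \<alpha> * X) (cst \<beta> * Y)"
  using subst_subst[of "monom2 \<alpha> 1 0" "monom2 \<beta> 0 1" X Y s]
  by (simp add: assms subst_monom2 scale_def)

lemma scale_subst:
  assumes "coef X 0 0 = 0" "coef Y 0 0 = 0"
  shows "scale \<alpha> \<beta> (subst s X Y) = subst s (scale \<alpha> \<beta> X) (scale \<alpha> \<beta> Y)"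
  unfolding scale_def by (rule subst_subst) (use assms in auto)

subsection \<open>The action of the roots of unity\<close>

definition unity_root :: "nat \<Rightarrow> complex" where
  "unity_root m = cis (2 * pi / real m)"

lemma unity_root_power_eq_1_iff:
  assumes "0 < m"
  shows "unity_root m ^ k = 1 \<longleftrightarrow> m dvd k"
  using complex_root_unity_eq_1[of m k] assms
  by (simp add: unity_root_def cis_conv_exp flip: exp_of_nat_mult add: mult_ac)

lemma unity_root_power_eq_iff:
  assumes "0 < m"
  shows "unity_root m ^ a = unity_root m ^ b \<longleftrightarrow> [a = b] (mod m)"
proof (induction a b rule: linorder_wlog)
  case (le a b)
  have "unity_root m ^ b = unity_root m ^ a * unity_root m ^ (b - a)" using le
    by (simp flip: power_add)
  then have "unity_root m ^ a = unity_root m ^ b \<longleftrightarrow> unity_root m ^ (b - a) = 1"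
    by (auto simp: unity_root_def)
  also have "\<dots> \<longleftrightarrow> [a = b] (mod m)"
    using le unity_root_power_eq_1_iff[OF assms] by (metis cong_altdef_nat cong_sym)
  finally show ?case .
next
  case (sym a b)
  then show ?case by (metis cong_sym)
qed

lemma unity_root_power_dvd:
  assumes "0 < m" "d dvd m"
  shows "unity_root m ^ d = unity_root (m div d)"
proof -
  have "unity_root m ^ d = cis (real d * (2 * pi / real m))" unfolding unity_root_def
    by (rule Complex.DeMoivre)
  also have "real d * (2 * pi / real m) = 2 * pi / real (m div d)"
    using assms by (auto simp: real_of_nat_div)
  finally show ?thesis by (simp add: unity_root_def)
qed

definition mu_act :: "nat \<Rightarrow> nat \<Rightarrow> cps \<Rightarrow> cps" where
  "mu_act m q = scale (unity_root m) (unity_root m ^ q)"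

lemma coef_mu_act: "coef (mu_act m q s) i j = unity_root m ^ (i + q * j) * coef s i j"
  by (simp add: mu_act_def coef_scale power_add power_mult)

lemma mu_act_add: "mu_act m q (s + t) = mu_act m q s + mu_act m q t"
  and mu_act_mult: "mu_act m q (s * t) = mu_act m q s * mu_act m q t"
  and mu_act_power: "mu_act m q (s ^ n) = mu_act m q s ^ n"
  by (simp_all add: mu_act_def scale_def subst_add subst_mult subst_power)

lemma mu_act_monom2: "mu_act m q (monom2 c i j) = cst (unity_root m ^ (i + q * j)) * monom2 c i j"
  by (rule cps_eqI) (simp add: coef_mu_act coef_monom2)

lemma inv_ring_iff_mu_act: "0 < m \<Longrightarrow> s \<in> inv_ring m q \<longleftrightarrow> mu_act m q s = s"
  by (simp add: mu_act_def scale_eq_iff inv_ring_def unity_root_power_eq_1_iff flip: power_mult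
    power_add)

lemma subst_in_inv_ring_iff:
  assumes "0 < m" "0 < n" and XY: "coef X 0 0 = 0" "coef Y 0 0 = 0"
    and inj: "\<And>s t. subst s X Y = subst t X Y \<Longrightarrow> s = t"
    and weights: "mu_act m q X = cst (unity_root n) * X" "mu_act m q Y = cst (unity_root n ^ p) * Y"
  shows "subst s X Y \<in> inv_ring m q \<longleftrightarrow> s \<in> inv_ring n p"
proof -
  have "mu_act m q (subst s X Y) = subst (mu_act n p s) X Y"
    using weights by (simp add: mu_act_def scale_subst[OF XY] subst_scale[OF XY])
  then show ?thesis
    using inj unfolding inv_ring_iff_mu_act[OF assms(1)] inv_ring_iff_mu_act[OF assms(2)] by metis
qed

lemma root_of_invariant:
  assumes "s ^ n \<in> inv_ring m q" "0 < n" "0 < m"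
  obtains \<theta> where "mu_act m q s = cst \<theta> * s"
proof -
  have "mu_act m q s ^ n = s ^ n"
    using assms(1,3) by (simp add: inv_ring_iff_mu_act mu_act_power)
  then show ?thesis using cps_power_eq_imp[OF _ assms(2)] that by metis
qed

lemma linear_coefs_of_weight:
  assumes "mu_act m q s = cst \<theta> * s"
  shows "unity_root m * coef s 1 0 = \<theta> * coef s 1 0" "unity_root m ^ q * coef s 0 1 = \<theta> * coef s 0 1"
  using arg_cong[OF assms, of "\<lambda>u. coef u 1 0"] arg_cong[OF assms, of "\<lambda>u. coef u 0 1"]
  by (simp_all add: coef_mu_act)

lemma inv_ring_unit:
  assumes "s \<in> inv_ring m q" "coef s 0 0 \<noteq> 0" "0 < m"
  obtains t where "t \<in> inv_ring m q" "s * t = 1"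
proof -
  obtain t where t: "s * t = 1" using cps_unit[OF assms(2)] .
  have "s * mu_act m q t = mu_act m q (s * t)"
    using assms(1,3) by (simp add: mu_act_mult inv_ring_iff_mu_act)
  also have "\<dots> = s * t" using mu_act_monom2[of m q 1 0 0] t by simp
  finally have "mu_act m q t = t" using t by (metis mult_left_cancel mult_zero_left zero_neq_one)
  then show ?thesis using that t assms(3) by (simp add: inv_ring_iff_mu_act)
qed

lemma coef_hom_0_0:
  assumes "cps_hom (inv_ring m q) \<psi>" "b \<in> inv_ring m q" "0 < m"
  shows "coef (\<psi> b) 0 0 = coef b 0 0"
proof (rule ccontr)
  interpret \<psi>: cps_hom "inv_ring m q" \<psi> by fact
  define c where "c = coef (\<psi> b) 0 0"
  define b' where "b' = b + cst (- c)"
  assume "coef (\<psi> b) 0 0 \<noteq> coef b 0 0"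
  then have "coef b' 0 0 \<noteq> 0" by (simp add: b'_def c_def)
  moreover have b': "b' \<in> inv_ring m q"
    unfolding b'_def by (intro inv_ring.add_closed inv_ring.cst_closed assms(2))
  ultimately obtain t where t: "t \<in> inv_ring m q" "b' * t = 1" using inv_ring_unit assms(3) by blast
  have "\<psi> b' * \<psi> t = 1" using \<psi>.map_mult[OF b' t(1)] t(2) by (simp add: \<psi>.map_one)
  moreover have "coef (\<psi> b') 0 0 = 0"
    by (simp add: b'_def c_def \<psi>.map_add \<psi>.map_cst inv_ring.cst_closed assms(2))
  ultimately show False using coef_mult_0_0[of "\<psi> b'" "\<psi> t"] by simp
qed

section \<open>Partial derivatives\<close>

definition flip :: "cps \<Rightarrow> cps" where
  "flip s = subst s yvar xvar"

lemma coef_flip [simp]: "coef (flip s) i j = coef s j i"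
  using coef_subst_swap[of s 1 1] by (simp add: flip_def)

lemma ev_flip: "ev (flip s) z = ev s (snd z, fst z)"
  unfolding ev_def ps2_eval_def
  by (rule infsum_reindex_bij_witness[of _ prod.swap prod.swap]) (auto simp: mult_ac)

definition dy :: "cps \<Rightarrow> cps" where
  "dy s = Cps (\<lambda>i j. of_nat (Suc j) * coef s i (Suc j))"

definition dx :: "cps \<Rightarrow> cps" where
  "dx s = flip (dy (flip s))"

lemma ps2_abs_conv_dy:
  assumes a: "ps2_abs_conv a r" and r: "0 < r"
  shows "ps2_abs_conv (\<lambda>i j. of_nat (Suc j) * a i (Suc j)) (r / 4)"
proof (rule ps2_abs_conv_of_bounded)
  define M where "M = (\<Sum>\<^sub>\<infinity>(i, j). norm (a i j) * r ^ (i + j))"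
  fix i j
  have "real (Suc j) \<le> 2 ^ j" by (induction j) auto
  also have "\<dots> \<le> 2 ^ (i + j)" by (simp add: power_increasing)
  finally have "real (Suc j) / 2 ^ (i + j) \<le> 1" by simp
  moreover have "norm (a i (Suc j)) * r ^ (i + Suc j) \<le> M"
    unfolding M_def by (rule ps2_abs_conv_imp_bounded[OF a]) (use r in simp)
  ultimately have "real (Suc j) / 2 ^ (i + j) * (norm (a i (Suc j)) * r ^ (i + Suc j) / r) \<le>
      1 * (M / r)"
    using r by (intro mult_mono divide_right_mono) auto
  then show "norm (of_nat (Suc j) * a i (Suc j)) * (r / 2) ^ (i + j) \<le> M / r"
    using r by (simp add: norm_mult power_divide del: of_nat_Suc)
qed (use r in auto)

lemma coef_dy [simp]: "coef (dy s) i j = of_nat (Suc j) * coef s i (Suc j)"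
proof -
  obtain r where "r > 0" "ps2_abs_conv (coef s) r"
    using convergent_coef[of s] unfolding convergent_ps2_def by blast
  then have "convergent_ps2 (\<lambda>i j. of_nat (Suc j) * coef s i (Suc j))"
    unfolding convergent_ps2_def using ps2_abs_conv_dy
    by (intro exI[of _ "r / 4"]) (simp del: of_nat_Suc)
  then show ?thesis by (simp add: dy_def del: of_nat_Suc)
qed

lemma coef_dx [simp]: "coef (dx s) i j = of_nat (Suc i) * coef s (Suc i) j"
  by (simp add: dx_def)

lemma dx_add: "dx (s + t) = dx s + dx t" and dy_add: "dy (s + t) = dy s + dy t"
  by (rule cps_eqI; simp add: algebra_simps)+

lemma dx_monom2: "dx (monom2 c i j) = monom2 (of_nat i * c) (i - 1) j"
  and dy_monom2: "dy (monom2 c i j) = monom2 (of_nat j * c) i (j - 1)"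
  by (rule cps_eqI; auto simp: coef_monom2)+

lemma ev_has_field_derivative_snd:
  "\<forall>\<^sub>0z. ((\<lambda>t. ev s (fst z, t)) has_field_derivative ev (dy s) z) (at (snd z))"
proof -
  let ?a = "coef s"
  obtain r where r: "r > 0" "ps2_abs_conv ?a r"
    using convergent_coef[of s] unfolding convergent_ps2_def by blast
  have dy: "ps2_abs_conv (coef (dy s)) (r / 4)"
    using ps2_abs_conv_dy[OF r(2,1)] by (simp add: coef_dy[abs_def] del: of_nat_Suc)
  have "((\<lambda>t. ev s (x, t)) has_field_derivative ev (dy s) (x, y)) (at y)"
    if xy: "norm x < r / 4" "norm y < r / 4" for x y
  proof -
    let ?A = "\<lambda>j. \<Sum>i. ?a i j * x ^ i"
    have rows: "(\<lambda>j. ?A j * t ^ j) sums ev s (x, t)" if "norm t \<le> r" for t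
      unfolding ev_def by (rule ps2_eval_rows(2)[OF r(2) _ r(1) that]) (use xy r in auto)
    have row_dy: "diffs ?A j = (\<Sum>i. coef (dy s) i j * x ^ i)" for j
      unfolding diffs_def coef_dy
      using suminf_mult[OF ps2_eval_rows(1)[OF r(2) _ r(1)], of x "of_nat (Suc j)" "Suc j"] xy r
      by (simp add: mult.assoc)
    have "(\<lambda>j. (\<Sum>i. coef (dy s) i j * x ^ i) * y ^ j) sums ev (dy s) (x, y)"
      unfolding ev_def by (rule ps2_eval_rows(2)[OF dy]) (use xy r in auto)
    then have "(\<Sum>j. diffs ?A j * y ^ j) = ev (dy s) (x, y)" by (simp add: row_dy sums_iff)
    moreover have "((\<lambda>t. \<Sum>j. ?A j * t ^ j) has_field_derivative (\<Sum>j. diffs ?A j * y ^ j)) (at y)"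
      by (rule termdiffs_strong[of _ "of_real r"]) (use rows[of "of_real r"] r xy in
        \<open>auto simp: sums_iff\<close>)
    ultimately have "((\<lambda>t. \<Sum>j. ?A j * t ^ j) has_field_derivative ev (dy s) (x, y)) (at y)" by simp
    then show ?thesis
      by (rule has_field_derivative_transform_within_open[of _ _ _ "ball 0 r"])
         (use xy r rows in \<open>auto simp: sums_iff\<close>)
  qed
  then show ?thesis unfolding near0_iff_polydisc using r(1) by (intro exI[of _ "r / 4"]) auto
qed

lemma ev_has_field_derivative_fst:
  "\<forall>\<^sub>0z. ((\<lambda>t. ev s (t, snd z)) has_field_derivative ev (dx s) z) (at (fst z))"
  using near0_compose[OF coef_vars_0_0(2,1) ev_has_field_derivative_snd[of "flip s"]]
  by eventually_elim (simp add: ev_monom2 ev_flip dx_def)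

lemma ev_has_derivative:
  "\<forall>\<^sub>0z. (ev s has_derivative (\<lambda>h. ev (dx s) z * fst h + ev (dy s) z * snd h)) (at z)"
proof -
  have "\<forall>\<^sub>F r in at_right 0. ev (dy s) holomorphic2_on polydisc r \<and>
      (\<forall>z\<in>polydisc r. ((\<lambda>t. ev s (t, snd z)) has_field_derivative ev (dx s) z) (at (fst z)) \<and>
        ((\<lambda>t. ev s (fst z, t)) has_field_derivative ev (dy s) z) (at (snd z)))"
    by (intro eventually_conj ev_holomorphic2_on near0_imp_eventually_polydisc
        ev_has_field_derivative_fst ev_has_field_derivative_snd)
  then obtain r where r: "r > 0" "ev (dy s) holomorphic2_on polydisc r"
    and partial_x:
        "\<And>z. z \<in> polydisc r \<Longrightarrow> ((\<lambda>t. ev s (t, snd z)) has_field_derivative ev (dx s) z) (at (fst z))"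
    and partial_y:
        "\<And>z. z \<in> polydisc r \<Longrightarrow> ((\<lambda>t. ev s (fst z, t)) has_field_derivative ev (dy s) z) (at (snd z))"
    by (rule eventually_at_right_0E) blast
  define B where "B = (\<lambda>x y. Blinfun (\<lambda>k. ev (dy s) (x, y) * k))"
  have B: "blinfun_apply (B x y) = (\<lambda>k. ev (dy s) (x, y) * k)" for x y
    unfolding B_def by (simp add: bounded_linear_Blinfun_apply bounded_linear_mult_right)
  have "(ev s has_derivative (\<lambda>h. ev (dx s) (x, y) * fst h + ev (dy s) (x, y) * snd h)) (at (x, y))"
    if xy: "(x, y) \<in> polydisc r" for x y
  proof -
    have "((\<lambda>(x, y). ev s (x, y)) has_derivative (\<lambda>(tx, ty). ev (dx s) (x, y) * tx + B x y ty))
        (at (x, y) within ball 0 r \<times> ball 0 r)"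
    proof (rule has_derivative_partialsI)
      show "((\<lambda>x. ev s (x, y)) has_derivative (*) (ev (dx s) (x, y))) (at x within ball 0 r)"
        using partial_x[OF xy] by (simp add: has_field_derivative_def has_derivative_at_withinI)
      show "((\<lambda>y. ev s (x, y)) has_derivative blinfun_apply (B x y)) (at y within ball 0 r)"
        if "x \<in> ball 0 r" "y \<in> ball 0 r" for x y
        using partial_y[of "(x, y)"] that
        by (simp add: has_field_derivative_def has_derivative_at_withinI B)
      have "continuous_on (polydisc r) (\<lambda>z. case z of (x, y) \<Rightarrow> B x y)"
        using holomorphic2_on_imp_continuous_on[OF r(2)]
        by (intro continuous_on_blinfun_componentwise) (auto simp: B case_prod_unfold intro!:
          continuous_intros)
      then show "continuous (at (x, y) within ball 0 r \<times> ball 0 r) (\<lambda>(x, y). B x y)"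
        using xy by (simp add: continuous_on_eq_continuous_within polydisc_def)
    qed (use xy in auto)
    moreover have "at (x, y) within ball 0 r \<times> ball 0 r = at (x, y)"
      by (rule at_within_open) (use xy in \<open>auto intro: open_Times\<close>)
    ultimately show ?thesis by (simp add: case_prod_unfold B)
  qed
  then show ?thesis unfolding near0_iff_polydisc using r(1) by (intro exI[of _ r]) auto
qed

context
  fixes X Y :: cps
  assumes XY: "coef X 0 0 = 0" "coef Y 0 0 = 0"
begin

lemma ev_partials_subst:
  "\<forall>\<^sub>0z. ev (dx (subst s X Y)) z = ev (dx s) (ev X z, ev Y z) * ev (dx X) z +
      ev (dy s) (ev X z, ev Y z) * ev (dx Y) z \<and>
     ev (dy (subst s X Y)) z = ev (dx s) (ev X z, ev Y z) * ev (dy X) z +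
      ev (dy s) (ev X z, ev Y z) * ev (dy Y) z"
proof -
  have "\<forall>\<^sub>0z. \<forall>\<^sub>F w in nhds z. ev (subst s X Y) w = ev s (ev X w, ev Y w)"
    using ev_subst[OF XY, of s] by (simp add: eventually_eventually)
  with ev_has_derivative[of "subst s X Y"] near0_compose[OF XY ev_has_derivative[of s]]
    ev_has_derivative[of X] ev_has_derivative[of Y]
  show ?thesis
  proof eventually_elim
    case (elim z)
    have "((\<lambda>w. ev s (ev X w, ev Y w)) has_derivative (\<lambda>h.
       ev (dx s) (ev X z, ev Y z) * fst (ev (dx X) z * fst h + ev (dy X) z * snd h,
         ev (dx Y) z * fst h + ev (dy Y) z * snd h) +
       ev (dy s) (ev X z, ev Y z) * snd (ev (dx X) z * fst h + ev (dy X) z * snd h,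
         ev (dx Y) z * fst h + ev (dy Y) z * snd h))) (at z)"
      by (rule has_derivative_compose[OF has_derivative_Pair[OF elim(3,4)] elim(2)])
    then have "(ev (subst s X Y) has_derivative (\<lambda>h.
       ev (dx s) (ev X z, ev Y z) * (ev (dx X) z * fst h + ev (dy X) z * snd h) +
       ev (dy s) (ev X z, ev Y z) * (ev (dx Y) z * fst h + ev (dy Y) z * snd h))) (at z)"
      unfolding fst_conv snd_conv
      by (rule has_derivative_transform_eventually)
         (use elim(5) eventually_nhds_x_imp_x[OF elim(5)] in
             \<open>auto simp: eventually_at_filter elim: eventually_mono\<close>)
    from has_derivative_unique[OF elim(1) this] show ?case
      by (metis (no_types, lifting) add_0 add_0_right fst_conv mult.right_neutral mult_zero_right
        snd_conv)
  qed
qed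

lemma dx_subst: "dx (subst s X Y) = subst (dx s) X Y * dx X + subst (dy s) X Y * dx Y"
  by (rule ev_eqI, use ev_partials_subst[of s] ev_subst[OF XY, of "dx s"] ev_subst[OF XY, of "dy s"]
      ev_add[of "subst (dx s) X Y * dx X" "subst (dy s) X Y * dx Y"]
      ev_mult[of "subst (dx s) X Y" "dx X"] ev_mult[of "subst (dy s) X Y" "dx Y"]
      in eventually_elim) simp

lemma dy_subst: "dy (subst s X Y) = subst (dx s) X Y * dy X + subst (dy s) X Y * dy Y"
  by (rule ev_eqI, use ev_partials_subst[of s] ev_subst[OF XY, of "dx s"] ev_subst[OF XY, of "dy s"]
      ev_add[of "subst (dx s) X Y * dy X" "subst (dy s) X Y * dy Y"]
      ev_mult[of "subst (dx s) X Y" "dy X"] ev_mult[of "subst (dy s) X Y" "dy Y"]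
      in eventually_elim) simp

lemma linear_coefs_subst:
  shows "coef (subst s X Y) 1 0 = coef s 1 0 * coef X 1 0 + coef s 0 1 * coef Y 1 0"
    and "coef (subst s X Y) 0 1 = coef s 1 0 * coef X 0 1 + coef s 0 1 * coef Y 0 1"
  using arg_cong[OF dx_subst[of s], of "\<lambda>t. coef t 0 0"]
    arg_cong[OF dy_subst[of s], of "\<lambda>t. coef t 0 0"]
  by (simp_all add: coef_subst_0_0[OF XY] One_nat_def)

end

section \<open>Jacobians and local coordinates\<close>

definition cps_jacobian :: "cps \<Rightarrow> cps \<Rightarrow> cps" where
  "cps_jacobian X Y = dx X * dy Y - dy X * dx Y"

lemma coef_cps_jacobian_0_0:
  "coef (cps_jacobian X Y) 0 0 = coef X 1 0 * coef Y 0 1 - coef X 0 1 * coef Y 1 0"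
  by (simp add: cps_jacobian_def One_nat_def)

lemma cps_jacobian_subst:
  assumes "coef X 0 0 = 0" "coef Y 0 0 = 0"
  shows "cps_jacobian (subst s X Y) (subst t X Y) = subst (cps_jacobian s t) X Y * cps_jacobian X Y"
  unfolding cps_jacobian_def dx_subst[OF assms] dy_subst[OF assms] subst_diff[OF assms]
    subst_mult[OF assms]
  by (simp add: algebra_simps)

lemma subst_eq_0_imp_eq_0:
  assumes XY: "coef X 0 0 = 0" "coef Y 0 0 = 0" and jac: "cps_jacobian X Y \<noteq> 0"
    and s: "subst s X Y = 0"
  shows "s = 0"
proof -
  have partials: "subst (dx s) X Y = 0 \<and> subst (dy s) X Y = 0" if "subst s X Y = 0" for s
  proof -
    let ?u = "subst (dx s) X Y" and ?v = "subst (dy s) X Y"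
    have eqs: "?u * dx X + ?v * dx Y = 0" "?u * dy X + ?v * dy Y = 0"
      using dx_subst[OF XY, of s] dy_subst[OF XY, of s] that dx_monom2[of 0 0 0] dy_monom2[of 0 0 0]
      by simp_all
    have "?u * cps_jacobian X Y = (?u * dx X + ?v * dx Y) * dy Y - (?u * dy X + ?v * dy Y) * dx Y"
      "?v * cps_jacobian X Y = (?u * dy X + ?v * dy Y) * dx X - (?u * dx X + ?v * dx Y) * dy X"
      by (simp_all add: cps_jacobian_def algebra_simps)
    then have "?u * cps_jacobian X Y = 0" "?v * cps_jacobian X Y = 0"
      by (simp_all only: eqs mult_zero_left diff_self)
    then show ?thesis using jac by simp
  qed
  have "\<forall>s. subst s X Y = 0 \<longrightarrow> coef s 0 j = 0" for j
  proof (induction j)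
    case 0
    show ?case using coef_subst_0_0[OF XY] coef_0 by metis
  next
    case (Suc j)
    have "coef s 0 (Suc j) = 0" if "subst s X Y = 0" for s
      using Suc.IH[rule_format, of "dy s"] partials[OF that] by (simp del: of_nat_Suc)
    then show ?case by blast
  qed
  then have "\<forall>s. subst s X Y = 0 \<longrightarrow> coef s i j = 0" for i j
  proof (induction i)
    case (Suc i)
    have "coef s (Suc i) j = 0" if "subst s X Y = 0" for s
      using Suc.IH[rule_format, of "dx s"] Suc.prems partials[OF that] by (simp del: of_nat_Suc)
    then show ?case by blast
  qed blast
  then show ?thesis using s by (intro cps_eqI) simp
qed

lemma inj_subst:
  assumes "coef X 0 0 = 0" "coef Y 0 0 = 0" "cps_jacobian X Y \<noteq> 0"
  shows "inj (\<lambda>s. subst s X Y)"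
proof (rule injI)
  fix s t assume "subst s X Y = subst t X Y"
  then have "subst (s - t) X Y = 0" by (simp add: subst_diff[OF assms(1,2)])
  then show "s = t" using subst_eq_0_imp_eq_0[OF assms] by fastforce
qed

lemma cps_iso_subst_image:
  assumes "coef X 0 0 = 0" "coef Y 0 0 = 0" "cps_jacobian X Y \<noteq> 0" "cps_subalgebra A"
  shows "cps_iso A ((\<lambda>s. subst s X Y) ` A)"
  unfolding cps_iso_def
  using cps_hom_subst[OF assms(1,2,4)] inj_on_subset[OF inj_subst[OF assms(1-3)] subset_UNIV]
  by (auto intro: inj_on_imp_bij_betw)

subsection \<open>The inverse function theorem\<close>

definition matrix2 ::
    "complex \<Rightarrow> complex \<Rightarrow> complex \<Rightarrow> complex \<Rightarrow> complex \<times> complex \<Rightarrow> complex \<times> complex" where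
  "matrix2 a b c d h = (a * fst h + b * snd h, c * fst h + d * snd h)"

lemma bounded_linear_matrix2: "bounded_linear (matrix2 a b c d)"
  unfolding matrix2_def[abs_def]
  by (intro bounded_linear_Pair bounded_linear_add bounded_linear_const_mult bounded_linear_fst
    bounded_linear_snd)

lemma matrix2_scalar: "matrix2 a b c d (k * fst h, k * snd h) =
    (k * fst (matrix2 a b c d h), k * snd (matrix2 a b c d h))"
  by (simp add: matrix2_def algebra_simps)

lemma matrix2_inverse:
  assumes "D = a * d - b * c" "D \<noteq> 0"
  shows "matrix2 (d / D) (- b / D) (- c / D) (a / D) (matrix2 a b c d h) = h"
proof -
  have "d * (a * fst h + b * snd h) - b * (c * fst h + d * snd h) = D * fst h"
    "a * (c * fst h + d * snd h) - c * (a * fst h + b * snd h) = D * snd h"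
    by (simp_all add: assms(1) algebra_simps)
  then show ?thesis using assms(2)
    by (simp add: matrix2_def prod_eq_iff flip: diff_divide_distrib)
qed

lemma holomorphic2_on_of_complex_linear_derivative:
  assumes deriv: "\<And>z. z \<in> V \<Longrightarrow> (G has_derivative G' z) (at z)"
    and linear: "\<And>z k h. z \<in> V \<Longrightarrow> G' z (k * fst h, k * snd h) = k * G' z h"
  shows "G holomorphic2_on V"
proof -
  have "(\<lambda>t. G (t, y)) field_differentiable at x" "(\<lambda>t. G (x, t)) field_differentiable at y"
    if V: "(x, y) \<in> V" for x y
  proof -
    have "((\<lambda>t. G (t, y)) has_derivative (\<lambda>h. G' (x, y) (h, 0))) (at x)"
      by (rule has_derivative_compose[OF has_derivative_Pair[OF has_derivative_ident
        has_derivative_const] deriv[OF V]])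
    moreover have "((\<lambda>t. G (x, t)) has_derivative (\<lambda>h. G' (x, y) (0, h))) (at y)"
      by (rule has_derivative_compose[OF has_derivative_Pair[OF has_derivative_const
        has_derivative_ident] deriv[OF V]])
    moreover have "G' (x, y) (h, 0) = G' (x, y) (1, 0) * h"
        "G' (x, y) (0, h) = G' (x, y) (0, 1) * h" for h
      using linear[OF V, of h "(1, 0)"] linear[OF V, of h "(0, 1)"] by simp_all
    then have "(\<lambda>h. G' (x, y) (h, 0)) = (*) (G' (x, y) (1, 0))"
        "(\<lambda>h. G' (x, y) (0, h)) = (*) (G' (x, y) (0, 1))"
      by blast+
    ultimately show "(\<lambda>t. G (t, y)) field_differentiable at x"
        "(\<lambda>t. G (x, t)) field_differentiable at y"
      unfolding field_differentiable_def has_field_derivative_def by (metis, metis)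
  qed
  moreover have "continuous_on V G"
    using deriv has_derivative_continuous continuous_at_imp_continuous_on by blast
  ultimately show ?thesis
    unfolding holomorphic2_on_def holomorphic_on_def by (auto intro: field_differentiable_at_within)
qed

lemma holomorphic_inverse_function:
  fixes f :: "complex \<times> complex \<Rightarrow> complex \<times> complex"
  assumes U: "open U" "z0 \<in> U"
    and deriv: "\<And>z. z \<in> U \<Longrightarrow> (f has_derivative matrix2 (a z) (b z) (c z) (d z)) (at z)"
    and cont: "continuous_on U a" "continuous_on U b" "continuous_on U c" "continuous_on U d"
    and det: "a z0 * d z0 - b z0 * c z0 \<noteq> 0"
  obtains U' V g where "open U'" "z0 \<in> U'" "open V" "f z0 \<in> V" "\<And>z. z \<in> U' \<Longrightarrow> g (f z) = z"
    "(\<lambda>w. fst (g w)) holomorphic2_on V" "(\<lambda>w. snd (g w)) holomorphic2_on V"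
proof -
  define A where "A z = matrix2 (a z) (b z) (c z) (d z)" for z
  define D where "D = a z0 * d z0 - b z0 * c z0"
  define f' where "f' z = Blinfun (A z)" for z
  define B where "B = matrix2 (d z0 / D) (- b z0 / D) (- c z0 / D) (a z0 / D)"
  have f': "blinfun_apply (f' z) = A z" for z
    by (simp add: f'_def A_def bounded_linear_Blinfun_apply bounded_linear_matrix2)
  have "continuous_on U f'"
    by (rule continuous_on_blinfun_componentwise) (auto simp: f' A_def matrix2_def intro!:
      continuous_intros cont)
  moreover have "Blinfun B o\<^sub>L f' z0 = id_blinfun"
    using matrix2_inverse[OF D_def] det
    by (intro blinfun_eqI) (simp add: f' A_def B_def D_def bounded_linear_Blinfun_apply
      bounded_linear_matrix2)
  ultimately obtain U' V g g' where g: "open U'" "z0 \<in> U'" "open V" "f z0 \<in> V"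
      "homeomorphism U' V f g"
    and deriv_g: "\<And>w. w \<in> V \<Longrightarrow> (g has_derivative g' w) (at w)"
    and g': "\<And>w. w \<in> V \<Longrightarrow> g' w = inv_into UNIV (A (g w))" and bij: "\<And>w. w \<in> V \<Longrightarrow> bij (A (g w))"
    using inverse_function_theorem[OF U(1) _ _ U(2), of f f' "Blinfun B"] deriv unfolding f' A_def
    by metis
  have linear: "g' w (k * fst h, k * snd h) = (k * fst (g' w h), k * snd (g' w h))" if w: "w \<in> V"
    for w k h
  proof -
    obtain v where v: "h = A (g w) v" using bij[OF w] by (metis bij_pointE)
    then have "(k * fst h, k * snd h) = A (g w) (k * fst v, k * snd v)"
      by (simp add: A_def matrix2_scalar)
    then show ?thesis using bij[OF w] by (simp add: g'[OF w] v bij_is_inj)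
  qed
  have "(\<lambda>w. fst (g w)) holomorphic2_on V" "(\<lambda>w. snd (g w)) holomorphic2_on V"
    by (rule holomorphic2_on_of_complex_linear_derivative[where G' = "\<lambda>w h. fst (g' w h)"]
          holomorphic2_on_of_complex_linear_derivative[where G' = "\<lambda>w h. snd (g' w h)"];
        simp add: linear deriv_g has_derivative_fst has_derivative_snd)+
  moreover have "g (f z) = z" if "z \<in> U'" for z using g(5) that by (simp add: homeomorphism_def)
  ultimately show ?thesis using that g(1-4) by blast
qed

definition local_coords :: "cps \<Rightarrow> cps \<Rightarrow> bool" where
  "local_coords X Y \<longleftrightarrow> coef X 0 0 = 0 \<and> coef Y 0 0 = 0 \<and> coef (cps_jacobian X Y) 0 0 \<noteq> 0"

lemma local_coords_left_inverse:
  assumes "local_coords X Y"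
  obtains P Q where "coef P 0 0 = 0" "coef Q 0 0 = 0" "subst P X Y = xvar" "subst Q X Y = yvar"
proof -
  have XY: "coef X 0 0 = 0" "coef Y 0 0 = 0" using assms by (simp_all add: local_coords_def)
  let ?f = "\<lambda>z. (ev X z, ev Y z)"
  let ?D = "\<lambda>z. matrix2 (ev (dx X) z) (ev (dy X) z) (ev (dx Y) z) (ev (dy Y) z)"
  have "\<forall>\<^sub>0z. (?f has_derivative ?D z) (at z)"
    using ev_has_derivative[of X] ev_has_derivative[of Y]
    by eventually_elim (simp add: matrix2_def[abs_def] has_derivative_Pair)
  then have "\<forall>\<^sub>F r in at_right 0. (\<forall>z\<in>polydisc r. (?f has_derivative ?D z) (at z)) \<and>
      (ev (dx X) holomorphic2_on polydisc r \<and> ev (dy X) holomorphic2_on polydisc r) \<and>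
      (ev (dx Y) holomorphic2_on polydisc r \<and> ev (dy Y) holomorphic2_on polydisc r)"
    by (intro eventually_conj near0_imp_eventually_polydisc ev_holomorphic2_on)
  then obtain r where r: "0 < r" and deriv: "\<forall>z\<in>polydisc r. (?f has_derivative ?D z) (at z)"
    and hol: "ev (dx X) holomorphic2_on polydisc r" "ev (dy X) holomorphic2_on polydisc r"
      "ev (dx Y) holomorphic2_on polydisc r" "ev (dy Y) holomorphic2_on polydisc r"
    by (rule eventually_at_right_0E) (elim conjE, rule that)
  obtain U' V g where g: "open U'" "(0, 0) \<in> U'" "open V" "?f (0, 0) \<in> V" "\<And>z. z \<in> U' \<Longrightarrow> g (?f z) = z"
    "(\<lambda>w. fst (g w)) holomorphic2_on V" "(\<lambda>w. snd (g w)) holomorphic2_on V"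
  proof (rule holomorphic_inverse_function[OF open_polydisc _ _
      hol[THEN holomorphic2_on_imp_continuous_on]])
    show "(?f has_derivative ?D z) (at z)" if "z \<in> polydisc r" for z using deriv that by blast
    show "ev (dx X) (0, 0) * ev (dy Y) (0, 0) - ev (dy X) (0, 0) * ev (dx Y) (0, 0) \<noteq> 0"
      using assms by (simp add: local_coords_def cps_jacobian_def ev_0_0)
  qed (use r in auto)
  have V0: "(0, 0) \<in> V" and g0: "g (0, 0) = (0, 0)"
    using g(4) g(5)[OF g(2)] XY by (simp_all add: ev_0_0)
  obtain P where P: "\<forall>\<^sub>0z. ev P z = fst (g z)" using holomorphic2_on_imp_ev[OF g(6,3) V0] .
  obtain Q where Q: "\<forall>\<^sub>0z. ev Q z = snd (g z)" using holomorphic2_on_imp_ev[OF g(7,3) V0] .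
  have PQ: "coef P 0 0 = 0" "coef Q 0 0 = 0"
    using eventually_nhds_x_imp_x[OF P] eventually_nhds_x_imp_x[OF Q] by (simp_all add: ev_0_0 g0)
  have "subst P X Y = xvar"
    by (rule ev_eqI, use ev_subst[OF XY, of P] near0_compose[OF XY P]
      eventually_nhds_in_open[OF g(1,2)]
        in eventually_elim) (simp add: g(5) ev_monom2)
  moreover have "subst Q X Y = yvar"
    by (rule ev_eqI, use ev_subst[OF XY, of Q] near0_compose[OF XY Q]
      eventually_nhds_in_open[OF g(1,2)]
        in eventually_elim) (simp add: g(5) ev_monom2)
  ultimately show ?thesis using that PQ by blast
qed

lemma bij_subst:
  assumes "local_coords X Y"
  shows "bij (\<lambda>s. subst s X Y)"
proof (rule bijI)
  have XY: "coef X 0 0 = 0" "coef Y 0 0 = 0" and jac: "cps_jacobian X Y \<noteq> 0"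
    using assms by (auto simp: local_coords_def)
  show "inj (\<lambda>s. subst s X Y)" by (rule inj_subst[OF XY jac])
  obtain P Q where PQ: "coef P 0 0 = 0" "coef Q 0 0 = 0" "subst P X Y = xvar" "subst Q X Y = yvar"
    by (rule local_coords_left_inverse[OF assms])
  have "subst (subst s P Q) X Y = s" for s
    unfolding subst_subst[OF PQ(1,2) XY] PQ(3,4) by (rule subst_xvar_yvar)
  then show "surj (\<lambda>s. subst s X Y)" by (rule surjI)
qed

section \<open>Roots of power series\<close>

subsection \<open>Roots of holomorphic functions of one variable\<close>

lemma holomorphic_factor_at_point:
  assumes f: "f holomorphic_on S" "open S" "connected S" "a \<in> S" "\<exists>z\<in>S. f z \<noteq> 0"
  obtains k F where "F holomorphic_on S" "F a \<noteq> 0" "\<And>z. z \<in> S \<Longrightarrow> f z = (z - a) ^ k * F z"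
proof -
  obtain r where r: "r > 0" "cball a r \<subseteq> S" "zor_poly f a holomorphic_on cball a r"
    "\<And>z. z \<in> cball a r \<Longrightarrow> f z = zor_poly f a z * (z - a) ^ nat (zorder f a) \<and> zor_poly f a z \<noteq> 0"
    using zorder_exist_zero[OF f] by blast
  define k where "k = nat (zorder f a)"
  define F where "F = (\<lambda>z. if z \<in> ball a r then zor_poly f a z else f z / (z - a) ^ k)"
  have "F holomorphic_on ball a r \<union> (S - {a})"
    unfolding F_def
  proof (rule holomorphic_on_If_Un)
    show "(\<lambda>z. f z / (z - a) ^ k) holomorphic_on S - {a}"
      by (intro holomorphic_intros holomorphic_on_subset[OF f(1)]) auto
    show "zor_poly f a holomorphic_on ball a r"
      by (rule holomorphic_on_subset[OF r(3)]) auto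
  qed (use r(4) f in \<open>auto simp: k_def intro: open_delete\<close>)
  moreover have "ball a r \<union> (S - {a}) = S" using r f(4) by auto
  ultimately have "F holomorphic_on S" by simp
  moreover have "F a \<noteq> 0" using r by (simp add: F_def)
  moreover have "f z = (z - a) ^ k * F z" if "z \<in> S" for z
    using r(1) r(4)[of z] by (auto simp: F_def k_def)
  ultimately show ?thesis by (rule that)
qed

lemma zorder_eq_of_factor:
  assumes "open S" "a \<in> S" "F holomorphic_on S" "F a \<noteq> 0" "\<And>z. z \<in> S \<Longrightarrow> f z = (z - a) ^ k * F z"
  shows "zorder f a = int k"
  by (rule zorder_eqI[OF assms(1-4)]) (simp add: assms(5) mult.commute)

lemma dvd_zorder_of_power_eq:
  assumes fgh: "f holomorphic_on S" "g holomorphic_on S" "h holomorphic_on S"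
    and S: "open S" "connected S" "a \<in> S"
    and eq: "\<And>z. z \<in> S \<Longrightarrow> f z ^ i * g z = h z ^ n" and n: "coprime i n"
    and nonzero: "\<exists>z\<in>S. h z \<noteq> 0" "\<exists>z\<in>S. f z \<noteq> 0" "g a \<noteq> 0"
  shows "int n dvd zorder f a"
proof -
  obtain k F where F: "F holomorphic_on S" "F a \<noteq> 0" "\<And>z. z \<in> S \<Longrightarrow> f z = (z - a) ^ k * F z"
    by (rule holomorphic_factor_at_point[OF fgh(1) S nonzero(2)]) blast
  obtain l H where H: "H holomorphic_on S" "H a \<noteq> 0" "\<And>z. z \<in> S \<Longrightarrow> h z = (z - a) ^ l * H z"
    by (rule holomorphic_factor_at_point[OF fgh(3) S nonzero(1)]) blast
  have "zorder (\<lambda>z. h z ^ n) a = int (k * i)"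
  proof (rule zorder_eq_of_factor[OF S(1,3)])
    show "(\<lambda>z. F z ^ i * g z) holomorphic_on S" by (intro holomorphic_intros F fgh)
  qed (use F nonzero(3) in \<open>auto simp: eq[symmetric] power_mult_distrib power_mult mult.assoc\<close>)
  moreover have "zorder (\<lambda>z. h z ^ n) a = int (l * n)"
  proof (rule zorder_eq_of_factor[OF S(1,3)])
    show "(\<lambda>z. H z ^ n) holomorphic_on S" by (intro holomorphic_intros H)
  qed (use H in \<open>auto simp: power_mult_distrib power_mult\<close>)
  ultimately have "k * i = l * n" using of_nat_eq_iff by metis
  then have "n dvd k * i" by simp
  then have "n dvd k" using n by (simp add: coprime_commute coprime_dvd_mult_left_iff)
  then show ?thesis using zorder_eq_of_factor[OF S(1,3) F] by simp
qed

lemma holomorphic_nth_root_nonvanishing: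
  assumes "convex S" "open S" "f holomorphic_on S" "0 < n" "\<And>z. z \<in> S \<Longrightarrow> f z \<noteq> 0"
  shows "\<exists>p. p holomorphic_on S \<and> (\<forall>z\<in>S. f z = p z ^ n)"
proof (cases "S = {}")
  case True
  then show ?thesis using assms(3) by blast
next
  case False
  then obtain L where L: "L holomorphic_on S" "\<And>z. z \<in> S \<Longrightarrow> exp (L z) = f z"
    using holomorphic_logarithm_exists[OF assms(1-3,5)] by blast
  have "(\<lambda>z. exp (L z / of_nat n)) holomorphic_on S"
    using assms(4) by (intro holomorphic_intros L) auto
  moreover have "f z = exp (L z / of_nat n) ^ n" if "z \<in> S" for z
    using L(2)[OF that] assms(4) by (simp flip: exp_of_nat_mult)
  ultimately show ?thesis by blast
qed

lemma zorder_cofactor: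
  assumes S: "open S" "connected S" and F: "F holomorphic_on S" "F a \<noteq> 0" "a \<in> S"
    and f: "\<And>z. z \<in> S \<Longrightarrow> f z = (z - a) ^ k * F z" and b: "b \<in> S" "b \<noteq> a"
  shows "zorder F b = zorder f b"
proof -
  obtain l G where G: "G holomorphic_on S" "G b \<noteq> 0" "\<And>z. z \<in> S \<Longrightarrow> F z = (z - b) ^ l * G z"
    using holomorphic_factor_at_point[OF F(1) S b(1)] F(2,3) by metis
  have "zorder f b = int l"
  proof (rule zorder_eq_of_factor[OF S(1) b(1)])
    show "(\<lambda>z. (z - a) ^ k * G z) holomorphic_on S" by (intro holomorphic_intros G)
  qed (use G f b(2) in auto)
  then show ?thesis using zorder_eq_of_factor[OF S(1) b(1) G] by simp
qed

lemma holomorphic_nth_root_exists: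
  assumes S: "convex S" "open S" and "f holomorphic_on S" "0 < n" "finite {z \<in> S. f z = 0}"
    and "\<And>a. a \<in> S \<Longrightarrow> f a = 0 \<Longrightarrow> int n dvd zorder f a"
  shows "\<exists>p. p holomorphic_on S \<and> (\<forall>z\<in>S. f z = p z ^ n)"
  using assms(3,5,6)
proof (induction "card {z \<in> S. f z = 0}" arbitrary: f rule: less_induct)
  case less
  note f = \<open>f holomorphic_on S\<close> and finite_zeros = \<open>finite {z \<in> S. f z = 0}\<close>
  note connected = convex_connected[OF S(1)]
  show ?case
  proof (cases "\<exists>a\<in>S. f a = 0")
    case False
    then show ?thesis using holomorphic_nth_root_nonvanishing[OF S f assms(4)] by blast
  next
    case True
    then obtain a where a: "a \<in> S" "f a = 0" by blast
    have "\<exists>z\<in>S. f z \<noteq> 0"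
    proof (rule ccontr)
      assume "\<not> ?thesis"
      then have "{z \<in> S. f z = 0} = S" by auto
      then show False using finite_zeros finite_imp_not_open[of S] S(2) a(1) by auto
    qed
    then obtain k F where F: "F holomorphic_on S" "F a \<noteq> 0" "\<And>z. z \<in> S \<Longrightarrow> f z = (z - a) ^ k * F z"
      using holomorphic_factor_at_point[OF f S(2) connected a(1)] by metis
    have zeros: "{z \<in> S. F z = 0} = {z \<in> S. f z = 0} - {a}" using F(2,3) by auto
    have "int n dvd zorder F b" if b: "b \<in> S" "F b = 0" for b
    proof -
      have "b \<noteq> a" using b(2) F(2) by auto
      then have "zorder F b = zorder f b"
        using zorder_cofactor[OF S(2) connected F(1,2) a(1) _ b(1)] F(3) by blast
      then show ?thesis using less.prems(3)[OF b(1)] F(3)[OF b(1)] b(2) by simp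
    qed
    moreover have "card {z \<in> S. F z = 0} < card {z \<in> S. f z = 0}"
      unfolding zeros by (rule card_Diff1_less[OF finite_zeros]) (use a in simp)
    moreover have "finite {z \<in> S. F z = 0}" unfolding zeros using finite_zeros by simp
    ultimately obtain p where p: "p holomorphic_on S" "\<And>z. z \<in> S \<Longrightarrow> F z = p z ^ n"
      using less.hyps F(1) by blast
    have "n dvd k" using less.prems(3)[OF a] zorder_eq_of_factor[OF S(2) a(1) F] by simp
    then obtain l where l: "k = n * l" by (rule dvdE)
    have "(\<lambda>z. (z - a) ^ l * p z) holomorphic_on S" by (intro holomorphic_intros p)
    moreover have "f z = ((z - a) ^ l * p z) ^ n" if "z \<in> S" for z
      using F(3)[OF that] p(2)[OF that]
      by (simp add: l mult.commute[of n] power_mult power_mult_distrib)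
    ultimately show ?thesis by blast
  qed
qed

lemma nth_roots_proportional:
  fixes f g :: "complex \<Rightarrow> complex"
  assumes S: "connected S" "continuous_on S f" "continuous_on S g"
    and "\<And>w. w \<in> S \<Longrightarrow> g w \<noteq> 0" "\<And>w. w \<in> S \<Longrightarrow> f w ^ n = g w ^ n" "0 < n"
  obtains c where "c ^ n = 1" "\<And>w. w \<in> S \<Longrightarrow> f w = c * g w"
proof (cases "S = {}")
  case False
  have roots: "(\<lambda>w. f w / g w) ` S \<subseteq> {c. c ^ n = 1}"
    using assms(4,5) by (auto simp: power_divide)
  have "(\<lambda>w. f w / g w) constant_on S"
  proof (rule continuous_finite_range_constant[OF S(1)])
    show "continuous_on S (\<lambda>w. f w / g w)" by (intro continuous_intros S ballI assms(4))
    show "finite ((\<lambda>w. f w / g w) ` S)"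
      by (rule finite_subset[OF roots finite_roots_unity]) (use assms(6) in simp)
  qed
  then obtain c where c: "\<And>w. w \<in> S \<Longrightarrow> f w / g w = c" unfolding constant_on_def by blast
  then show ?thesis
    using that[of c] False roots assms(4) by (force simp: field_simps)
qed (use that[of 1] in simp)

subsection \<open>Gluing the roots on the fibres\<close>

lemma fibrewise_nth_root:
  assumes FGH: "F holomorphic2_on polydisc R" "G holomorphic2_on polydisc R"
      "H holomorphic2_on polydisc R"
    and eq: "\<And>z. z \<in> polydisc R \<Longrightarrow> F z ^ i * G z = H z ^ n" and n: "coprime i n" "0 < n"
    and x: "norm x < R" and common: "\<And>y. norm y < R \<Longrightarrow> F (x, y) = 0 \<Longrightarrow> G (x, y) \<noteq> 0"
    and nonzero: "norm y0 < R" "F (x, y0) \<noteq> 0" and \<sigma>: "\<sigma> < R"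
  obtains p where "p holomorphic_on ball 0 \<sigma>" "\<And>y. norm y < \<sigma> \<Longrightarrow> F (x, y) = p y ^ n"
proof -
  let ?B = "ball (0 :: complex) R"
  have slice: "(\<lambda>y. K (x, y)) holomorphic_on ?B" if "K holomorphic2_on polydisc R" for K
    using x by (auto intro!: holomorphic2_on_imp_holomorphic_on[OF that])
  have "finite {y \<in> ball 0 \<sigma>. F (x, y) = 0}"
  proof (cases "(\<lambda>y. F (x, y)) constant_on ?B")
    case True
    then have "F (x, y) \<noteq> 0" if "y \<in> ?B" for y
      using nonzero that unfolding constant_on_def by (metis mem_ball_0)
    then have "{y \<in> ball 0 \<sigma>. F (x, y) = 0} = {}" using \<sigma> by auto
    then show ?thesis by (simp only: finite.emptyI)
  next
    case False
    have "finite {y \<in> cball 0 \<sigma>. F (x, y) = 0}"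
      by (rule holomorphic_compact_finite_zeros[OF slice[OF FGH(1)] _ _ _ _ False]) (use \<sigma> in auto)
    then show ?thesis by (rule rev_finite_subset) auto
  qed
  moreover have "int n dvd zorder (\<lambda>y. F (x, y)) a" if a: "a \<in> ball 0 \<sigma>" "F (x, a) = 0" for a
  proof (rule dvd_zorder_of_power_eq[where S = ?B and g = "\<lambda>y. G (x, y)" and h = "\<lambda>y. H (x, y)"])
    show "G (x, a) \<noteq> 0" using common a \<sigma> by auto
    have "\<forall>\<^sub>F y in at a. F (x, y) \<noteq> 0 \<and> y \<in> ?B"
      by (rule non_zero_neighbour_alt[OF slice[OF FGH(1)], of _ y0]) (use a nonzero \<sigma> in auto)
    moreover have "\<forall>\<^sub>F y in at a. G (x, y) \<noteq> 0 \<and> y \<in> ?B"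
      by (rule non_zero_neighbour_alt[OF slice[OF FGH(2)], of _ a]) (use a \<sigma> \<open>G (x, a) \<noteq> 0\<close> in auto)
    ultimately have "\<forall>\<^sub>F y in at a. y \<in> ?B \<and> H (x, y) \<noteq> 0"
    proof eventually_elim
      case (elim y)
      then show ?case using eq[of "(x, y)"] x n(2) by (auto simp: zero_power)
    qed
    from eventually_happens'[OF _ this] show "\<exists>y\<in>?B. H (x, y) \<noteq> 0" by auto
  qed (use a x \<sigma> nonzero n eq in \<open>auto intro: slice FGH\<close>)
  moreover have "(\<lambda>y. F (x, y)) holomorphic_on ball 0 \<sigma>"
    by (rule holomorphic_on_subset[OF slice[OF FGH(1)]]) (use \<sigma> in auto)
  ultimately obtain p where "p holomorphic_on ball 0 \<sigma>" "\<forall>y\<in>ball 0 \<sigma>. F (x, y) = p y ^ n"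
    using holomorphic_nth_root_exists[of "ball 0 \<sigma>" "\<lambda>y. F (x, y)" n] n(2) by blast
  then show ?thesis using that by simp
qed

lemma slices_uniformly_close:
  fixes F :: "complex \<times> complex \<Rightarrow> complex"
  assumes F: "continuous_on (cball 0 r \<times> sphere 0 \<rho>) F" and "0 < r" "0 < \<rho>"
    and nonzero: "\<And>w. w \<in> sphere 0 \<rho> \<Longrightarrow> F (0, w) \<noteq> 0"
  obtains \<delta> where "0 < \<delta>" "\<delta> \<le> r" "\<And>x x' w. norm x \<le> \<delta> \<Longrightarrow> norm x' \<le> \<delta> \<Longrightarrow> w \<in> sphere 0 \<rho> \<Longrightarrow>
      norm (F (x, w) - F (x', w)) < norm (F (x', w))"
proof -
  have "continuous_on (sphere 0 \<rho>) (\<lambda>w. norm (F (0, w)))"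
    by (intro continuous_on_norm continuous_on_compose2[OF F] continuous_intros)
      (use assms(2) in auto)
  moreover have "sphere (0 :: complex) \<rho> \<noteq> {}" using \<open>0 < \<rho>\<close> by simp
  ultimately obtain w0 where w0: "w0 \<in> sphere 0 \<rho>"
      "\<And>w. w \<in> sphere 0 \<rho> \<Longrightarrow> norm (F (0, w0)) \<le> norm (F (0, w))"
    using continuous_attains_inf[OF compact_sphere] by metis
  define \<mu> where "\<mu> = norm (F (0, w0))"
  have \<mu>: "\<mu> / 3 > 0" using nonzero[OF w0(1)] by (simp add: \<mu>_def)
  have "compact (cball (0 :: complex) r \<times> sphere (0 :: complex) \<rho>)" by (intro compact_Times) auto
  then obtain d where d: "d > 0" "\<And>z z'. z \<in> cball 0 r \<times> sphere 0 \<rho> \<Longrightarrow> z' \<in> cball 0 r \<times> sphere 0 \<rho> \<Longrightarrow>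
      dist z' z < d \<Longrightarrow> dist (F z') (F z) < \<mu> / 3"
    using compact_uniformly_continuous[OF F] \<mu> unfolding uniformly_continuous_on_def by metis
  define \<delta> where "\<delta> = min (d / 2) r"
  have \<delta>: "0 < \<delta>" "\<delta> < d" "\<delta> \<le> r" using d(1) \<open>0 < r\<close> by (auto simp: \<delta>_def)
  have close: "norm (F (x, w) - F (0, w)) < \<mu> / 3" if "norm x \<le> \<delta>" "w \<in> sphere 0 \<rho>" for x w
    using d(2)[of "(0, w)" "(x, w)"] that \<delta> \<open>0 < r\<close> by (auto simp: dist_norm)
  have "norm (F (x, w) - F (x', w)) < norm (F (x', w))"
    if "norm x \<le> \<delta>" "norm x' \<le> \<delta>" "w \<in> sphere 0 \<rho>" for x x' w
    using close[OF that(1,3)] close[OF that(2,3)] w0(2)[OF that(3)]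
      norm_triangle_ineq4[of "F (x, w) - F (0, w)" "F (x', w) - F (0, w)"]
      norm_triangle_ineq2[of "F (0, w)" "F (0, w) - F (x', w)"]
    by (simp add: \<mu>_def norm_minus_commute)
  then show ?thesis using that \<delta> by blast
qed

lemma nth_root_continuation_on_circle:
  fixes F :: "complex \<times> complex \<Rightarrow> complex"
  assumes F: "continuous_on (cball 0 \<delta> \<times> sphere 0 \<rho>) F"
    and hol: "\<And>w. w \<in> sphere 0 \<rho> \<Longrightarrow> (\<lambda>x. F (x, w)) holomorphic_on ball 0 \<delta>"
    and close: "\<And>x w. norm x \<le> \<delta> \<Longrightarrow> w \<in> sphere 0 \<rho> \<Longrightarrow> norm (F (x, w) - F (x1, w)) < norm (F (x1, w))"
    and x1: "norm x1 \<le> \<delta>" and p: "continuous_on (sphere 0 \<rho>) p"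
        "\<And>w. w \<in> sphere 0 \<rho> \<Longrightarrow> F (x1, w) = p w ^ n"
    and n: "0 < n"
  obtains k where "continuous_on (cball 0 \<delta> \<times> sphere 0 \<rho>) k"
    "\<And>w. w \<in> sphere 0 \<rho> \<Longrightarrow> (\<lambda>x. k (x, w)) holomorphic_on ball 0 \<delta>"
    "\<And>x w. norm x \<le> \<delta> \<Longrightarrow> w \<in> sphere 0 \<rho> \<Longrightarrow> k (x, w) ^ n = F (x, w)"
proof -
  define k where "k = (\<lambda>z. p (snd z) * exp (Ln (F z / F (x1, snd z)) / of_nat n))"
  have x1_nonzero: "F (x1, w) \<noteq> 0" if "w \<in> sphere 0 \<rho>" for w
    using close[OF x1 that] by auto
  have ratio: "F (x, w) / F (x1, w) \<notin> \<real>\<^sub>\<le>\<^sub>0" if "norm x \<le> \<delta>" "w \<in> sphere 0 \<rho>" for x w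
  proof -
    have "norm (F (x, w) - F (x1, w)) / norm (F (x1, w)) < 1"
      using close[OF that] x1_nonzero[OF that(2)] by simp
    also have "norm (F (x, w) - F (x1, w)) / norm (F (x1, w)) = norm (F (x, w) / F (x1, w) - 1)"
      using x1_nonzero[OF that(2)] by (simp add: norm_divide[symmetric] diff_divide_distrib)
    finally have "Re (F (x, w) / F (x1, w)) > 0"
      using abs_Re_le_cmod[of "F (x, w) / F (x1, w) - 1"] by (auto simp: abs_le_iff)
    then show ?thesis by (auto simp: complex_nonpos_Reals_iff)
  qed
  show ?thesis
  proof (rule that)
    show "continuous_on (cball 0 \<delta> \<times> sphere 0 \<rho>) k"
      unfolding k_def
    proof (intro continuous_intros F)
      show "continuous_on (cball 0 \<delta> \<times> sphere 0 \<rho>) (\<lambda>z. p (snd z))"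
        by (intro continuous_on_compose2[OF p(1)] continuous_intros) auto
      show "continuous_on (cball 0 \<delta> \<times> sphere 0 \<rho>) (\<lambda>z. F (x1, snd z))"
        by (intro continuous_on_compose2[OF F] continuous_intros) (use x1 in auto)
    qed (use ratio x1_nonzero n in \<open>auto simp: case_prod_unfold\<close>)
    show "(\<lambda>x. k (x, w)) holomorphic_on ball 0 \<delta>" if "w \<in> sphere 0 \<rho>" for w
      unfolding k_def snd_conv
      by (intro holomorphic_intros hol that) (use ratio[OF _ that] x1_nonzero[OF that] n in auto)
    show "k (x, w) ^ n = F (x, w)" if "norm x \<le> \<delta>" "w \<in> sphere 0 \<rho>" for x w
    proof -
      have "k (x, w) ^ n = p w ^ n * exp (Ln (F (x, w) / F (x1, w)))"
        using n by (simp add: k_def power_mult_distrib flip: exp_of_nat_mult)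
      also have "F (x, w) / F (x1, w) \<noteq> 0" using ratio[OF that] by auto
      then have "p w ^ n * exp (Ln (F (x, w) / F (x1, w))) = F (x, w)"
        using p(2)[OF that(2)] x1_nonzero[OF that(2)] by simp
      finally show ?thesis .
    qed
  qed
qed

lemma torus_eval_power_of_proportional_root:
  assumes radii: "0 < \<delta>" "\<delta> \<le> \<rho>" and n: "0 < n" and x: "norm x < \<delta>" and y: "norm y < \<delta>"
    and k: "continuous_on (cball 0 \<delta> \<times> sphere 0 \<rho>) k"
    and holk: "\<And>w. w \<in> sphere 0 \<rho> \<Longrightarrow> (\<lambda>x. k (x, w)) holomorphic_on ball 0 \<delta>"
    and p: "p holomorphic_on cball 0 \<rho>"
    and powers: "\<And>w. w \<in> sphere 0 \<rho> \<Longrightarrow> p w \<noteq> 0" "\<And>w. w \<in> sphere 0 \<rho> \<Longrightarrow> k (x, w) ^ n = p w ^ n"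
  shows "ps2_eval (torus_coeff \<delta> \<rho> k) (x, y) ^ n = p y ^ n"
proof -
  have "0 < \<rho>" using radii by simp
  have p': "continuous_on (cball 0 \<rho>) p" "p holomorphic_on ball 0 \<rho>"
    using p by (auto intro: holomorphic_on_imp_continuous_on holomorphic_on_subset)
  obtain c where c: "c ^ n = 1" "\<And>w. w \<in> sphere 0 \<rho> \<Longrightarrow> k (x, w) = c * p w"
  proof (rule nth_roots_proportional)
    show "continuous_on (sphere 0 \<rho>) (\<lambda>w. k (x, w))"
      by (intro continuous_on_compose2[OF k] continuous_intros) (use x in auto)
    show "continuous_on (sphere 0 \<rho>) p" by (rule continuous_on_subset[OF p'(1)]) auto
  qed (use powers n connected_sphere[of "0 :: complex" \<rho>] in auto)
  have "ps2_eval (torus_coeff \<delta> \<rho> k) (x, y) = c * p y"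
    by (rule torus_coeff_eval[OF radii(1) \<open>0 < \<rho>\<close> k holk])
       (use x y radii c(2) in \<open>auto intro!: continuous_intros holomorphic_intros p'\<close>)
  then show ?thesis using c(1) by (simp add: power_mult_distrib)
qed

text \<open>The root is recovered by a Cauchy integral from its values on a torus that avoids the zeros of \<open>F\<close>;
  on the fibres over \<open>x \<noteq> 0\<close> these values agree with those of a holomorphic root, up to a constant.\<close>

lemma glue_fibrewise_nth_roots:
  assumes F: "F holomorphic2_on polydisc R" and radii: "0 < \<rho>" "\<rho> < R" and n: "0 < n"
    and boundary: "\<And>w. w \<in> sphere 0 \<rho> \<Longrightarrow> F (0, w) \<noteq> 0"
    and roots: "\<And>x. x \<noteq> 0 \<Longrightarrow> norm x < R \<Longrightarrow> F (x, of_real \<rho>) \<noteq> 0 \<Longrightarrow>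
      \<exists>p. p holomorphic_on cball 0 \<rho> \<and> (\<forall>y\<in>cball 0 \<rho>. F (x, y) = p y ^ n)"
  obtains a where "convergent_ps2 a" "\<forall>\<^sub>0z. fst z \<noteq> 0 \<longrightarrow> F z = ps2_eval a z ^ n"
proof -
  have contF: "continuous_on (cball 0 r \<times> sphere 0 \<rho>) F" if "r < R" for r
    by (rule continuous_on_subset[OF holomorphic2_on_imp_continuous_on[OF F]])
       (use that radii in \<open>auto simp: polydisc_def\<close>)
  obtain \<delta> where \<delta>: "0 < \<delta>" "\<delta> \<le> \<rho>" and close: "\<And>x x' w. norm x \<le> \<delta> \<Longrightarrow> norm x' \<le> \<delta> \<Longrightarrow> w \<in> sphere 0 \<rho> \<Longrightarrow>
      norm (F (x, w) - F (x', w)) < norm (F (x', w))"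
    by (rule slices_uniformly_close[OF contF[OF radii(2)] radii(1,1) boundary], assumption, rule that)
  have nonzero: "F (x, w) \<noteq> 0" if "norm x \<le> \<delta>" "w \<in> sphere 0 \<rho>" for x w
    using close[OF that(1,1,2)] by auto
  have root: "\<exists>p. p holomorphic_on cball 0 \<rho> \<and> (\<forall>y\<in>cball 0 \<rho>. F (x, y) = p y ^ n)"
    if "x \<noteq> 0" "norm x \<le> \<delta>" for x
    using roots[of x] nonzero[of x "of_real \<rho>"] that \<delta> radii by simp
  have x1: "complex_of_real \<delta> \<noteq> 0" "norm (complex_of_real \<delta>) \<le> \<delta>" using \<delta> by simp_all
  obtain p1 where p1: "p1 holomorphic_on cball 0 \<rho>" "\<forall>y\<in>cball 0 \<rho>. F (of_real \<delta>, y) = p1 y ^ n"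
    using root[OF x1] by blast
  obtain k where contk: "continuous_on (cball 0 \<delta> \<times> sphere 0 \<rho>) k"
    and holk: "\<And>w. w \<in> sphere 0 \<rho> \<Longrightarrow> (\<lambda>x. k (x, w)) holomorphic_on ball 0 \<delta>"
    and powk: "\<And>x w. norm x \<le> \<delta> \<Longrightarrow> w \<in> sphere 0 \<rho> \<Longrightarrow> k (x, w) ^ n = F (x, w)"
  proof (rule nth_root_continuation_on_circle)
    show "(\<lambda>x. F (x, w)) holomorphic_on ball 0 \<delta>" if "w \<in> sphere 0 \<rho>" for w
      using that \<delta> radii by (auto intro!: holomorphic2_on_imp_holomorphic_on[OF F])
    show "continuous_on (sphere 0 \<rho>) p1"
      by (rule continuous_on_subset[OF holomorphic_on_imp_continuous_on[OF p1(1)]]) auto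
    show "norm (F (x, w) - F (of_real \<delta>, w)) < norm (F (of_real \<delta>, w))"
      if "norm x \<le> \<delta>" "w \<in> sphere 0 \<rho>" for x w
      by (rule close[OF that(1) x1(2) that(2)])
    show "continuous_on (cball 0 \<delta> \<times> sphere 0 \<rho>) F" using contF \<delta> radii by simp
  qed (use x1(2) p1(2) n in auto)
  have "F (x, y) = ps2_eval (torus_coeff \<delta> \<rho> k) (x, y) ^ n"
    if x: "x \<noteq> 0" "norm x < \<delta>" and y: "norm y < \<delta>" for x y
  proof -
    obtain p where p: "p holomorphic_on cball 0 \<rho>" "\<forall>y\<in>cball 0 \<rho>. F (x, y) = p y ^ n"
      using root[of x] x by auto
    have "p w \<noteq> 0" "k (x, w) ^ n = p w ^ n" if "w \<in> sphere 0 \<rho>" for w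
      using p(2) nonzero[of x w] powk[of x w] x that n by (auto simp: zero_power)
    then show ?thesis
      using torus_eval_power_of_proportional_root[OF \<delta> n x(2) y contk holk p(1)] p(2) y \<delta>(2) by simp
  qed
  then have "\<forall>\<^sub>0z. fst z \<noteq> 0 \<longrightarrow> F z = ps2_eval (torus_coeff \<delta> \<rho> k) z ^ n"
    unfolding near0_iff_polydisc using \<delta>(1) by (intro exI[of _ \<delta>]) auto
  then show ?thesis using that convergent_torus_coeff[OF \<delta>(1) radii(1) contk] by blast
qed

subsection \<open>Roots in the ring of power series\<close>

definition isolated_common_zero :: "cps \<Rightarrow> cps \<Rightarrow> bool" where
  "isolated_common_zero s t \<longleftrightarrow> (\<forall>\<^sub>0z. ev s z = 0 \<longrightarrow> ev t z = 0 \<longrightarrow> z = (0, 0))"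

lemma x_regular_imp_nonzero_on_axis:
  assumes "x_regular s"
  shows "\<forall>\<^sub>F r in at_right 0. \<forall>w. w \<noteq> 0 \<longrightarrow> norm w < r \<longrightarrow> ev s (0, w) \<noteq> 0"
proof -
  have "\<forall>\<^sub>F r in at_right 0. ev s holomorphic2_on polydisc r \<and> ps2_abs_conv (coef s) r"
    by (intro eventually_conj ev_holomorphic2_on convergent_ps2_eventually_abs_conv) simp
  then obtain r where r: "0 < r" "ev s holomorphic2_on polydisc r" "ps2_abs_conv (coef s) r"
    by (rule eventually_at_right_0E) auto
  have hol: "(\<lambda>w. ev s (0, w)) holomorphic_on ball 0 r"
    using r(1) by (auto intro!: holomorphic2_on_imp_holomorphic_on[OF r(2)])
  have "\<exists>w\<in>ball 0 r. ev s (0, w) \<noteq> 0"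
  proof (rule ccontr)
    assume vanishes: "\<not> ?thesis"
    have "coef s 0 j = 0" for j
    proof (rule sums_zero_imp_coeffs_zero[OF r(1)])
      fix w :: complex assume "norm w < r"
      then show "(\<lambda>j. coef s 0 j * w ^ j) sums 0"
        using ps2_eval_rows(2)[OF r(3) _ r(1), of 0 w] vanishes r(1) by (simp add: ev_def)
    qed
    then show False using assms by (simp add: x_regular_def)
  qed
  then have "\<forall>\<^sub>F w in at 0. ev s (0, w) \<noteq> 0 \<and> w \<in> ball 0 r"
    using non_zero_neighbour_alt[OF hol open_ball connected_ball] r(1) by auto
  then obtain d where "0 < d" "\<And>w. w \<noteq> 0 \<Longrightarrow> norm w < d \<Longrightarrow> ev s (0, w) \<noteq> 0"
    unfolding eventually_at by (auto simp: dist_norm)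
  then show ?thesis by (intro eventually_at_right_0I[of d]) auto
qed

lemma x_regular_nth_root:
  assumes eq: "s ^ i * t = u ^ n" and n: "coprime i n" "0 < n" and reg: "x_regular s"
    and common: "isolated_common_zero s t"
  obtains v where "s = v ^ n"
proof -
  have eq_ev: "\<forall>\<^sub>0z. ev s z ^ i * ev t z = ev u z ^ n"
    using ev_power[of s i] ev_power[of u n] ev_mult[of "s ^ i" t] by eventually_elim (simp add: eq)
  have "\<forall>\<^sub>F R in at_right 0.
      (ev s holomorphic2_on polydisc R \<and> ev t holomorphic2_on polydisc R \<and>
        ev u holomorphic2_on polydisc R) \<and>
      (\<forall>z\<in>polydisc R. ev s z ^ i * ev t z = ev u z ^ n) \<and>
      (\<forall>z\<in>polydisc R. ev s z = 0 \<longrightarrow> ev t z = 0 \<longrightarrow> z = (0, 0)) \<and>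
      (\<forall>w. w \<noteq> 0 \<longrightarrow> norm w < R \<longrightarrow> ev s (0, w) \<noteq> 0)"
    using common unfolding isolated_common_zero_def
    by (intro eventually_conj ev_holomorphic2_on near0_imp_eventually_polydisc eq_ev
        x_regular_imp_nonzero_on_axis[OF reg])
  then obtain R where R: "0 < R"
    and hol: "ev s holomorphic2_on polydisc R" "ev t holomorphic2_on polydisc R"
        "ev u holomorphic2_on polydisc R"
    and eqR: "\<forall>z\<in>polydisc R. ev s z ^ i * ev t z = ev u z ^ n"
    and commonR: "\<forall>z\<in>polydisc R. ev s z = 0 \<longrightarrow> ev t z = 0 \<longrightarrow> z = (0, 0)"
    and axis: "\<forall>w. w \<noteq> 0 \<longrightarrow> norm w < R \<longrightarrow> ev s (0, w) \<noteq> 0"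
    by (rule eventually_at_right_0E) (elim conjE, rule that)
  obtain a where a: "convergent_ps2 a" "\<forall>\<^sub>0z. fst z \<noteq> 0 \<longrightarrow> ev s z = ps2_eval a z ^ n"
  proof (rule glue_fibrewise_nth_roots[OF hol(1), of "R / 2" n])
    fix x assume x: "x \<noteq> 0" "norm x < R" "ev s (x, of_real (R / 2)) \<noteq> 0"
    obtain p where p: "p holomorphic_on ball 0 (3 / 4 * R)"
        "\<And>y. norm y < 3 / 4 * R \<Longrightarrow> ev s (x, y) = p y ^ n"
      by (rule fibrewise_nth_root[OF hol _ n x(2) _ _ x(3), where \<sigma> = "3 / 4 * R"])
         (use eqR commonR x(1,2) R in auto)
    have "p holomorphic_on cball 0 (R / 2)" by (rule holomorphic_on_subset[OF p(1)]) (use R in auto)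
    then show "\<exists>p. p holomorphic_on cball 0 (R / 2) \<and> (\<forall>y\<in>cball 0 (R / 2). ev s (x, y) = p y ^ n)"
      using p(2) R by auto
  qed (use R n axis in auto)
  define v where "v = Cps a"
  have off_axis: "\<forall>\<^sub>0z. fst z \<noteq> 0 \<longrightarrow> ev s z = ev v z ^ n"
    using a(2) by (simp add: ev_def v_def a(1))
  have "xvar * (s - v ^ n) = 0"
    by (rule ev_eqI, use off_axis ev_mult[of xvar "s - v ^ n"] ev_diff[of s "v ^ n"]
      ev_power[of v n] in eventually_elim)
       (auto simp: ev_monom2)
  moreover have "xvar \<noteq> 0" using coef_monom2[of 1 1 0 1 0] by auto
  ultimately show ?thesis using that[of v] by simp
qed

lemma isolated_common_zero_imp_x_regular:
  assumes "isolated_common_zero (monom2 1 (Suc k) 0 * s) t"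
  shows "x_regular t"
proof (rule ccontr)
  assume "\<not> x_regular t"
  then have "1 \<le> i \<and> 0 \<le> j" if "coef t i j \<noteq> 0" for i j
    using that by (cases i) (auto simp: x_regular_def One_nat_def)
  then obtain t' where t': "t = monom2 1 1 0 * t'" using cps_divide_monom2[of t 1 0] by metis
  have "\<forall>\<^sub>0z. fst z = 0 \<longrightarrow> z = (0, 0)"
    using assms ev_mult[of "monom2 1 (Suc k) 0" s] ev_mult[of "monom2 1 1 0" t']
    unfolding isolated_common_zero_def by eventually_elim (auto simp: t' ev_monom2)
  then obtain r where "r > 0" "\<forall>z\<in>polydisc r. fst z = 0 \<longrightarrow> z = (0, 0)"
    unfolding near0_iff_polydisc by blast
  then show False by (auto dest!: bspec[of _ _ "(0, of_real (r / 2))"])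
qed

theorem cps_nth_root:
  assumes eq: "s ^ i * t = u ^ n" and n: "coprime i n" "0 < n" and common: "isolated_common_zero s t"
  obtains v where "s = v ^ n"
proof (cases "s = 0")
  case True
  then show ?thesis using that[of 0] n by (simp add: zero_power)
next
  case False
  then obtain a s' where s': "s = monom2 1 a 0 * s'" "x_regular s'" using x_regular_factor by blast
  show ?thesis
  proof (cases a)
    case 0
    then show ?thesis using x_regular_nth_root[OF eq n _ common] s' that by auto
  next
    case (Suc k)
    have t: "x_regular t" using isolated_common_zero_imp_x_regular common s'(1) Suc by metis
    have reg: "x_regular (s' ^ i * t)" by (intro x_regular_mult x_regular_power s'(2) t)
    have u: "u ^ n = monom2 1 (a * i) 0 * (s' ^ i * t)"
      by (simp add: s'(1) power_mult_distrib monom2_power mult.assoc flip: eq)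
    then have "u \<noteq> 0" using monom2_times_x_regular_nonzero[OF reg] n(2) by (auto simp: zero_power)
    then obtain l u' where u': "u = monom2 1 l 0 * u'" "x_regular u'" using x_regular_factor by blast
    have "monom2 1 (a * i) 0 * (s' ^ i * t) = monom2 1 (l * n) 0 * u' ^ n"
      using u by (simp add: u'(1) power_mult_distrib monom2_power)
    from x_order_unique[OF this reg x_regular_power[OF u'(2)]]
    have order: "a * i = l * n" and eq': "s' ^ i * t = u' ^ n" by auto
    have "isolated_common_zero s' t"
      using common ev_mult[of "monom2 1 a 0" s'] unfolding isolated_common_zero_def
      by eventually_elim (simp add: s'(1))
    then obtain v where v: "s' = v ^ n" using x_regular_nth_root[OF eq' n s'(2)] by blast
    have "n dvd a * i" using order by simp
    then have "n dvd a" using n(1) by (simp add: coprime_commute coprime_dvd_mult_left_iff)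
    then obtain b where "a = n * b" by (rule dvdE)
    then have "s = (monom2 1 b 0 * v) ^ n"
      by (simp add: s'(1) v power_mult_distrib monom2_power mult.commute)
    then show ?thesis by (rule that)
  qed
qed

lemma zero_not_isolated:
  assumes "coef s 0 0 = 0"
  shows "\<not> (\<forall>\<^sub>0z. ev s z = 0 \<longrightarrow> z = (0, 0))"
proof
  assume isolated: "\<forall>\<^sub>0z. ev s z = 0 \<longrightarrow> z = (0, 0)"
  have "coef s i j = 0" for i j
  proof -
    let ?n = "Suc (i + j)"
    have "isolated_common_zero s (s ^ (i + j))"
      using isolated unfolding isolated_common_zero_def by eventually_elim auto
    then obtain v where v: "s = v ^ ?n"
      using cps_nth_root[of s 1 "s ^ (i + j)" s ?n] by auto
    then have "coef v 0 0 ^ ?n = 0" using assms coef_power_0_0 by metis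
    then have "coef v 0 0 = 0" by (simp only: power_eq_0_iff)
    then show ?thesis unfolding v by (rule coef_power_low_order) simp
  qed
  then have "s = 0" by (intro cps_eqI) simp
  with isolated obtain r where "r > 0" "\<forall>z\<in>polydisc r. z = (0, 0)"
    unfolding near0_iff_polydisc by auto
  then show False by (auto dest!: bspec[of _ _ "(0, of_real (r / 2))"])
qed

section \<open>Lifting homomorphisms of invariant rings\<close>

lemma hom_vanishes_at_common_zeros:
  assumes "cps_hom (inv_ring m q) \<psi>" "0 < m" and a: "a \<in> inv_ring m q" "coef a 0 0 = 0"
  shows "\<forall>\<^sub>0z. ev (\<psi> (monom2 1 m 0)) z = 0 \<longrightarrow> ev (\<psi> (monom2 1 0 m)) z = 0 \<longrightarrow> ev (\<psi> a) z = 0"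
proof -
  interpret \<psi>: cps_hom "inv_ring m q" \<psi> by fact
  let ?x = "monom2 1 m 0" and ?y = "monom2 1 0 m"
  have xy: "?x \<in> inv_ring m q" "?y \<in> inv_ring m q" by (auto intro: monom2_in_inv_ring)
  obtain b1 b2 where b: "b1 \<in> inv_ring m q" "b2 \<in> inv_ring m q"
    and "a ^ (2 * m) = truncate m (a ^ (2 * m)) + ?x * b1 + ?y * b2"
    by (rule inv_ring_truncate[OF inv_ring.power_closed[OF a(1)] dvd_refl])
  moreover have "truncate m (a ^ (2 * m)) = 0"
    using coef_power_low_order[OF a(2), of _ _ "2 * m"] by (intro cps_eqI) (simp add: coef_truncate)
  ultimately have "a ^ (2 * m) = ?x * b1 + ?y * b2" by simp
  from arg_cong[OF this, of \<psi>] have image: "\<psi> a ^ (2 * m) = \<psi> ?x * \<psi> b1 + \<psi> ?y * \<psi> b2"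
    using xy a b by (simp add: \<psi>.map_add \<psi>.map_mult \<psi>.map_power inv_ring.mult_closed)
  have "\<forall>\<^sub>0z. ev (\<psi> a) z ^ (2 * m) = ev (\<psi> ?x) z * ev (\<psi> b1) z + ev (\<psi> ?y) z * ev (\<psi> b2) z"
    using ev_power[of "\<psi> a" "2 * m"] ev_add[of "\<psi> ?x * \<psi> b1" "\<psi> ?y * \<psi> b2"]
      ev_mult[of "\<psi> ?x" "\<psi> b1"] ev_mult[of "\<psi> ?y" "\<psi> b2"]
    by eventually_elim (simp add: image)
  then show ?thesis by eventually_elim auto
qed

lemma simultaneous_roots:
  assumes eq: "F ^ e * G = H ^ m" and m: "0 < m" "coprime e m" and common: "isolated_common_zero F G"
  obtains X Y where "F = X ^ m" "G = Y ^ m" "H = X ^ e * Y"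
proof -
  obtain X where X: "F = X ^ m" by (rule cps_nth_root[OF eq m(2,1) common])
  have "isolated_common_zero G (F ^ e)"
    using common ev_power[of F e] unfolding isolated_common_zero_def by eventually_elim auto
  then obtain Y where Y: "G = Y ^ m" using cps_nth_root[of G 1 "F ^ e" H m] eq m(1)
    by (auto simp: mult.commute)
  have "H ^ m = (X ^ e * Y) ^ m"
    using eq by (simp add: X Y power_mult_distrib mult.commute flip: power_mult)
  then obtain \<theta> where \<theta>: "\<theta> ^ m = 1" "H = cst \<theta> * (X ^ e * Y)" using cps_power_eq_imp[OF _ m(1)]
    by blast
  show ?thesis
    by (rule that[of X "cst \<theta> * Y"]) (use \<theta> X Y in
      \<open>simp_all add: power_mult_distrib cst_power mult_ac\<close>)
qed

lemma hom_monomial_eq: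
  assumes "cps_hom (inv_ring m q) \<psi>" and c: "e + q = m * c" and "X \<noteq> 0"
    and \<psi>: "\<psi> (monom2 1 m 0) = X ^ m" "\<psi> (monom2 1 e 1) = X ^ e * Y" and ij: "m dvd i + q * j"
  shows "\<psi> (monom2 1 i j) = X ^ i * Y ^ j"
proof -
  interpret \<psi>: cps_hom "inv_ring m q" \<psi> by fact
  obtain k where k: "i + q * j = m * k" using ij by (auto simp: dvd_def)
  have "e * j + (i + q * j) = i + (e + q) * j" by (simp add: algebra_simps)
  then have exponents: "i + m * (c * j) = e * j + m * k" by (simp add: c k mult.assoc)
  have inv: "monom2 1 m 0 \<in> inv_ring m q" "monom2 1 e 1 \<in> inv_ring m q" "monom2 1 i j \<in> inv_ring m q"
    using ij by (auto intro!: monom2_in_inv_ring simp: c)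
  have "monom2 1 i j * monom2 1 m 0 ^ (c * j) = monom2 1 e 1 ^ j * monom2 1 m 0 ^ k"
    by (simp add: monom2_power monom2_mult exponents)
  from arg_cong[OF this, of \<psi>]
  have "\<psi> (monom2 1 i j) * X ^ (m * (c * j)) = (X ^ e * Y) ^ j * X ^ (m * k)"
    using inv by (simp add: \<psi>.map_mult \<psi>.map_power inv_ring.power_closed \<psi> power_mult)
  also have "\<dots> = X ^ (e * j + m * k) * Y ^ j"
    by (simp add: power_mult_distrib power_add power_mult mult_ac)
  also have "\<dots> = (X ^ i * Y ^ j) * X ^ (m * (c * j))"
    unfolding exponents[symmetric] by (simp add: power_add mult_ac)
  finally show ?thesis using \<open>X \<noteq> 0\<close> by simp
qed

theorem inv_ring_hom_lift:
  assumes m: "0 < m" "coprime q m" and hom: "cps_hom (inv_ring m q) \<psi>"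
    and ab: "a \<in> inv_ring m q" "coef a 0 0 = 0" "b \<in> inv_ring m q" "coef b 0 0 = 0"
    and isolated: "isolated_common_zero (\<psi> a) (\<psi> b)"
  obtains X Y where "coef X 0 0 = 0" "coef Y 0 0 = 0" "\<And>s. s \<in> inv_ring m q \<Longrightarrow> \<psi> s = subst s X Y"
proof -
  interpret \<psi>: cps_hom "inv_ring m q" \<psi> by (rule hom)
  define e where "e = (m - 1) * q"
  have e: "e + q = m * q" using m(1) by (cases m) (auto simp: e_def)
  have "coprime (m - 1) m" using m(1) by (metis Suc_diff_1 coprime_Suc_right_nat)
  then have coprime_e: "coprime e m" using m(2) by (simp add: e_def)
  let ?F = "\<psi> (monom2 1 m 0)" and ?G = "\<psi> (monom2 1 0 m)" and ?H = "\<psi> (monom2 1 e 1)"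
  have inv: "monom2 1 m 0 \<in> inv_ring m q" "monom2 1 0 m \<in> inv_ring m q" "monom2 1 e 1 \<in> inv_ring m q"
    by (auto intro!: monom2_in_inv_ring simp: e)
  have FG0: "coef ?F 0 0 = 0" "coef ?G 0 0 = 0"
    using coef_hom_0_0[OF hom inv(1) m(1)] coef_hom_0_0[OF hom inv(2) m(1)] m(1) by simp_all
  have common: "isolated_common_zero ?F ?G"
    using isolated hom_vanishes_at_common_zeros[OF hom m(1) ab(1,2)]
      hom_vanishes_at_common_zeros[OF hom m(1) ab(3,4)]
    unfolding isolated_common_zero_def by eventually_elim auto
  have "monom2 1 m 0 ^ e * monom2 1 0 m = monom2 1 e 1 ^ m"
    by (simp add: monom2_power monom2_mult mult.commute)
  from arg_cong[OF this, of \<psi>] have "?F ^ e * ?G = ?H ^ m"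
    using inv by (simp add: \<psi>.map_mult \<psi>.map_power inv_ring.power_closed)
  from simultaneous_roots[OF this m(1) coprime_e common]
  obtain X Y where XY: "?F = X ^ m" "?G = Y ^ m" "?H = X ^ e * Y" .
  have XY0: "coef X 0 0 = 0" "coef Y 0 0 = 0"
    using FG0 coef_power_0_0[of X m] coef_power_0_0[of Y m] unfolding XY by simp_all
  have "X \<noteq> 0"
  proof
    assume "X = 0"
    then have "?F = 0" using XY(1) m(1) by (simp add: zero_power)
    then show False using common zero_not_isolated[OF FG0(2)] by (simp add: isolated_common_zero_def)
  qed
  from hom_eq_subst[OF m(1) hom XY0 hom_monomial_eq[OF hom e this XY(1,3)]] show ?thesis
    using that[OF XY0] by blast
qed

lemma inv_ring_uniformisation:
  assumes iso: "cps_iso (inv_ring n p) G" and n: "0 < n" "coprime p n"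
    and rs: "r \<in> G" "coef r 0 0 = 0" "s \<in> G" "coef s 0 0 = 0" "isolated_common_zero r s"
  obtains X Y where "coef X 0 0 = 0" "coef Y 0 0 = 0" "G = (\<lambda>a. subst a X Y) ` inv_ring n p"
proof -
  obtain \<psi> where \<psi>: "cps_hom (inv_ring n p) \<psi>" and image: "\<psi> ` inv_ring n p = G"
    using iso by (auto simp: cps_iso_def bij_betw_def)
  obtain a b where a: "a \<in> inv_ring n p" "\<psi> a = r" and b: "b \<in> inv_ring n p" "\<psi> b = s"
    using rs(1,3) image by (metis imageE)
  have "coef a 0 0 = 0" "coef b 0 0 = 0"
    using coef_hom_0_0[OF \<psi> a(1) n(1)] coef_hom_0_0[OF \<psi> b(1) n(1)] rs(2,4) by (simp_all add: a b)
  then obtain X Y where XY: "coef X 0 0 = 0" "coef Y 0 0 = 0"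
    and subst: "\<And>c. c \<in> inv_ring n p \<Longrightarrow> \<psi> c = subst c X Y"
    using inv_ring_hom_lift[OF n \<psi> a(1) _ b(1)] rs(5) a(2) b(2) by metis
  have "G = (\<lambda>c. subst c X Y) ` inv_ring n p"
    unfolding image[symmetric] by (rule image_cong[OF refl subst])
  then show ?thesis by (rule that[OF XY])
qed

section \<open>Invariant rings of monomial covers\<close>

lemma monom2_eq_0_iff: "monom2 c i j = 0 \<longleftrightarrow> c = 0"
proof
  assume "monom2 c i j = 0"
  from arg_cong[OF this, of "\<lambda>s. coef s i j"] show "c = 0" by (simp add: coef_monom2)
qed (auto intro: cps_eqI simp: coef_monom2)

lemma cps_jacobian_powers: "cps_jacobian (monom2 1 a 0) (monom2 1 0 b) =
    monom2 (of_nat (a * b)) (a - 1) (b - 1)"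
  by (simp add: cps_jacobian_def dx_monom2 dy_monom2 monom2_mult monom2_eq_0_iff)

lemma subst_powers_image:
  assumes ab: "0 < a" "0 < b"
  shows "(\<lambda>s. subst s (monom2 1 a 0) (monom2 1 0 b)) ` {s. \<forall>i j. coef s i j \<noteq> 0 \<longrightarrow> P i j} =
    {s. \<forall>i j. coef s i j \<noteq> 0 \<longrightarrow> a dvd i \<and> b dvd j \<and> P (i div a) (j div b)}"
    (is "?\<sigma> ` ?A = ?B")
proof
  show "?\<sigma> ` ?A \<subseteq> ?B" by (auto simp: coef_subst_powers[OF ab] split: if_splits)
  show "?B \<subseteq> ?\<sigma> ` ?A"
  proof
    fix s assume s: "s \<in> ?B"
    define u where "u = Cps (\<lambda>i j. coef s (a * i) (b * j))"
    have "a * i + b * j \<le> (a + b) * (i + j + 1)" for i j by (simp add: algebra_simps)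
    then have "convergent_ps2 (\<lambda>i j. coef s (a * i) (b * j))"
      by (rule convergent_ps2_reindex[OF convergent_coef])
    then have u: "coef u i j = coef s (a * i) (b * j)" for i j by (simp add: u_def)
    have "?\<sigma> u = s" by (rule cps_eqI) (use s in \<open>auto simp: coef_subst_powers[OF ab] u\<close>)
    moreover have "P i j" if "coef u i j \<noteq> 0" for i j
    proof -
      have "P (a * i div a) (b * j div b)" using s that unfolding u by blast
      then show ?thesis using ab by simp
    qed
    then have "u \<in> ?A" by blast
    ultimately show "s \<in> ?\<sigma> ` ?A" by blast
  qed
qed

lemma cps_iso_powers:
  assumes ab: "0 < a" "0 < b" and "cps_subalgebra {s. \<forall>i j. coef s i j \<noteq> 0 \<longrightarrow> P i j}"
  shows "cps_iso {s. \<forall>i j. coef s i j \<noteq> 0 \<longrightarrow> P i j}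
    {s. \<forall>i j. coef s i j \<noteq> 0 \<longrightarrow> a dvd i \<and> b dvd j \<and> P (i div a) (j div b)}"
  unfolding subst_powers_image[OF ab, symmetric]
  by (rule cps_iso_subst_image[OF _ _ _ assms(3)]) (use ab in
    \<open>auto simp: cps_jacobian_powers monom2_eq_0_iff\<close>)

lemma inv_ring_even_part_iso:
  "cps_iso {s \<in> inv_ring m q. \<forall>i j. coef s i j \<noteq> 0 \<longrightarrow> even j} (inv_ring m (2 * q))"
proof -
  have "even j \<and> m dvd i + q * j \<longleftrightarrow> 1 dvd i \<and> 2 dvd j \<and> m dvd i div 1 + 2 * q * (j div 2)" for i j
    by (cases "even j") (metis div_by_1 dvd_mult_div_cancel mult.assoc mult.commute one_dvd, simp)
  then have "{s \<in> inv_ring m q. \<forall>i j. coef s i j \<noteq> 0 \<longrightarrow> even j} =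
      {s. \<forall>i j. coef s i j \<noteq> 0 \<longrightarrow> 1 dvd i \<and> 2 dvd j \<and> m dvd i div 1 + 2 * q * (j div 2)}"
    unfolding inv_ring_def by blast
  moreover have "cps_subalgebra {s. \<forall>i j. coef s i j \<noteq> 0 \<longrightarrow> m dvd i + 2 * q * j}"
    using inv_ring.cps_subalgebra_axioms[of m "2 * q"] by (simp only: inv_ring_def)
  ultimately show ?thesis
    using cps_iso_sym[OF cps_iso_powers[of 1 2 "\<lambda>i j. m dvd i + 2 * q * j"]]
    by (simp only: inv_ring_def zero_less_one zero_less_numeral)
qed

lemma inv_ring_cancel_iso:
  assumes "0 < g"
  shows "cps_iso (inv_ring n p) (inv_ring (g * n) (g * p))"
proof -
  have "g * n dvd i + g * p * j \<longleftrightarrow> g dvd i \<and> 1 dvd j \<and> n dvd i div g + p * (j div 1)" for i j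
  proof (cases "g dvd i")
    case True
    then obtain i' where i': "i = g * i'" by (rule dvdE)
    have "i + g * p * j = g * (i' + p * j)" by (simp add: i' algebra_simps)
    then show ?thesis using assms by (simp add: i')
  next
    case False
    have "g dvd g * p * j" by (simp add: mult.assoc)
    then have "\<not> g dvd i + g * p * j" using False dvd_add_left_iff by blast
    then show ?thesis using False dvd_mult_left by blast
  qed
  then have "inv_ring (g * n) (g * p) =
      {s. \<forall>i j. coef s i j \<noteq> 0 \<longrightarrow> g dvd i \<and> 1 dvd j \<and> n dvd i div g + p * (j div 1)}"
    unfolding inv_ring_def by blast
  moreover have "cps_subalgebra {s. \<forall>i j. coef s i j \<noteq> 0 \<longrightarrow> n dvd i + p * j}"
    using inv_ring.cps_subalgebra_axioms[of n p] by (simp only: inv_ring_def)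
  ultimately show ?thesis
    using cps_iso_powers[OF assms zero_less_one, of "\<lambda>i j. n dvd i + p * j"]
    by (simp only: inv_ring_def)
qed

lemma inv_ring_iso_UNIV_coprime:
  assumes iso: "cps_iso (inv_ring n p) UNIV" and n: "0 < n" "coprime p n"
  shows "n = 1"
proof (rule ccontr)
  assume "n \<noteq> 1"
  have "isolated_common_zero xvar yvar" by (simp add: isolated_common_zero_def ev_monom2 prod_eq_iff)
  then obtain X Y where XY: "coef X 0 0 = 0" "coef Y 0 0 = 0"
      "UNIV = (\<lambda>a. subst a X Y) ` inv_ring n p"
    using inv_ring_uniformisation[OF iso n, of xvar yvar] by auto
  have "xvar \<in> (\<lambda>a. subst a X Y) ` inv_ring n p" unfolding XY(3)[symmetric] by (rule UNIV_I)
  then obtain a where a: "a \<in> inv_ring n p" "xvar = subst a X Y" by (elim imageE)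
  have "\<not> n dvd p" using n(2) \<open>n \<noteq> 1\<close> by (metis coprime_common_divisor_nat dvd_refl)
  then have "coef a 1 0 = 0" "coef a 0 1 = 0"
    using a(1) \<open>n \<noteq> 1\<close> by (fastforce simp: inv_ring_def)+
  then have "coef xvar 1 0 = 0" unfolding a(2) by (simp add: linear_coefs_subst(1)[OF XY(1,2)])
  then show False by (simp add: coef_monom2)
qed

lemma inv_ring_iso_UNIV_imp_dvd:
  assumes "cps_iso (inv_ring n p) UNIV" "0 < n"
  shows "n dvd p"
proof -
  define g where "g = gcd n p"
  have g: "0 < g" "n = g * (n div g)" "p = g * (p div g)" using assms(2) by (auto simp: g_def)
  have "cps_iso (inv_ring (n div g) (p div g)) UNIV"
    using inv_ring_cancel_iso[OF g(1), of "n div g" "p div g"] assms(1) g(2,3) cps_iso_trans by metis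
  moreover have "0 < n div g" using g(2) assms(2) by (metis gr0I mult_0_right)
  moreover have "coprime (p div g) (n div g)"
    using div_gcd_coprime[of n p] assms(2) by (simp add: g_def coprime_commute)
  ultimately have "n div g = 1" by (rule inv_ring_iso_UNIV_coprime)
  then have "n = g" using g(2) by simp
  then show ?thesis by (metis g_def gcd_dvd2)
qed

section \<open>Symmetric invariants\<close>

fun lucas :: "nat \<Rightarrow> complex \<Rightarrow> complex \<Rightarrow> complex" where
  "lucas 0 v w = 2"
| "lucas (Suc 0) v w = v"
| "lucas (Suc (Suc k)) v w = v * lucas (Suc k) v w - w * lucas k v w"

lemma lucas_power_sum: "lucas k (a + b) (a * b) = a ^ k + b ^ k"
  by (induction k "a + b" "a * b" rule: lucas.induct) (auto simp: algebra_simps)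

lemma norm_lucas_le:
  assumes "norm v \<le> r / 2" "norm w \<le> r\<^sup>2 / 2" "0 \<le> r"
  shows "norm (lucas k v w) \<le> 2 * r ^ k"
  using assms
proof (induction k v w rule: lucas.induct)
  case (3 k v w)
  have "norm (lucas (Suc (Suc k)) v w) \<le> norm v * norm (lucas (Suc k) v w) +
      norm w * norm (lucas k v w)"
    using norm_triangle_ineq4[of "v * lucas (Suc k) v w" "w * lucas k v w"] by (simp add: norm_mult)
  also have "\<dots> \<le> r / 2 * (2 * r ^ Suc k) + r\<^sup>2 / 2 * (2 * r ^ k)"
    using 3 by (intro add_mono mult_mono) auto
  also have "\<dots> = 2 * r ^ Suc (Suc k)" by (simp add: power2_eq_square)
  finally show ?case .
qed auto

lemma holomorphic2_on_lucas:
  assumes "F holomorphic2_on U" "G holomorphic2_on U"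
  shows "(\<lambda>z. lucas k (F z) (G z)) holomorphic2_on U"
proof (induction k rule: induct_nat_012)
  case (ge2 n)
  then show ?case by (auto intro!: holomorphic2_on_diff holomorphic2_on_mult assms)
qed (auto intro: assms)

lemma lucas_series:
  assumes d: "0 < d"
  obtains b where "\<forall>\<^sub>0z. ev b z = (\<Sum>\<^sub>\<infinity>(k, j). coef P k j * lucas k (fst z) (snd z ^ d) * snd z ^ j)"
proof -
  obtain r where r: "r > 0" "ps2_abs_conv (coef P) r"
    using convergent_coef[of P] unfolding convergent_ps2_def by blast
  define F where "F = (\<lambda>(k, j) z. coef P k j * lucas k (fst z) (snd z ^ d) * snd z ^ j)"
  define \<epsilon> where "\<epsilon> = min (min 1 (r / 2)) (r\<^sup>2 / 2)"
  have \<epsilon>: "0 < \<epsilon>" "\<epsilon> \<le> 1" "\<epsilon> \<le> r / 2" "\<epsilon> \<le> r\<^sup>2 / 2" using r(1) by (auto simp: \<epsilon>_def)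
  have bound: "norm (F (k, j) z) \<le> 2 * (norm (coef P k j) * r ^ (k + j))" if z: "z \<in> polydisc \<epsilon>"
    for k j z
  proof -
    obtain v u where vu: "z = (v, u)" "norm v \<le> \<epsilon>" "norm u \<le> \<epsilon>" using z by (cases z) auto
    have "norm u ^ d \<le> norm u ^ 1" using vu \<epsilon> d by (intro power_decreasing) auto
    then have "norm (lucas k v (u ^ d)) \<le> 2 * r ^ k"
      using vu \<epsilon> r(1) by (intro norm_lucas_le) (auto simp: norm_power)
    moreover have "norm u ^ j \<le> r ^ j" using vu \<epsilon> r(1) by (intro power_mono) auto
    ultimately have "norm (coef P k j) * norm (lucas k v (u ^ d)) * norm u ^ j \<le>
        norm (coef P k j) * (2 * r ^ k) * r ^ j"
      using r(1) by (intro mult_mono mult_left_mono) auto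
    then show ?thesis by (simp add: F_def vu(1) norm_mult norm_power power_add mult_ac)
  qed
  have "(\<lambda>z. \<Sum>\<^sub>\<infinity>p. F p z) holomorphic2_on polydisc \<epsilon>"
  proof (rule holomorphic2_on_infsum)
    show "F p holomorphic2_on polydisc \<epsilon>" for p
      unfolding F_def case_prod_unfold by (intro holomorphic2_intros holomorphic2_on_lucas)
    show "norm (F p z) \<le> (case p of (k, j) \<Rightarrow> 2 * (norm (coef P k j) * r ^ (k + j)))"
      if "z \<in> polydisc \<epsilon>" for p z
      using bound[OF that] by (cases p) simp
    show "(\<lambda>(k, j). 2 * (norm (coef P k j) * r ^ (k + j))) summable_on UNIV"
      using summable_on_cmult_right[OF r(2), of 2] by (simp add: case_prod_unfold)
  qed simp
  then obtain b where "\<forall>\<^sub>0z. ev b z = (\<Sum>\<^sub>\<infinity>p. F p z)"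
    using \<epsilon>(1) by (elim holomorphic2_on_imp_ev) auto
  then show ?thesis using that by (simp add: F_def case_prod_unfold)
qed

lemma ev_has_sum: "\<forall>\<^sub>0z. ((\<lambda>(k, j). coef P k j * fst z ^ k * snd z ^ j) has_sum ev P z) UNIV"
proof -
  obtain r where r: "r > 0" "ps2_abs_conv (coef P) r"
    using convergent_coef[of P] unfolding convergent_ps2_def by blast
  have "((\<lambda>(k, j). coef P k j * fst z ^ k * snd z ^ j) has_sum ev P z) UNIV" if "z \<in> polydisc r" for z
    using ps2_eval_has_sum[OF r(2), of "fst z" "snd z"] that by (cases z) (simp add: ev_def)
  then show ?thesis unfolding near0_iff_polydisc using r(1) by blast
qed

text \<open>The trace of a monomial in \<open>x\<^sup>d\<close> and \<open>x y\<close> is a power of \<open>x y\<close> times a power sum of \<open>x\<^sup>d\<close> and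
  \<open>y\<^sup>d\<close>, which is a Lucas polynomial in \<open>x\<^sup>d + y\<^sup>d\<close> and \<open>(x y)\<^sup>d\<close>.\<close>

lemma trace_is_subst:
  assumes d: "0 < d"
  obtains b where "subst b (monom2 1 d 0 + monom2 1 0 d) (monom2 1 1 1) =
    subst P (monom2 1 d 0) (monom2 1 1 1) + subst P (monom2 1 0 d) (monom2 1 1 1)"
proof -
  obtain b where b: "\<forall>\<^sub>0z. ev b z = (\<Sum>\<^sub>\<infinity>(k, j). coef P k j * lucas k (fst z) (snd z ^ d) * snd z ^ j)"
    using lucas_series[OF d] .
  let ?X = "monom2 1 d 0" and ?Y = "monom2 1 0 d" and ?U = "monom2 1 1 1"
  have const: "coef ?X 0 0 = 0" "coef ?Y 0 0 = 0" "coef (?X + ?Y) 0 0 = 0" "coef ?U 0 0 = 0" using d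
    by auto
  have "subst b (?X + ?Y) ?U = subst P ?X ?U + subst P ?Y ?U"
  proof (rule ev_eqI, use ev_subst[OF const(3,4), of b] near0_compose[OF const(3,4) b]
      ev_add[of ?X ?Y] ev_add[of "subst P ?X ?U" "subst P ?Y ?U"]
      ev_subst[OF const(1,4), of P] ev_subst[OF const(2,4), of P]
      near0_compose[OF const(1,4) ev_has_sum[of P]]
      near0_compose[OF const(2,4) ev_has_sum[of P]] in eventually_elim)
    case (elim z)
    let ?x = "fst z" and ?y = "snd z"
    have power_sum: "lucas k (?x ^ d + ?y ^ d) ((?x * ?y) ^ d) = (?x ^ d) ^ k + (?y ^ d) ^ k" for k
      by (simp add: power_mult_distrib lucas_power_sum)
    have "((\<lambda>(k, j). coef P k j * lucas k (?x ^ d + ?y ^ d) ((?x * ?y) ^ d) * (?x * ?y) ^ j) has_sum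
        ev P (?x ^ d, ?x * ?y) + ev P (?y ^ d, ?x * ?y)) UNIV"
      using has_sum_add[OF elim(7,8)]
      by (simp add: ev_monom2 power_sum case_prod_unfold distrib_left distrib_right)
    then show ?case using elim(1-6) by (simp add: ev_monom2 infsumI)
  qed
  then show ?thesis by (rule that)
qed

lemma coef_subst_power_xy:
  assumes "0 < d"
  shows "coef (subst P (monom2 1 d 0) (monom2 1 1 1)) i j =
      (if j \<le> i \<and> d dvd i - j then coef P ((i - j) div d) j else 0)"
    and "coef (subst P (monom2 1 0 d) (monom2 1 1 1)) i j =
      (if i \<le> j \<and> d dvd j - i then coef P ((j - i) div d) i else 0)"
proof -
  have solve: "d * k + l = i \<and> l = j \<longleftrightarrow> (j \<le> i \<and> d dvd i - j) \<and> k = (i - j) div d \<and> l = j" for i j k l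
    using assms by auto
  show "coef (subst P (monom2 1 d 0) (monom2 1 1 1)) i j =
      (if j \<le> i \<and> d dvd i - j then coef P ((i - j) div d) j else 0)"
  proof (cases "j \<le> i \<and> d dvd i - j")
    case True
    have "coef (subst P (monom2 1 d 0) (monom2 1 1 1)) i j =
        1 ^ ((i - j) div d) * 1 ^ j * coef P ((i - j) div d) j"
      by (rule coef_subst_monom2_unique) (use assms solve[of _ _ i j] True in auto)
    then show ?thesis using True by simp
  next
    case False
    then show ?thesis by (subst coef_subst_monom2_eq_0) (use assms solve[of _ _ i j] in auto)
  qed
  show "coef (subst P (monom2 1 0 d) (monom2 1 1 1)) i j =
      (if i \<le> j \<and> d dvd j - i then coef P ((j - i) div d) i else 0)"
  proof (cases "i \<le> j \<and> d dvd j - i")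
    case True
    have "coef (subst P (monom2 1 0 d) (monom2 1 1 1)) i j =
        1 ^ ((j - i) div d) * 1 ^ i * coef P ((j - i) div d) i"
      by (rule coef_subst_monom2_unique) (use assms solve[of _ _ j i] True in auto)
    then show ?thesis using True by simp
  next
    case False
    then show ?thesis by (subst coef_subst_monom2_eq_0) (use assms solve[of _ _ j i] in auto)
  qed
qed

lemma symmetric_imp_subst:
  assumes d: "0 < d" and sym: "flip s = s" and support: "\<And>i j. coef s i j \<noteq> 0 \<Longrightarrow> [i = j] (mod d)"
  obtains b where "s = subst b (monom2 1 d 0 + monom2 1 0 d) (monom2 1 1 1)"
proof -
  define a where "a k j = (if k = 0 then 1 / 2 else 1) * coef s (d * k + j) j" for k j
  have "d * k + j + j \<le> (d + 2) * (k + j + 1)" for k j by (simp add: algebra_simps)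
  then have "convergent_ps2 (\<lambda>k j. coef s (d * k + j) j)"
    by (rule convergent_ps2_reindex[OF convergent_coef])
  then have "convergent_ps2 a" by (rule convergent_ps2_mono) (simp add: a_def norm_mult)
  then have P: "coef (Cps a) = a" by simp
  have sym': "coef s j i = coef s i j" for i j using sym coef_flip[of s i j] by simp
  have divides: "d dvd i - j" if "coef s i j \<noteq> 0" "j \<le> i" for i j
    using support[OF that(1)] that(2) by (simp add: cong_altdef_nat)
  obtain b where b: "subst b (monom2 1 d 0 + monom2 1 0 d) (monom2 1 1 1) =
      subst (Cps a) (monom2 1 d 0) (monom2 1 1 1) + subst (Cps a) (monom2 1 0 d) (monom2 1 1 1)"
    using trace_is_subst[OF d] .
  have "coef s i j = coef (subst b (monom2 1 d 0 + monom2 1 0 d) (monom2 1 1 1)) i j" for i j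
    unfolding b coef_add coef_subst_power_xy[OF d] P
    using divides[of i j] divides[of j i] sym'[of i j] d
    by (cases i j rule: linorder_cases) (auto simp: a_def dvd_div_eq_0_iff)
  then show ?thesis using that cps_eqI by blast
qed

lemma cps_jacobian_power_sum_product:
  assumes "0 < d"
  shows "cps_jacobian (monom2 1 d 0 + monom2 1 0 d) (monom2 1 1 1) \<noteq> 0"
proof
  assume "cps_jacobian (monom2 1 d 0 + monom2 1 0 d) (monom2 1 1 1) = 0"
  from arg_cong[OF this, of "\<lambda>s. coef s d 0"] show False
    using assms
    by (simp add: cps_jacobian_def dx_add dy_add dx_monom2 dy_monom2 distrib_right monom2_mult
      coef_monom2)
qed

lemma mult_gcd_cong_of_square_cong_1:
  fixes q m :: nat
  assumes "[q\<^sup>2 = 1] (mod m)"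
  shows "[q * gcd (q + 1) m = gcd (q + 1) m] (mod m)"
proof -
  have "int m dvd (int q)\<^sup>2 - 1"
    using assms by (metis cong_iff_dvd_diff cong_int_iff of_nat_1 of_nat_power)
  then have "int m dvd (int q - 1) * int (q + 1)" by (simp add: power2_eq_square algebra_simps)
  then have "int m dvd gcd ((int q - 1) * int (q + 1)) ((int q - 1) * int m)" by simp
  also have "gcd ((int q - 1) * int (q + 1)) ((int q - 1) * int m) =
      \<bar>int q - 1\<bar> * int (gcd (q + 1) m)"
    by (simp add: gcd_mult_left abs_mult del: of_nat_add of_nat_Suc flip: gcd_int_int_eq)
  finally have "int m dvd int (q * gcd (q + 1) m) - int (gcd (q + 1) m)"
    by (auto simp: abs_if algebra_simps dvd_diff_commute split: if_splits)
  then show ?thesis by (simp add: cong_iff_dvd_diff flip: cong_int_iff)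
qed

lemma cong_of_dvd_weighted_degree:
  fixes d i j q :: nat
  assumes "d dvd i + q * j" "d dvd q + 1"
  shows "[i = j] (mod d)"
proof -
  have "int d dvd int (i + q * j) - int (q + 1) * int j"
    using assms by (meson dvd_diff dvd_mult2 int_dvd_int_iff)
  also have "int (i + q * j) - int (q + 1) * int j = int i - int j" by (simp add: algebra_simps)
  finally show ?thesis by (simp add: cong_iff_dvd_diff flip: cong_int_iff)
qed

theorem symmetric_ring_iso:
  fixes m q :: nat
  defines "d \<equiv> gcd (q + 1) m"
  assumes m: "0 < m" and q: "[q\<^sup>2 = 1] (mod m)"
  shows "cps_iso {s \<in> inv_ring m q. flip s = s} (inv_ring (m div d) ((q + 1) div d))"
proof -
  have d: "0 < d" "d dvd m" "d dvd q + 1" using m by (auto simp: d_def)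
  let ?V = "monom2 1 d 0 + monom2 1 0 d" and ?U = "monom2 1 1 1"
  have VU: "coef ?V 0 0 = 0" "coef ?U 0 0 = 0" using d(1) by auto
  note jacobian = cps_jacobian_power_sum_product[OF d(1)]
  have root: "unity_root m ^ d = unity_root (m div d)" by (rule unity_root_power_dvd[OF m d(2)])
  have "unity_root m ^ (q * d) = unity_root m ^ d"
    using mult_gcd_cong_of_square_cong_1[OF q] unity_root_power_eq_iff[OF m] by (simp add: d_def)
  then have weight_V: "mu_act m q ?V = cst (unity_root (m div d)) * ?V"
    by (simp add: mu_act_add mu_act_monom2 root distrib_left)
  have weight_U: "mu_act m q ?U = cst (unity_root (m div d) ^ ((q + 1) div d)) * ?U"
    using d(3) by (simp add: mu_act_monom2 add.commute flip: root power_mult)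
  have invariant_iff: "subst b ?V ?U \<in> inv_ring m q \<longleftrightarrow> b \<in> inv_ring (m div d) ((q + 1) div d)" for b
    using m d(2) inj_subst[OF VU jacobian] weight_V weight_U
    by (intro subst_in_inv_ring_iff VU) (auto simp: inj_def div_greater_zero_iff dvd_imp_le)
  have "flip ?V = ?V" "flip ?U = ?U" by (rule cps_eqI; auto simp: coef_monom2)+
  then have flip_subst: "flip (subst b ?V ?U) = subst b ?V ?U" for b
    unfolding flip_def subst_subst[OF VU coef_vars_0_0(2,1)] by simp
  have "s \<in> (\<lambda>b. subst b ?V ?U) ` inv_ring (m div d) ((q + 1) div d)"
    if s: "s \<in> inv_ring m q" "flip s = s" for s
  proof -
    have "[i = j] (mod d)" if "coef s i j \<noteq> 0" for i j
      using s(1) that d cong_of_dvd_weighted_degree[of d i q j] dvd_trans[OF d(2)]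
      by (auto simp: inv_ring_def)
    then obtain b where "s = subst b ?V ?U" using symmetric_imp_subst[OF d(1) s(2)] by blast
    then show ?thesis using invariant_iff s(1) by blast
  qed
  then have
      "{s \<in> inv_ring m q. flip s = s} = (\<lambda>b. subst b ?V ?U) ` inv_ring (m div d) ((q + 1) div d)"
    using invariant_iff flip_subst by blast
  then show ?thesis
    using cps_iso_sym[OF cps_iso_subst_image[OF VU jacobian inv_ring.cps_subalgebra_axioms]] by simp
qed

section \<open>Involutions with diagonal linear part\<close>

lemma sign_character_invariants:
  fixes \<alpha> \<beta> \<sigma> \<tau> :: complex
  assumes m: "0 < m" and \<sigma>: "\<alpha> ^ m = \<sigma>" "\<sigma> = 1 \<or> \<sigma> = -1" and \<tau>: "\<beta> = \<tau> * \<alpha> ^ q" "\<tau> = 1 \<or> \<tau> = -1"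
  shows "m dvd i + q * j \<and> \<alpha> ^ i * \<beta> ^ j = 1 \<longleftrightarrow>
    (if \<sigma> = 1 then m dvd i + q * j \<and> (\<tau> = -1 \<longrightarrow> even j)
     else if \<tau> = 1 then 2 * m dvd i + q * j else 2 * m dvd i + (m + q) * j)"
proof (cases "m dvd i + q * j")
  case False
  have "m dvd m * j" by simp
  then have "\<not> m dvd i + (m + q) * j"
    using False dvd_add_right_iff[of m "m * j" "i + q * j"] by (simp add: algebra_simps)
  then show ?thesis using False by (auto dest: dvd_mult_right)
next
  case True
  then obtain k where k: "i + q * j = m * k" by (rule dvdE)
  have "\<alpha> ^ i * \<beta> ^ j = \<tau> ^ j * \<alpha> ^ (i + q * j)"
    unfolding \<tau>(1) power_mult_distrib power_add power_mult by (rule mult.left_commute)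
  also have "\<dots> = \<tau> ^ j * \<sigma> ^ k" by (simp add: k power_mult \<sigma>(1))
  finally have character: "\<alpha> ^ i * \<beta> ^ j = \<tau> ^ j * \<sigma> ^ k" .
  have parity: "(- 1 :: complex) ^ n = 1 \<longleftrightarrow> even n" for n by (cases "even n") auto
  have "2 * m dvd i + q * j \<longleftrightarrow> even k" using m by (simp add: k mult.commute[of 2 m])
  moreover have "i + (m + q) * j = m * (j + k)" using k by (simp add: algebra_simps)
  then have "2 * m dvd i + (m + q) * j \<longleftrightarrow> even (j + k)" using m by (simp add: mult.commute[of 2 m])
  ultimately show ?thesis
    using \<sigma>(2) \<tau>(2) True by (auto simp: character parity simp flip: power_add)
qed

lemma diagonal_fixed_ring:
  assumes m: "0 < m" and \<alpha>: "\<alpha> ^ (2 * m) = 1" and \<beta>: "\<beta>\<^sup>2 = \<alpha> ^ (2 * q)"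
  shows "{s \<in> inv_ring m q. scale \<alpha> \<beta> s = s} \<in>
    {inv_ring m q, {s \<in> inv_ring m q. \<forall>i j. coef s i j \<noteq> 0 \<longrightarrow> even j},
     inv_ring (2 * m) q, inv_ring (2 * m) (m + q)}"
proof -
  have "(\<alpha> ^ m)\<^sup>2 = 1" "\<beta>\<^sup>2 = (\<alpha> ^ q)\<^sup>2" using \<alpha> \<beta> by (simp_all add: mult.commute flip: power_mult)
  then have "\<alpha> ^ m = 1 \<or> \<alpha> ^ m = -1" "\<beta> = \<alpha> ^ q \<or> \<beta> = - (\<alpha> ^ q)"
    by (simp_all add: power2_eq_1_iff power2_eq_iff)
  then obtain \<sigma> \<tau> where "\<alpha> ^ m = \<sigma>" "\<sigma> = 1 \<or> \<sigma> = -1" "\<beta> = \<tau> * \<alpha> ^ q" "\<tau> = 1 \<or> \<tau> = -1"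
    by (metis mult_1 mult_minus1)
  note character = sign_character_invariants[OF m this]
  have "{s \<in> inv_ring m q. scale \<alpha> \<beta> s = s} =
      {s. \<forall>i j. coef s i j \<noteq> 0 \<longrightarrow> m dvd i + q * j \<and> \<alpha> ^ i * \<beta> ^ j = 1}"
    unfolding inv_ring_def scale_eq_iff by blast
  also have "\<dots> \<in> {inv_ring m q, {s \<in> inv_ring m q. \<forall>i j. coef s i j \<noteq> 0 \<longrightarrow> even j},
      inv_ring (2 * m) q, inv_ring (2 * m) (m + q)}"
    unfolding character inv_ring_def by (cases "\<sigma> = 1"; cases "\<tau> = 1"; cases "\<tau> = -1") auto
  finally show ?thesis .
qed

lemma square_root_of_scalar_matrix_diagonalizable:
  fixes a b c d \<omega> :: complex
  assumes square: "a * a + b * c = \<omega>" "a * b + b * d = 0" "c * a + d * c = 0" "c * b + d * d = \<omega>"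
    and "\<omega> \<noteq> 0"
  obtains \<alpha> p r \<alpha>' p' r' where "\<alpha>\<^sup>2 = \<omega>" "p * a + r * c = \<alpha> * p" "p * b + r * d = \<alpha> * r"
    "\<alpha>'\<^sup>2 = \<omega>" "p' * a + r' * c = \<alpha>' * p'" "p' * b + r' * d = \<alpha>' * r'" "p * r' - r * p' \<noteq> 0"
proof -
  define \<alpha> where "\<alpha> = csqrt \<omega>"
  have \<alpha>: "\<alpha> * \<alpha> = \<omega>" "\<alpha>\<^sup>2 = \<omega>" by (simp_all add: \<alpha>_def flip: power2_eq_square)
  have "\<alpha> \<noteq> 0" using \<alpha> assms(5) by auto
  have "b * (a + d) = 0" "c * (a + d) = 0" using square(2,3) by (simp_all add: algebra_simps)
  then consider "c \<noteq> 0" "d = - a" | "c = 0" "b \<noteq> 0" "d = - a" | "c = 0" "b = 0"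
    by (auto simp: add_eq_0_iff)
  then show thesis
  proof cases
    case 1
    show thesis
      by (rule that[of \<alpha> c "\<alpha> - a" "- \<alpha>" c "- \<alpha> - a"])
        (use \<alpha> \<open>\<alpha> \<noteq> 0\<close> 1 square(1) in \<open>auto simp: algebra_simps\<close>)
  next
    case 2
    show thesis
      by (rule that[of \<alpha> "\<alpha> - d" b "- \<alpha>" "- \<alpha> - d" b])
        (use \<alpha> \<open>\<alpha> \<noteq> 0\<close> 2 square(1) in \<open>auto simp: algebra_simps\<close>)
  next
    case 3
    show thesis
      by (rule that[of a 1 0 d 0 1]) (use square 3 in \<open>auto simp: power2_eq_square\<close>)
  qed
qed

section \<open>Lifted involutions\<close>

lemma subst_trivial_on_inv_ring:
  assumes m: "0 < m" and XY: "coef X 0 0 = 0" "coef Y 0 0 = 0"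
    and trivial: "\<And>a. a \<in> inv_ring m q \<Longrightarrow> subst a X Y = a"
  obtains \<omega> where "\<omega> ^ m = 1" "X = monom2 \<omega> 1 0" "Y = monom2 (\<omega> ^ q) 0 1"
proof -
  have "X ^ m = xvar ^ m" "Y ^ m = yvar ^ m"
    using trivial[OF monom2_in_inv_ring, of m 0 1] trivial[OF monom2_in_inv_ring, of 0 m 1]
    by (simp_all add: subst_monom2[OF XY] monom2_power)
  then obtain \<omega> \<omega>' where \<omega>: "\<omega> ^ m = 1" and X: "X = monom2 \<omega> 1 0" and Y: "Y = monom2 \<omega>' 0 1"
    using m by (elim cps_power_eq_imp) (auto simp: monom2_mult)
  define e where "e = (m - 1) * q"
  have e: "e + q = m * q" using m by (cases m) (auto simp: e_def)
  have "X ^ e * Y = monom2 1 e 1"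
    using trivial[OF monom2_in_inv_ring, of e 1 1] by (simp add: e subst_monom2[OF XY])
  from arg_cong[OF this, of "\<lambda>s. coef s e 1"] have "\<omega> ^ e * \<omega>' = 1"
    by (simp add: X Y monom2_power monom2_mult coef_monom2)
  moreover have "\<omega> ^ q * \<omega> ^ e = 1" using e \<omega> by (simp add: power_mult add.commute flip: power_add)
  ultimately have "\<omega>' = \<omega> ^ q" by (metis mult.assoc mult.commute mult_1)
  then show ?thesis using that \<omega> X Y by blast
qed

locale lifted_involution =
  fixes m q :: nat and X Y :: cps and \<omega> :: complex
  assumes q: "0 < q" "q < m" "coprime q m"
    and lift_0: "coef X 0 0 = 0" "coef Y 0 0 = 0"
    and lift_closed: "a \<in> inv_ring m q \<Longrightarrow> subst a X Y \<in> inv_ring m q"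
    and lift_twice: "subst X X Y = monom2 \<omega> 1 0" "subst Y X Y = monom2 (\<omega> ^ q) 0 1"
    and root: "\<omega> ^ m = 1"

theorem inv_ring_involution_lift:
  assumes q: "0 < q" "q < m" "coprime q m" and hom: "cps_hom (inv_ring m q) t"
    and closed: "\<And>a. a \<in> inv_ring m q \<Longrightarrow> t a \<in> inv_ring m q"
    and involutive: "\<And>a. a \<in> inv_ring m q \<Longrightarrow> t (t a) = a"
  obtains X Y \<omega> where "lifted_involution m q X Y \<omega>" "\<And>a. a \<in> inv_ring m q \<Longrightarrow> t a = subst a X Y"
proof -
  have m: "0 < m" using q by simp
  let ?x = "monom2 1 m 0" and ?y = "monom2 1 0 m"
  have xy: "?x \<in> inv_ring m q" "?y \<in> inv_ring m q" by (auto intro: monom2_in_inv_ring)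
  have "isolated_common_zero (t (t ?x)) (t (t ?y))"
    using m by (auto simp: involutive xy isolated_common_zero_def ev_monom2 prod_eq_iff)
  moreover have "coef (t ?x) 0 0 = 0" "coef (t ?y) 0 0 = 0"
    using m coef_hom_0_0[OF hom xy(1) m] coef_hom_0_0[OF hom xy(2) m] by simp_all
  ultimately obtain X Y where XY: "coef X 0 0 = 0" "coef Y 0 0 = 0"
    and t: "\<And>a. a \<in> inv_ring m q \<Longrightarrow> t a = subst a X Y"
    using inv_ring_hom_lift[OF m q(3) hom closed[OF xy(1)] _ closed[OF xy(2)]] by metis
  have "coef (subst X X Y) 0 0 = 0" "coef (subst Y X Y) 0 0 = 0" by (simp_all add: coef_subst_0_0 XY)
  moreover have "subst a (subst X X Y) (subst Y X Y) = a" if "a \<in> inv_ring m q" for a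
    using involutive[OF that] closed[OF that] that by (simp add: t subst_subst[OF XY XY])
  ultimately obtain \<omega> where "\<omega> ^ m = 1" "subst X X Y = monom2 \<omega> 1 0"
      "subst Y X Y = monom2 (\<omega> ^ q) 0 1"
    using subst_trivial_on_inv_ring[OF m] by metis
  moreover have "subst a X Y \<in> inv_ring m q" if "a \<in> inv_ring m q" for a
    using closed[OF that] t[OF that] by simp
  ultimately have "lifted_involution m q X Y \<omega>" using q XY by unfold_locales
  then show ?thesis using that t by blast
qed

context lifted_involution
begin

lemma m_pos: "0 < m"
  using q by simp

lemma root_nonzero: "\<omega> \<noteq> 0"
  using root m_pos by (auto simp: zero_power)

definition fixed :: "cps set" where
  "fixed = {a \<in> inv_ring m q. subst a X Y = a}"

lemma cps_subalgebra_fixed: "cps_subalgebra fixed"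
  unfolding fixed_def
  using cps_subalgebra_equalizer[OF cps_hom_subst[OF lift_0] cps_hom_subst[OF coef_vars_0_0]]
  by (simp add: subst_xvar_yvar inv_ring.cps_subalgebra_axioms)

lemma weights:
  obtains \<theta> \<theta>' where "mu_act m q X = cst \<theta> * X" "mu_act m q Y = cst \<theta>' * Y"
proof -
  have "X ^ m \<in> inv_ring m q" "Y ^ m \<in> inv_ring m q"
    using lift_closed[OF monom2_in_inv_ring, of m 0 1] lift_closed[OF monom2_in_inv_ring, of 0 m 1]
    by (simp_all add: subst_monom2 lift_0)
  then show ?thesis using root_of_invariant[OF _ m_pos m_pos] that by metis
qed

lemma linear_part_squared:
  "coef X 1 0 * coef X 1 0 + coef X 0 1 * coef Y 1 0 = \<omega>"
  "coef X 1 0 * coef X 0 1 + coef X 0 1 * coef Y 0 1 = 0"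
  "coef Y 1 0 * coef X 1 0 + coef Y 0 1 * coef Y 1 0 = 0"
  "coef Y 1 0 * coef X 0 1 + coef Y 0 1 * coef Y 0 1 = \<omega> ^ q"
  using linear_coefs_subst[OF lift_0, of X] linear_coefs_subst[OF lift_0, of Y]
  by (simp_all add: lift_twice coef_monom2)

context
  fixes \<xi> \<eta> :: cps
  assumes coords: "local_coords \<xi> \<eta>"
    and weights: "mu_act m q \<xi> = cst (unity_root m) * \<xi>" "mu_act m q \<eta> = cst (unity_root m ^ q) * \<eta>"
begin

lemma subst_coords_in_inv_ring_iff: "subst s \<xi> \<eta> \<in> inv_ring m q \<longleftrightarrow> s \<in> inv_ring m q"
  using subst_in_inv_ring_iff[OF m_pos m_pos _ _ injD[OF bij_is_inj[OF bij_subst[OF coords]]]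
    weights] coords
  by (simp add: local_coords_def)

lemma inv_ring_eq_image: "(\<lambda>s. subst s \<xi> \<eta>) ` inv_ring m q = inv_ring m q"
proof -
  have "a \<in> (\<lambda>s. subst s \<xi> \<eta>) ` inv_ring m q" if "a \<in> inv_ring m q" for a
    using surjD[OF bij_is_surj[OF bij_subst[OF coords]], of a] that subst_coords_in_inv_ring_iff
    by blast
  then show ?thesis using subst_coords_in_inv_ring_iff by blast
qed

lemma fixed_eq_image:
  "fixed = (\<lambda>s. subst s \<xi> \<eta>) ` {s \<in> inv_ring m q. subst s (subst \<xi> X Y) (subst \<eta> X Y) = subst s \<xi> \<eta>}"
proof -
  have subst_eq: "subst (subst s \<xi> \<eta>) X Y = subst s (subst \<xi> X Y) (subst \<eta> X Y)" for s
    using coords by (intro subst_subst lift_0) (simp_all add: local_coords_def)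
  have "fixed = {a \<in> (\<lambda>s. subst s \<xi> \<eta>) ` inv_ring m q. subst a X Y = a}"
    by (simp add: fixed_def inv_ring_eq_image)
  also have "\<dots> = (\<lambda>s. subst s \<xi> \<eta>) ` {s \<in> inv_ring m q. subst (subst s \<xi> \<eta>) X Y = subst s \<xi> \<eta>}"
    by blast
  finally show ?thesis using subst_eq by simp
qed

lemma fixed_in_coordinates:
  "cps_iso fixed {s \<in> inv_ring m q. subst s (subst \<xi> X Y) (subst \<eta> X Y) = subst s \<xi> \<eta>}"
proof -
  have \<xi>\<eta>: "coef \<xi> 0 0 = 0" "coef \<eta> 0 0 = 0" and jacobian: "cps_jacobian \<xi> \<eta> \<noteq> 0"
    using coords by (auto simp: local_coords_def)
  have "cps_subalgebra {s \<in> inv_ring m q. subst s (subst \<xi> X Y) (subst \<eta> X Y) = subst s \<xi> \<eta>}"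
    by (intro cps_subalgebra_equalizer cps_hom_subst inv_ring.cps_subalgebra_axioms)
      (simp_all add: coef_subst_0_0 lift_0 \<xi>\<eta>)
  then show ?thesis
    using cps_iso_sym[OF cps_iso_subst_image[OF \<xi>\<eta> jacobian]] unfolding fixed_eq_image by blast
qed

lemma diagonal_quotient:
  assumes eigen: "subst \<xi> X Y = cst \<alpha> * \<xi>" "subst \<eta> X Y = cst \<beta> * \<eta>" and \<alpha>\<beta>: "\<alpha>\<^sup>2 = \<omega>" "\<beta>\<^sup>2 = \<omega> ^ q"
    and nontrivial: "fixed \<noteq> inv_ring m q"
  shows "\<exists>(n, p) \<in> {(m, 2 * q), (2 * m, q), (2 * m, m + q)}. cps_iso fixed (inv_ring n p)"
proof -
  define G where "G = {s \<in> inv_ring m q. scale \<alpha> \<beta> s = s}"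
  have \<xi>\<eta>: "coef \<xi> 0 0 = 0" "coef \<eta> 0 0 = 0" using coords by (simp_all add: local_coords_def)
  have "subst s (subst \<xi> X Y) (subst \<eta> X Y) = subst s \<xi> \<eta> \<longleftrightarrow> scale \<alpha> \<beta> s = s" for s
    unfolding eigen subst_scale[OF \<xi>\<eta>, symmetric]
    by (rule inj_eq[OF bij_is_inj[OF bij_subst[OF coords]]])
  then have G: "{s \<in> inv_ring m q. subst s (subst \<xi> X Y) (subst \<eta> X Y) = subst s \<xi> \<eta>} = G"
    by (simp add: G_def)
  have "G \<noteq> inv_ring m q" using nontrivial inv_ring_eq_image unfolding fixed_eq_image G by auto
  moreover have "\<alpha> ^ (2 * m) = 1" "\<beta>\<^sup>2 = \<alpha> ^ (2 * q)" using \<alpha>\<beta> root by (simp_all add: power_mult)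
  ultimately have "G \<in> {{s \<in> inv_ring m q. \<forall>i j. coef s i j \<noteq> 0 \<longrightarrow> even j}, inv_ring (2 * m) q,
      inv_ring (2 * m) (m + q)}"
    using diagonal_fixed_ring[OF m_pos, of \<alpha> \<beta> q] unfolding G_def by blast
  then show ?thesis
    using fixed_in_coordinates[unfolded G] cps_iso_trans[OF _ inv_ring_even_part_iso[of m q]] by auto
qed

end

end

section \<open>Twisted swaps\<close>

definition twisted_swap :: "complex \<Rightarrow> cps \<Rightarrow> cps" where
  "twisted_swap \<omega> s = subst s yvar (monom2 \<omega> 1 0)"

lemma coef_twisted_swap: "coef (twisted_swap \<omega> s) i j = \<omega> ^ i * coef s j i"
  using coef_subst_swap[of s 1 \<omega>] by (simp add: twisted_swap_def)

lemma twisted_swap_monom2: "twisted_swap \<omega> (monom2 c i j) = monom2 (\<omega> ^ j * c) j i"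
  by (rule cps_eqI) (auto simp: coef_twisted_swap coef_monom2)

lemma twisted_swap_add: "twisted_swap \<omega> (s + t) = twisted_swap \<omega> s + twisted_swap \<omega> t"
  and twisted_swap_power: "twisted_swap \<omega> (s ^ n) = twisted_swap \<omega> s ^ n"
  by (simp_all add: twisted_swap_def subst_add subst_power)

definition twisted_symmetric_ring :: "nat \<Rightarrow> nat \<Rightarrow> complex \<Rightarrow> cps set" where
  "twisted_symmetric_ring m q \<omega> = {s \<in> inv_ring m q. twisted_swap \<omega> s = s}"

lemma twisted_symmetric_invariants:
  assumes q2: "[q\<^sup>2 = 1] (mod m)" and \<omega>: "\<omega> ^ m = 1" "\<omega> ^ q = \<omega>" and n: "n + q = 2 * m"
  shows "monom2 1 m 0 + monom2 1 0 m \<in> twisted_symmetric_ring m q \<omega>"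
    and "monom2 1 m m \<in> twisted_symmetric_ring m q \<omega>"
    and "monom2 1 n 1 + monom2 \<omega> 1 n \<in> twisted_symmetric_ring m q \<omega>"
proof -
  have "m dvd q * (n + q)" by (simp add: n)
  then have "[q * n + q\<^sup>2 = 0] (mod m)" by (simp add: cong_0_iff distrib_left power2_eq_square)
  then have "[q * n + 1 = 0] (mod m)"
    using cong_add[OF cong_refl q2, of "q * n"] cong_sym cong_trans by blast
  then have "m dvd 1 + q * n" by (simp add: cong_0_iff add.commute)
  then have "monom2 1 n 1 + monom2 \<omega> 1 n \<in> inv_ring m q"
    using n by (intro inv_ring.add_closed monom2_in_inv_ring) simp_all
  moreover have "\<omega> ^ n * \<omega> = 1"
  proof -
    have "\<omega> ^ n * \<omega> ^ q = (\<omega> ^ m) ^ 2" using n by (metis mult.commute power_add power_mult)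
    then show ?thesis using \<omega> by simp
  qed
  ultimately show "monom2 1 n 1 + monom2 \<omega> 1 n \<in> twisted_symmetric_ring m q \<omega>"
    by (simp add: twisted_symmetric_ring_def twisted_swap_add twisted_swap_monom2 add.commute)
  have "monom2 1 m 0 + monom2 1 0 m \<in> inv_ring m q" "monom2 1 m m \<in> inv_ring m q"
    by (intro inv_ring.add_closed monom2_in_inv_ring; simp)+
  then show "monom2 1 m 0 + monom2 1 0 m \<in> twisted_symmetric_ring m q \<omega>"
    "monom2 1 m m \<in> twisted_symmetric_ring m q \<omega>"
    using \<omega>(1)
    by (simp_all add: twisted_symmetric_ring_def twisted_swap_add twisted_swap_monom2 add.commute)
qed

lemma linear_coefs_of_root_of_twisted_symmetric:
  assumes Z: "Z ^ n \<in> twisted_symmetric_ring m q \<omega>" "0 < n" and m: "\<not> [q = 1] (mod m)" "0 < m"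
    and "\<omega> \<noteq> 0"
  shows "coef Z 1 0 = 0" "coef Z 0 1 = 0"
proof -
  obtain \<theta> where \<theta>: "mu_act m q Z = cst \<theta> * Z"
    using root_of_invariant[OF _ Z(2) m(2)] Z(1) by (auto simp: twisted_symmetric_ring_def)
  have "unity_root m \<noteq> unity_root m ^ q"
    using unity_root_power_eq_iff[OF m(2), of 1 q] m(1) by (simp add: cong_sym_eq)
  then have "coef Z 1 0 = 0 \<or> coef Z 0 1 = 0" using linear_coefs_of_weight[OF \<theta>] by auto
  moreover have "twisted_swap \<omega> Z ^ n = Z ^ n"
    using Z(1) by (simp add: twisted_symmetric_ring_def twisted_swap_power)
  then obtain \<theta>' where "twisted_swap \<omega> Z = cst \<theta>' * Z" using cps_power_eq_imp[OF _ Z(2)] by metis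
  then have "coef (twisted_swap \<omega> Z) 1 0 = \<theta>' * coef Z 1 0"
      "coef (twisted_swap \<omega> Z) 0 1 = \<theta>' * coef Z 0 1" by simp_all
  then have "\<omega> * coef Z 0 1 = \<theta>' * coef Z 1 0" "coef Z 1 0 = \<theta>' * coef Z 0 1"
    by (simp_all add: coef_twisted_swap)
  ultimately show "coef Z 1 0 = 0" "coef Z 0 1 = 0" using \<open>\<omega> \<noteq> 0\<close> by auto
qed

lemma twisted_invariants_critical_point:
  fixes x y \<omega> :: complex
  assumes m: "1 < m" "1 < n" "n + q = 2 * m" and "\<omega> \<noteq> 0"
    and no_reflection: "\<And>c. c ^ m = 1 \<Longrightarrow> c ^ (q + 1) \<noteq> \<omega>"
  defines "P \<equiv> x ^ n + of_nat n * \<omega> * x * y ^ (n - 1)"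
    and "Q \<equiv> of_nat n * x ^ (n - 1) * y + \<omega> * y ^ n"
  assumes j12: "x ^ (m - 1) * (x ^ m * y ^ (m - 1)) = y ^ (m - 1) * (x ^ (m - 1) * y ^ m)"
    and j13: "x ^ (m - 1) * P = y ^ (m - 1) * Q"
    and j23: "x ^ (m - 1) * y ^ m * P = x ^ m * y ^ (m - 1) * Q"
  shows "x = 0 \<and> y = 0"
proof -
  have powers: "x ^ m = x * x ^ (m - 1)" "y ^ m = y * y ^ (m - 1)" "x ^ n = x * x ^ (n - 1)"
      "y ^ n = y * y ^ (n - 1)"
    using m by (simp_all flip: power_Suc)
  have axis: "x = 0 \<longleftrightarrow> y = 0" using j13 m(1,2) \<open>\<omega> \<noteq> 0\<close> by (auto simp: P_def Q_def zero_power)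
  have False if nonzero: "x \<noteq> 0" "y \<noteq> 0"
  proof -
    have "x ^ m = y ^ m" using j12 nonzero by simp
    then have root: "(y / x) ^ m = 1" using nonzero by (simp add: power_divide)
    have "(x ^ (m - 1) * y ^ (m - 1)) * (y * P) = (x ^ (m - 1) * y ^ (m - 1)) * (x * Q)"
      using j23 unfolding powers(1,2) by (simp add: mult_ac)
    then have "y * P = x * Q" using nonzero by simp
    then have "(1 - of_nat n) * (x * y * x ^ (n - 1)) = (1 - of_nat n) * (x * y * (\<omega> * y ^ (n - 1)))"
      unfolding P_def Q_def powers(3,4) by (simp add: algebra_simps)
    moreover have "(1 :: complex) - of_nat n \<noteq> 0" using m(2)
      by (metis of_nat_1 of_nat_eq_iff right_minus_eq less_irrefl)
    ultimately have "x ^ (n - 1) = \<omega> * y ^ (n - 1)" using nonzero by simp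
    then have "(y / x) ^ (n - 1) * \<omega> = 1" using nonzero \<open>\<omega> \<noteq> 0\<close>
      by (simp add: power_divide field_simps)
    moreover have "(y / x) ^ (n - 1) * (y / x) ^ (q + 1) = ((y / x) ^ m)\<^sup>2"
      using m by (simp flip: power_add power_mult add: mult.commute)
    ultimately have "(y / x) ^ (q + 1) = \<omega>" using root
      by (metis mult.assoc mult.commute mult_1 power_one)
    then show False using no_reflection[OF root] by blast
  qed
  then show ?thesis using axis by blast
qed

lemma ev_cps_jacobian:
  "\<forall>\<^sub>0z. ev (cps_jacobian s t) z = ev (dx s) z * ev (dy t) z - ev (dy s) z * ev (dx t) z"
  using ev_diff[of "dx s * dy t" "dy s * dx t"] ev_mult[of "dx s" "dy t"] ev_mult[of "dy s" "dx t"]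
  by eventually_elim (simp add: cps_jacobian_def)

lemma twisted_invariants_jacobians_isolated:
  assumes m: "1 < m" "1 < n" "n + q = 2 * m" and \<omega>: "\<omega> \<noteq> 0"
    and no_reflection: "\<And>c. c ^ m = 1 \<Longrightarrow> c ^ (q + 1) \<noteq> \<omega>"
  defines "r1 \<equiv> monom2 1 m 0 + monom2 1 0 m" and "r2 \<equiv> monom2 1 m m"
    and "r3 \<equiv> monom2 1 n 1 + monom2 \<omega> 1 n"
  shows "\<forall>\<^sub>0z. ev (cps_jacobian r1 r2) z = 0 \<longrightarrow> ev (cps_jacobian r1 r3) z = 0 \<longrightarrow>
    ev (cps_jacobian r2 r3) z = 0 \<longrightarrow> z = (0, 0)"
proof -
  have r1: "dx r1 = monom2 (of_nat m) (m - 1) 0" "dy r1 = monom2 (of_nat m) 0 (m - 1)"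
    by (simp_all add: r1_def dx_add dy_add dx_monom2 dy_monom2 monom2_eq_0_iff)
  have r2: "dx r2 = monom2 (of_nat m) (m - 1) m" "dy r2 = monom2 (of_nat m) m (m - 1)"
    by (simp_all add: r2_def dx_monom2 dy_monom2)
  have r3: "dx r3 = monom2 (of_nat n) (n - 1) 1 + monom2 \<omega> 0 n"
      "dy r3 = monom2 1 n 0 + monom2 (of_nat n * \<omega>) 1 (n - 1)"
    by (simp_all add: r3_def dx_add dy_add dx_monom2 dy_monom2)
  have m0: "complex_of_nat m \<noteq> 0" using m(1) by simp
  show ?thesis
    using ev_cps_jacobian[of r1 r2] ev_cps_jacobian[of r1 r3] ev_cps_jacobian[of r2 r3]
      ev_add[of "monom2 (of_nat n) (n - 1) 1" "monom2 \<omega> 0 n"]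
      ev_add[of "monom2 1 n 0" "monom2 (of_nat n * \<omega>) 1 (n - 1)"]
  proof eventually_elim
    case (elim z)
    let ?x = "fst z" and ?y = "snd z"
    let ?P = "?x ^ n + of_nat n * \<omega> * ?x * ?y ^ (n - 1)"
      and ?Q = "of_nat n * ?x ^ (n - 1) * ?y + \<omega> * ?y ^ n"
    have dr3: "ev (dx r3) z = ?Q" "ev (dy r3) z = ?P" using elim(4,5) by (simp_all add: r3 ev_monom2)
    show ?case
    proof (intro impI)
      assume zero: "ev (cps_jacobian r1 r2) z = 0" "ev (cps_jacobian r1 r3) z = 0"
          "ev (cps_jacobian r2 r3) z = 0"
      have "of_nat m * of_nat m * (?x ^ (m - 1) * (?x ^ m * ?y ^ (m - 1)) -
          ?y ^ (m - 1) * (?x ^ (m - 1) * ?y ^ m)) = 0"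
        "of_nat m * (?x ^ (m - 1) * ?P - ?y ^ (m - 1) * ?Q) = 0"
        "of_nat m * (?x ^ (m - 1) * ?y ^ m * ?P - ?x ^ m * ?y ^ (m - 1) * ?Q) = 0"
        using zero elim(1-3) unfolding dr3 r1 r2 ev_monom2 by (simp_all add: algebra_simps)
      then have "?x = 0 \<and> ?y = 0"
        using m0 by (intro twisted_invariants_critical_point[OF m \<omega> no_reflection]) simp_all
      then show "z = (0, 0)" by (simp add: prod_eq_iff)
    qed
  qed
qed

text \<open>If the twisted swaps contain no reflection, the quotient is not cyclic: its uniformisation would
  consist of semi-invariants \<open>X\<close>, \<open>Y\<close> of a non-abelian group, whose linear parts vanish, whereas the
  Jacobian of \<open>(X, Y)\<close> divides that of any two invariants and so has no zero off the origin.\<close>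

theorem twisted_symmetric_ring_not_cyclic:
  assumes q: "1 < q" "q < m" "[q\<^sup>2 = 1] (mod m)" and \<omega>: "\<omega> ^ m = 1" "\<omega> ^ q = \<omega>"
    and no_reflection: "\<And>c. c ^ m = 1 \<Longrightarrow> c ^ (q + 1) \<noteq> \<omega>" and n: "0 < n" "coprime p n"
  shows "\<not> cps_iso (inv_ring n p) (twisted_symmetric_ring m q \<omega>)"
proof
  let ?G = "twisted_symmetric_ring m q \<omega>"
  assume iso: "cps_iso (inv_ring n p) ?G"
  have m: "0 < m" "1 < m" "\<not> [q = 1] (mod m)" and \<omega>0: "\<omega> \<noteq> 0"
    using q \<omega>(1) by (auto simp: cong_def zero_power)
  define k where "k = 2 * m - q"
  have k: "1 < k" "k + q = 2 * m" using q by (auto simp: k_def)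
  define r1 r2 r3 where "r1 = monom2 1 m 0 + monom2 1 0 m" and "r2 = monom2 1 m m"
    and "r3 = monom2 1 k 1 + monom2 \<omega> 1 k"
  have r: "r1 \<in> ?G" "r2 \<in> ?G" "r3 \<in> ?G"
    using twisted_symmetric_invariants[OF q(3) \<omega> k(2)] by (simp_all add: r1_def r2_def r3_def)
  have common: "isolated_common_zero r1 r2"
    using ev_add[of "monom2 1 m 0" "monom2 1 0 m"] unfolding isolated_common_zero_def r1_def r2_def
    by eventually_elim (use m in \<open>auto simp: ev_monom2 prod_eq_iff zero_power\<close>)
  have "coef r1 0 0 = 0" "coef r2 0 0 = 0" using m by (simp_all add: r1_def r2_def)
  then obtain X Y where XY: "coef X 0 0 = 0" "coef Y 0 0 = 0" "?G = (\<lambda>a. subst a X Y) ` inv_ring n p"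
    by (rule inv_ring_uniformisation[OF iso n r(1) _ r(2) _ common])
  have "X ^ n \<in> ?G" "Y ^ n \<in> ?G"
    using imageI[OF monom2_in_inv_ring, of n n p 0 "\<lambda>a. subst a X Y" 1]
      imageI[OF monom2_in_inv_ring, of n 0 p n "\<lambda>a. subst a X Y" 1]
    by (simp_all add: subst_monom2[OF XY(1,2)] flip: XY(3))
  note linear = this[THEN linear_coefs_of_root_of_twisted_symmetric(1)[OF _ n(1) m(3,1) \<omega>0]]
    this[THEN linear_coefs_of_root_of_twisted_symmetric(2)[OF _ n(1) m(3,1) \<omega>0]]
  let ?J = "cps_jacobian X Y"
  have vanishing: "\<forall>\<^sub>0z. ev ?J z = 0 \<longrightarrow> ev (cps_jacobian s t) z = 0" if "s \<in> ?G" "t \<in> ?G" for s t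
  proof -
    obtain s' t' where "s = subst s' X Y" "t = subst t' X Y" using \<open>s \<in> ?G\<close> \<open>t \<in> ?G\<close> unfolding XY(3)
      by blast
    then have "cps_jacobian s t = subst (cps_jacobian s' t') X Y * ?J"
      by (simp add: cps_jacobian_subst[OF XY(1,2)])
    then show ?thesis using ev_mult[of "subst (cps_jacobian s' t') X Y" ?J]
      by (auto elim: eventually_mono)
  qed
  have "\<forall>\<^sub>0z. ev (cps_jacobian r1 r2) z = 0 \<longrightarrow> ev (cps_jacobian r1 r3) z = 0 \<longrightarrow>
      ev (cps_jacobian r2 r3) z = 0 \<longrightarrow> z = (0, 0)"
    unfolding r1_def r2_def r3_def
    by (rule twisted_invariants_jacobians_isolated[OF m(2) k \<omega>0 no_reflection])
  with vanishing[OF r(1,2)] vanishing[OF r(1,3)] vanishing[OF r(2,3)]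
  have "\<forall>\<^sub>0z. ev ?J z = 0 \<longrightarrow> z = (0, 0)" by eventually_elim blast
  moreover have "coef ?J 0 0 = 0" using linear by (simp add: coef_cps_jacobian_0_0)
  ultimately show False using zero_not_isolated by blast
qed

section \<open>Quotients by lifted involutions\<close>

context lifted_involution
begin

text \<open>Averaging \<open>p x + r y\<close> over the involution gives an eigenfunction for \<open>\<alpha>\<close>.\<close>

definition eigenform :: "complex \<Rightarrow> complex \<Rightarrow> complex \<Rightarrow> cps" where
  "eigenform \<alpha> p r = cst \<alpha> * (cst p * xvar + cst r * yvar) + (cst p * X + cst r * Y)"

lemma coef_eigenform_0_0: "coef (eigenform \<alpha> p r) 0 0 = 0"
  using lift_0 by (simp add: eigenform_def)

lemma linear_coefs_eigenform:
  "coef (eigenform \<alpha> p r) 1 0 = \<alpha> * p + (p * coef X 1 0 + r * coef Y 1 0)"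
  "coef (eigenform \<alpha> p r) 0 1 = \<alpha> * r + (p * coef X 0 1 + r * coef Y 0 1)"
  by (simp_all add: eigenform_def coef_monom2)

lemma subst_eigenform:
  assumes "p * \<omega> = p * \<alpha>\<^sup>2" "r * \<omega> ^ q = r * \<alpha>\<^sup>2"
  shows "subst (eigenform \<alpha> p r) X Y = cst \<alpha> * eigenform \<alpha> p r"
proof -
  have squared: "cst p * monom2 \<omega> 1 0 = cst \<alpha> * (cst \<alpha> * (cst p * xvar))"
      "cst r * monom2 (\<omega> ^ q) 0 1 = cst \<alpha> * (cst \<alpha> * (cst r * yvar))"
    using assms by (auto simp: monom2_mult power2_eq_square mult_ac)
  have "subst (eigenform \<alpha> p r) X Y =
      cst \<alpha> * (cst p * X + cst r * Y) +
      (cst \<alpha> * (cst \<alpha> * (cst p * xvar)) + cst \<alpha> * (cst \<alpha> * (cst r * yvar)))"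
    by (simp add: eigenform_def subst_add subst_mult subst_cst subst_xvar subst_yvar lift_twice
      lift_0 squared)
  then show ?thesis by (simp add: eigenform_def algebra_simps)
qed

lemma mu_act_eigenform:
  assumes "mu_act m q X = cst \<theta> * X" "mu_act m q Y = cst \<theta>' * Y"
    and "p * unity_root m = p * \<kappa>" "r * unity_root m ^ q = r * \<kappa>" "p * \<theta> = p * \<kappa>" "r * \<theta>' = r * \<kappa>"
  shows "mu_act m q (eigenform \<alpha> p r) = cst \<kappa> * eigenform \<alpha> p r"
proof -
  have weight: "cst p * (cst (unity_root m) * xvar) = cst \<kappa> * (cst p * xvar)"
    "cst r * (cst (unity_root m ^ q) * yvar) = cst \<kappa> * (cst r * yvar)"
    "cst p * (cst \<theta> * X) = cst \<kappa> * (cst p * X)" "cst r * (cst \<theta>' * Y) = cst \<kappa> * (cst r * Y)"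
    using assms(3-6) by auto
  have "mu_act m q (eigenform \<alpha> p r) = cst \<alpha> * (cst \<kappa> * (cst p * xvar) + cst \<kappa> * (cst r * yvar)) +
      (cst \<kappa> * (cst p * X) + cst \<kappa> * (cst r * Y))"
    by (simp add: eigenform_def mu_act_add mu_act_mult mu_act_monom2 assms(1,2) weight)
  then show ?thesis by (simp add: eigenform_def algebra_simps)
qed

lemma quotient_of_homothety_case:
  assumes "q = 1" and nontrivial: "fixed \<noteq> inv_ring m q"
  shows "\<exists>(n, p) \<in> {(m, 2 * q), (2 * m, q), (2 * m, m + q)}. cps_iso fixed (inv_ring n p)"
proof -
  let ?a = "coef X 1 0" and ?b = "coef X 0 1" and ?c = "coef Y 1 0" and ?d = "coef Y 0 1"
  note square = linear_part_squared[unfolded \<open>q = 1\<close> power_one_right]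
  obtain \<theta> \<theta>' where \<theta>: "mu_act m q X = cst \<theta> * X" "mu_act m q Y = cst \<theta>' * Y" by (rule weights)
  have "?a \<noteq> 0 \<or> ?b \<noteq> 0" "?c \<noteq> 0 \<or> ?d \<noteq> 0" using square(1,4) root_nonzero by auto
  then have \<theta>_eq: "\<theta> = unity_root m" "\<theta>' = unity_root m"
    using linear_coefs_of_weight[OF \<theta>(1)] linear_coefs_of_weight[OF \<theta>(2)] \<open>q = 1\<close> by auto
  obtain \<alpha> p r \<alpha>' p' r' where
    \<alpha>: "\<alpha>\<^sup>2 = \<omega>" "p * ?a + r * ?c = \<alpha> * p" "p * ?b + r * ?d = \<alpha> * r" and
    \<alpha>': "\<alpha>'\<^sup>2 = \<omega>" "p' * ?a + r' * ?c = \<alpha>' * p'" "p' * ?b + r' * ?d = \<alpha>' * r'" and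
    independent: "p * r' - r * p' \<noteq> 0"
    by (rule square_root_of_scalar_matrix_diagonalizable[OF square root_nonzero])
  let ?\<xi> = "eigenform \<alpha> p r" and ?\<eta> = "eigenform \<alpha>' p' r'"
  have weight: "mu_act m q (eigenform \<alpha> p r) = cst (unity_root m) * eigenform \<alpha> p r" for \<alpha> p r
    using \<theta>_eq \<open>q = 1\<close> by (intro mu_act_eigenform[OF \<theta>]) auto
  have "coef (cps_jacobian ?\<xi> ?\<eta>) 0 0 = 4 * \<alpha> * \<alpha>' * (p * r' - r * p')"
    unfolding coef_cps_jacobian_0_0 linear_coefs_eigenform \<alpha>(2,3) \<alpha>'(2,3) by (simp add: algebra_simps)
  moreover have "\<alpha> \<noteq> 0" "\<alpha>' \<noteq> 0" using \<alpha>(1) \<alpha>'(1) root_nonzero by auto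
  ultimately have "local_coords ?\<xi> ?\<eta>"
    using independent by (simp add: local_coords_def coef_eigenform_0_0)
  moreover have "subst ?\<xi> X Y = cst \<alpha> * ?\<xi>" "subst ?\<eta> X Y = cst \<alpha>' * ?\<eta>"
    using \<alpha>(1) \<alpha>'(1) \<open>q = 1\<close> by (simp_all add: subst_eigenform)
  ultimately show ?thesis
    using \<alpha>(1) \<alpha>'(1) weight nontrivial \<open>q = 1\<close> by (intro diagonal_quotient[of ?\<xi> ?\<eta> \<alpha> \<alpha>']) simp_all
qed

context
  assumes q1: "1 < q"
begin

lemma distinct_weights: "unity_root m \<noteq> unity_root m ^ q"
  using unity_root_power_eq_iff[OF m_pos, of 1 q] q q1 by (simp add: cong_def)

lemma quotient_of_axes_preserving_case:
  assumes a: "coef X 1 0 \<noteq> 0" and nontrivial: "fixed \<noteq> inv_ring m q"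
  shows "\<exists>(n, p) \<in> {(m, 2 * q), (2 * m, q), (2 * m, m + q)}. cps_iso fixed (inv_ring n p)"
proof -
  let ?a = "coef X 1 0" and ?d = "coef Y 0 1"
  obtain \<theta> \<theta>' where \<theta>: "mu_act m q X = cst \<theta> * X" "mu_act m q Y = cst \<theta>' * Y" by (rule weights)
  have \<theta>_eq: "\<theta> = unity_root m" and b: "coef X 0 1 = 0"
    using linear_coefs_of_weight[OF \<theta>(1)] a distinct_weights by auto
  then have squares: "?a\<^sup>2 = \<omega>" "?d\<^sup>2 = \<omega> ^ q" using linear_part_squared
    by (simp_all add: power2_eq_square)
  then have "?d \<noteq> 0" using root_nonzero by auto
  then have \<theta>'_eq: "\<theta>' = unity_root m ^ q" and c: "coef Y 1 0 = 0"
    using linear_coefs_of_weight[OF \<theta>(2)] distinct_weights by auto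
  let ?\<xi> = "eigenform ?a 1 0" and ?\<eta> = "eigenform ?d 0 1"
  have "local_coords ?\<xi> ?\<eta>"
    using a b c \<open>?d \<noteq> 0\<close>
    by (simp add: local_coords_def coef_eigenform_0_0 coef_cps_jacobian_0_0 linear_coefs_eigenform)
  moreover have "mu_act m q ?\<xi> = cst (unity_root m) * ?\<xi>"
      "mu_act m q ?\<eta> = cst (unity_root m ^ q) * ?\<eta>"
    by (rule mu_act_eigenform[OF \<theta>]; simp add: \<theta>_eq \<theta>'_eq)+
  moreover have "subst ?\<xi> X Y = cst ?a * ?\<xi>" "subst ?\<eta> X Y = cst ?d * ?\<eta>"
    by (simp_all add: subst_eigenform squares)
  ultimately show ?thesis using squares nontrivial by (rule diagonal_quotient)
qed

context
  assumes swap: "coef X 1 0 = 0"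
begin

lemma swap_linear_coef: "coef X 0 1 \<noteq> 0"
  and swap_root: "\<omega> ^ q = \<omega>"
  and swap_weights: "mu_act m q X = cst (unity_root m ^ q) * X"
      "mu_act m q Y = cst (unity_root m) * Y"
proof -
  obtain \<theta> \<theta>' where \<theta>: "mu_act m q X = cst \<theta> * X" "mu_act m q Y = cst \<theta>' * Y" by (rule weights)
  have bc: "coef X 0 1 * coef Y 1 0 = \<omega>" using linear_part_squared(1) swap by simp
  then show b: "coef X 0 1 \<noteq> 0" using root_nonzero by auto
  have c: "coef Y 1 0 \<noteq> 0" using bc root_nonzero by auto
  show "mu_act m q X = cst (unity_root m ^ q) * X" "mu_act m q Y = cst (unity_root m) * Y"
    using linear_coefs_of_weight[OF \<theta>(1)] linear_coefs_of_weight[OF \<theta>(2)] b c \<theta> by simp_all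
  have "coef Y 0 1 = 0" using linear_part_squared(2) swap b by simp
  then show "\<omega> ^ q = \<omega>" using linear_part_squared(4) bc by (simp add: mult.commute)
qed

lemma swap_square_cong_1: "[q\<^sup>2 = 1] (mod m)"
proof -
  define e where "e = (m - 1) * q"
  have e: "e + q = m * q" using m_pos by (cases m) (auto simp: e_def)
  let ?z = "unity_root m"
  have "X ^ e * Y \<in> inv_ring m q"
    using lift_closed[OF monom2_in_inv_ring, of e 1 1] by (simp add: e subst_monom2 lift_0)
  then have "(cst (?z ^ q) * X) ^ e * (cst ?z * Y) = X ^ e * Y"
    by (simp add: inv_ring_iff_mu_act m_pos mu_act_mult mu_act_power swap_weights)
  then have "cst (?z ^ (q * e + 1)) * (X ^ e * Y) = X ^ e * Y"
    by (simp add: power_mult_distrib cst_power power_add power_mult mult.assoc mult.left_commute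
      flip: cst_mult_cst)
  moreover have "coef Y 1 0 \<noteq> 0" using linear_part_squared(1) swap root_nonzero by auto
  then have "X ^ e * Y \<noteq> 0" using swap_linear_coef by auto
  ultimately have "cst (?z ^ (q * e + 1)) = 1" by auto
  from arg_cong[OF this, of "\<lambda>s. coef s 0 0"] have "?z ^ (q * e + 1) = 1" by simp
  then have "m dvd q * e + 1" by (simp only: unity_root_power_eq_1_iff[OF m_pos])
  moreover have "q * e + q\<^sup>2 = m * (q * q)" using e
    by (metis distrib_left mult.left_commute power2_eq_square)
  ultimately have "[q * e + q\<^sup>2 = q * e + 1] (mod m)"
    by (metis cong_0_iff cong_sym cong_trans dvd_triv_left)
  then show ?thesis by (simp only: cong_add_lcancel_nat)
qed

lemma fixed_iso_twisted_symmetric_ring: "cps_iso fixed (twisted_symmetric_ring m q \<omega>)"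
proof -
  have coords: "local_coords xvar X"
    using swap_linear_coef lift_0 by (simp add: local_coords_def coef_cps_jacobian_0_0 coef_monom2)
  have "subst s (subst xvar X Y) (subst X X Y) = subst (twisted_swap \<omega> s) xvar X" for s
    by (simp add: twisted_swap_def subst_subst subst_xvar subst_yvar subst_monom2 lift_twice lift_0
      monom2_mult)
  then have "subst s (subst xvar X Y) (subst X X Y) = subst s xvar X \<longleftrightarrow> twisted_swap \<omega> s = s" for s
    using inj_eq[OF bij_is_inj[OF bij_subst[OF coords]]] by metis
  then show ?thesis
    using fixed_in_coordinates[OF coords _ swap_weights(1)]
    by (simp add: twisted_symmetric_ring_def mu_act_monom2)
qed

lemma fixed_iso_symmetric_ring:
  assumes c: "c ^ m = 1" "c ^ (q + 1) = \<omega>"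
  shows "cps_iso fixed {s \<in> inv_ring m q. flip s = s}"
proof -
  have "c \<noteq> 0" using c(1) m_pos by (auto simp: zero_power)
  define \<eta> where "\<eta> = cst (inverse c) * X"
  have \<eta>: "coef \<eta> 0 0 = 0" "mu_act m q \<eta> = cst (unity_root m ^ q) * \<eta>"
    by (simp_all add: \<eta>_def lift_0 mu_act_mult mu_act_monom2 swap_weights(1) mult_ac)
  have coords: "local_coords xvar \<eta>"
    using swap_linear_coef \<eta>(1) \<open>c \<noteq> 0\<close>
    by (simp add: local_coords_def coef_cps_jacobian_0_0 coef_monom2 \<eta>_def)
  have "inverse c * \<omega> = c ^ q" using \<open>c \<noteq> 0\<close> by (simp add: power_add field_simps flip: c(2))
  then have lift: "subst xvar X Y = cst c * \<eta>" "subst \<eta> X Y = cst (c ^ q) * xvar"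
    using \<open>c \<noteq> 0\<close>
    by (simp_all add: \<eta>_def subst_mult subst_cst subst_xvar lift_0 lift_twice cst_mult_cst
      monom2_mult)
  have "subst s (subst xvar X Y) (subst \<eta> X Y) = subst (flip s) xvar \<eta>" if "s \<in> inv_ring m q" for s
  proof -
    have "c ^ i * (c ^ q) ^ j = 1" if "m dvd i + q * j" for i j
    proof -
      obtain k where "i + q * j = m * k" using \<open>m dvd i + q * j\<close> by (rule dvdE)
      then have "c ^ i * (c ^ q) ^ j = (c ^ m) ^ k" by (simp flip: power_mult power_add)
      then show ?thesis using c(1) by simp
    qed
    then have "scale c (c ^ q) s = s" using that by (simp add: scale_eq_iff inv_ring_def)
    then have "subst s (subst xvar X Y) (subst \<eta> X Y) = subst s \<eta> xvar"
      using subst_scale[OF \<eta>(1), of xvar c "c ^ q" s] by (simp add: lift)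
    then show ?thesis by (simp add: flip_def subst_subst subst_xvar subst_yvar \<eta>(1))
  qed
  then have "{s \<in> inv_ring m q. subst s (subst xvar X Y) (subst \<eta> X Y) = subst s xvar \<eta>} =
      {s \<in> inv_ring m q. flip s = s}"
    using inj_eq[OF bij_is_inj[OF bij_subst[OF coords]]] by fastforce
  then show ?thesis using fixed_in_coordinates[OF coords _ \<eta>(2)] by (simp add: mu_act_monom2)
qed

lemma quotient_of_swap_case:
  assumes "cps_iso fixed (inv_ring n p)" "0 < n" "coprime p n"
  shows "cps_iso fixed (inv_ring (m div gcd (q + 1) m) ((q + 1) div gcd (q + 1) m))"
proof -
  have "\<not> (\<forall>c. c ^ m = 1 \<longrightarrow> c ^ (q + 1) \<noteq> \<omega>)"
    using twisted_symmetric_ring_not_cyclic[OF q1 q(2) swap_square_cong_1 root swap_root _ assms(2,3)]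
      cps_iso_trans[OF cps_iso_sym[OF assms(1)] fixed_iso_twisted_symmetric_ring] by blast
  then show ?thesis
    using fixed_iso_symmetric_ring symmetric_ring_iso[OF m_pos swap_square_cong_1] cps_iso_trans
    by blast
qed

end

end

theorem cyclic_quotient_cases:
  assumes "fixed \<noteq> inv_ring m q" "cps_iso fixed (inv_ring n p)" "0 < n" "coprime p n"
  shows "(\<exists>(n, p) \<in> {(m, 2 * q), (2 * m, q), (2 * m, m + q)}. cps_iso fixed (inv_ring n p)) \<or>
    [q\<^sup>2 = 1] (mod m) \<and> cps_iso fixed (inv_ring (m div gcd (q + 1) m) ((q + 1) div gcd (q + 1) m))"
proof -
  consider "q = 1" | "1 < q" "coef X 1 0 \<noteq> 0" | "1 < q" "coef X 1 0 = 0" using q(1) by linarith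
  then show ?thesis
  proof cases
    case 1
    then show ?thesis using quotient_of_homothety_case assms(1) by blast
  next
    case 2
    then show ?thesis using quotient_of_axes_preserving_case assms(1) by blast
  next
    case 3
    then show ?thesis using quotient_of_swap_case[OF 3 assms(2-4)] swap_square_cong_1[OF 3] by blast
  qed
qed

lemma smooth_quotient_imp:
  assumes "fixed \<noteq> inv_ring m q" and smooth: "cps_iso fixed UNIV"
  shows "q = m - 1"
proof -
  let ?d = "gcd (q + 1) m"
  have dvd: "n dvd p" if "cps_iso fixed (inv_ring n p)" "0 < n" for n p
    using inv_ring_iso_UNIV_imp_dvd[OF cps_iso_trans[OF cps_iso_sym[OF that(1)] smooth] that(2)] .
  have "0 < m div ?d" using m_pos by (simp add: div_greater_zero_iff)
  then have "2 * m dvd q \<or> 2 * m dvd m + q \<or> m dvd 2 * q \<or> m dvd q + 1"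
    using cyclic_quotient_cases[of 1 1] assms m_pos by (auto dest!: dvd)
  moreover have "m \<le> 2" if "m dvd 2 * q"
  proof -
    have "m dvd 2" using that q(3) by (simp add: coprime_commute coprime_dvd_mult_left_iff)
    then show ?thesis by (rule dvd_imp_le) simp
  qed
  ultimately show ?thesis using q(1,2) by (elim disjE) (auto dest: dvd_imp_le)
qed

lemma quotient_classification:
  assumes nontrivial: "fixed \<noteq> inv_ring m q"
    and "(\<exists>n p. 0 < p \<and> p < n \<and> coprime p n \<and> cps_iso fixed (inv_ring n p)) \<or> cps_iso fixed UNIV"
  shows "cps_iso fixed UNIV \<and> q = m - 1 \<or> cps_iso fixed (inv_ring (2 * m) q) \<or>
    cps_iso fixed (inv_ring (2 * m) (m + q)) \<or> cps_iso fixed (inv_ring m (2 * q)) \<or>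
    cps_iso fixed (inv_ring (m div gcd (q + 1) m) ((q + 1) div gcd (q + 1) m)) \<and>
    [q ^ 2 = 1] (mod m) \<and> q \<noteq> m - 1"
proof -
  obtain n p where "cps_iso fixed (inv_ring n p)" "0 < n" "coprime p n"
    using assms(2) by (metis coprime_1_right inv_ring_1 zero_less_one less_trans)
  note cases = cyclic_quotient_cases[OF nontrivial this]
  show ?thesis
  proof (cases "q = m - 1")
    case True
    then have "m div gcd (q + 1) m = 1" using m_pos by simp
    then show ?thesis using cases True by auto
  next
    case False
    then show ?thesis using cases by blast
  qed
qed

end

section \<open>Germs of cyclic quotient singularities\<close>

lemma cqs_ring_eq: "cqs_ring m q = coef ` inv_ring m q"
proof
  show "cqs_ring m q \<subseteq> coef ` inv_ring m q"
  proof
    fix a assume "a \<in> cqs_ring m q"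
    then have "coef (Cps a) = a" "Cps a \<in> inv_ring m q" by (simp_all add: cqs_ring_def inv_ring_def)
    then show "a \<in> coef ` inv_ring m q" by (metis imageI)
  qed
qed (auto simp: cqs_ring_def inv_ring_def)

lemma smooth_ring_eq: "smooth_ring = coef ` UNIV"
  using cqs_ring_eq[of 1 1] by (simp add: smooth_ring_def cqs_ring_def)

lemma ps2_operations_coef:
  "ps2_add (coef a) (coef b) = coef (a + b)" "ps2_smult c (coef a) = coef (cst c * a)"
  "ps2_one = coef 1" "ps2_mult (coef a) (coef b) = coef (a * b)"
  by (simp_all add: ps2_add_def ps2_smult_def ps2_one_def fun_eq_iff coef_1) (simp add: coef_times)

lemma alg_hom_coefE:
  assumes "cps_subalgebra A" and f: "alg_hom (coef ` A) (coef ` B) f"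
  obtains \<psi> where "cps_hom A \<psi>" "\<And>a. a \<in> A \<Longrightarrow> \<psi> a \<in> B" "\<And>a. a \<in> A \<Longrightarrow> coef (\<psi> a) = f (coef a)"
proof -
  interpret cps_subalgebra A by (rule assms(1))
  define \<psi> where "\<psi> a = Cps (f (coef a))" for a
  have "f (coef a) \<in> coef ` B" if "a \<in> A" for a using f that by (simp add: alg_hom_def)
  then have \<psi>: "\<psi> a \<in> B \<and> coef (\<psi> a) = f (coef a)" if "a \<in> A" for a
    using that unfolding \<psi>_def by (metis coef_inverse imageE)
  have "cps_hom A \<psi>"
  proof unfold_locales
    fix a b c assume ab: "a \<in> A" "b \<in> A"
    show "\<psi> (a + b) = \<psi> a + \<psi> b" "\<psi> (a * b) = \<psi> a * \<psi> b"
      using f ab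
      by (simp_all add: \<psi> add_closed mult_closed alg_hom_def flip: coef_inject ps2_operations_coef)
    show "\<psi> (cst c * a) = cst c * \<psi> a"
      using f ab by (simp add: \<psi> scalar_closed alg_hom_def flip: coef_inject ps2_operations_coef(2))
  qed (use f in \<open>simp add: \<psi> one_closed alg_hom_def flip: coef_inject ps2_operations_coef(3)\<close>)
  then show ?thesis using that \<psi> by blast
qed

lemma alg_iso_coef_iff:
  assumes A: "cps_subalgebra A"
  shows "alg_iso (coef ` A) (coef ` B) \<longleftrightarrow> cps_iso A B"
proof
  assume "alg_iso (coef ` A) (coef ` B)"
  then obtain f where f: "alg_hom (coef ` A) (coef ` B) f" "bij_betw f (coef ` A) (coef ` B)"
    by (auto simp: alg_iso_def)
  obtain \<psi> where \<psi>: "cps_hom A \<psi>" "\<And>a. a \<in> A \<Longrightarrow> \<psi> a \<in> B" "\<And>a. a \<in> A \<Longrightarrow> coef (\<psi> a) = f (coef a)"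
    by (rule alg_hom_coefE[OF A f(1)], rule that)
  have coef: "bij_betw coef S (coef ` S)" for S by (simp add: bij_betw_def coef_inject inj_on_def)
  have "bij_betw (f \<circ> coef) A (coef ` B)" by (rule bij_betw_trans[OF coef f(2)])
  then have "bij_betw (coef \<circ> \<psi>) A (coef ` B)" using \<psi>(3) by (subst bij_betw_cong) auto
  then have "bij_betw \<psi> A B" using \<psi>(2) by (subst bij_betw_comp_iff2[OF coef]) auto
  then show "cps_iso A B" using \<psi>(1) by (auto simp: cps_iso_def)
next
  assume "cps_iso A B"
  then obtain \<psi> where "cps_hom A \<psi>" and bij: "bij_betw \<psi> A B" by (auto simp: cps_iso_def)
  interpret \<psi>: cps_hom A \<psi> by fact
  define f where "f = coef \<circ> \<psi> \<circ> Cps"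
  have f: "f (coef a) = coef (\<psi> a)" for a by (simp add: f_def coef_inverse)
  have "alg_hom (coef ` A) (coef ` B) f"
    using bij_betwE[OF bij]
    by (auto simp: alg_hom_def ps2_operations_coef f \<psi>.map_add \<psi>.map_mult \<psi>.map_scalar \<psi>.map_one)
  moreover have "bij_betw f (coef ` A) (coef ` B)"
    using bij by (auto simp: bij_betw_def inj_on_def f coef_inject image_image)
  ultimately show "alg_iso (coef ` A) (coef ` B)" by (auto simp: alg_iso_def)
qed

lemma is_involution_cqs_ringE:
  assumes q: "0 < q" "q < m" "coprime q m" and \<tau>: "is_involution (cqs_ring m q) \<tau>"
  obtains X Y \<omega> where "lifted_involution m q X Y \<omega>" "lifted_involution.fixed m q X Y \<noteq> inv_ring m q"
    "fixed_ring (cqs_ring m q) \<tau> = coef ` lifted_involution.fixed m q X Y"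
proof -
  obtain t where t: "cps_hom (inv_ring m q) t" "\<And>a. a \<in> inv_ring m q \<Longrightarrow> t a \<in> inv_ring m q"
    and coef_t: "\<And>a. a \<in> inv_ring m q \<Longrightarrow> coef (t a) = \<tau> (coef a)"
    using \<tau> alg_hom_coefE[OF inv_ring.cps_subalgebra_axioms] unfolding is_involution_def cqs_ring_eq
    by blast
  have "t (t a) = a" if "a \<in> inv_ring m q" for a
    using \<tau> that t(2)[OF that] by (simp add: is_involution_def cqs_ring_eq coef_t flip: coef_inject)
  then obtain X Y \<omega> where lift: "lifted_involution m q X Y \<omega>"
    and subst: "\<And>a. a \<in> inv_ring m q \<Longrightarrow> t a = subst a X Y"
    using inv_ring_involution_lift[OF q t] by metis
  interpret lifted_involution m q X Y \<omega> by (rule lift)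
  have fixed: "a \<in> fixed \<longleftrightarrow> a \<in> inv_ring m q \<and> \<tau> (coef a) = coef a" for a
    using subst coef_t by (auto simp: fixed_def simp flip: coef_inject)
  have "fixed \<noteq> inv_ring m q"
    using \<tau> fixed by (auto simp: is_involution_def cqs_ring_eq)
  moreover have "fixed_ring (cqs_ring m q) \<tau> = coef ` fixed"
    by (auto simp: fixed_ring_def cqs_ring_eq fixed)
  ultimately show ?thesis using that lift by blast
qed

theorem theorem5p1:
  fixes m q :: nat and \<tau> :: "ps2 \<Rightarrow> ps2"
  assumes "0 < q" and "q < m" and "coprime q m"
    and "is_involution (cqs_ring m q) \<tau>"
    and "(\<exists>m0 q0. 0 < q0 \<and> q0 < m0 \<and> coprime q0 m0 \<and>
                 alg_iso (fixed_ring (cqs_ring m q) \<tau>) (cqs_ring m0 q0))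
         \<or> alg_iso (fixed_ring (cqs_ring m q) \<tau>) smooth_ring"
  shows "(alg_iso (fixed_ring (cqs_ring m q) \<tau>) smooth_ring \<longrightarrow> q = m - 1) \<and>
         ((alg_iso (fixed_ring (cqs_ring m q) \<tau>) smooth_ring \<and> q = m - 1)
          \<or> alg_iso (fixed_ring (cqs_ring m q) \<tau>) (cqs_ring (2 * m) q)
          \<or> alg_iso (fixed_ring (cqs_ring m q) \<tau>) (cqs_ring (2 * m) (m + q))
          \<or> alg_iso (fixed_ring (cqs_ring m q) \<tau>) (cqs_ring m (2 * q))
          \<or> (even m \<and> alg_iso (fixed_ring (cqs_ring m q) \<tau>) (cqs_ring (m div 2) q))
          \<or> (alg_iso (fixed_ring (cqs_ring m q) \<tau>)
               (cqs_ring (m div gcd (q + 1) m) ((q + 1) div gcd (q + 1) m))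
             \<and> [q ^ 2 = 1] (mod m) \<and> q \<noteq> m - 1))"
proof -
  obtain X Y \<omega> where "lifted_involution m q X Y \<omega>"
    and nontrivial: "lifted_involution.fixed m q X Y \<noteq> inv_ring m q"
    and fixed: "fixed_ring (cqs_ring m q) \<tau> = coef ` lifted_involution.fixed m q X Y"
    using is_involution_cqs_ringE[OF assms(1-4)] .
  then interpret lifted_involution m q X Y \<omega> by simp
  have iso: "alg_iso (fixed_ring (cqs_ring m q) \<tau>) (cqs_ring n p) \<longleftrightarrow> cps_iso fixed (inv_ring n p)"
    for n p
    unfolding fixed cqs_ring_eq[of n p] by (rule alg_iso_coef_iff[OF cps_subalgebra_fixed])
  have smooth: "alg_iso (fixed_ring (cqs_ring m q) \<tau>) smooth_ring \<longleftrightarrow> cps_iso fixed UNIV"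
    unfolding fixed smooth_ring_eq by (rule alg_iso_coef_iff[OF cps_subalgebra_fixed])
  show ?thesis
    using smooth_quotient_imp[OF nontrivial] quotient_classification[OF nontrivial] assms(5)
    unfolding iso smooth by blast
qed

end
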